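(* Let $1\le p,q<\infty$. There exists a constant $C>0$, independent of $f$, such that $$\|\hat f|_{\mathbb{T}^2}\|_{L^q(\mathbb{T}^2,d\sigma)}:=\left(\int_{\mathbb{T}^2}|\hat f(\xi_1,\xi_2,\eta_1,\eta_2)|^q\,d\sigma(\xi_1,\xi_2,\eta_1,\eta_2)\right)^{1/q}\le C\,\|f\|_{L^p(\mathbb{R}^4)}$$ for all $f\in L^p(\mathbb{R}^4)$ if and only if $1\le p<\frac43$ and $q\le p'/3$.
   Context: The 2-torus is the subset $\mathbb{T}^2=\{(x_1,x_2,y_1,y_2)\in\mathbb{R}^4: x_1^2+x_2^2=1,\ y_1^2+y_2^2=1\}=\mathbb{S}^1\times\mathbb{S}^1$ of $\mathbb{R}^4$. It carries the product surface measure $d\sigma(\xi_1,\xi_2,\eta_1,\eta_2)=d\sigma(\xi_1,\xi_2)\,d\sigma(\eta_1,\eta_2)$, where on $\mathbb{S}^1$ the measure $d\sigma$ is arc length normalized to total mass 1, i.e. $d\sigma(\xi_1,\xi_2)=d\varkappa$ for $(\xi_1,\xi_2)=(\cos 2\pi\varkappa,\sin 2\pi\varkappa)$, $0\le\varkappa<1$. The Fourier transform on $\mathbb{R}^4$ is $\hat f(\xi)=\int_{\mathbb{R}^4}e^{-2\pi i x\cdot\xi}f(x)\,dx$. The conjugate exponent is $p'=p/(p-1)$, with $p'=\infty$ if $p=1$ (in which case $q\le p'/3$ imposes no restriction on $q<\infty$). Meaning of the estimate for $f\in L^p$: since $\mathbb{T}^2$ is a null set, the inequality is understood as an a priori estimate,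 i.e. it holds with one constant $C=C(p,q)$ for all $f\in C_c^\infty(\mathbb{R}^4)$ (complex-valued), a dense subspace of $L^p(\mathbb{R}^4)$; equivalently, the restriction map $f\mapsto\hat f|_{\mathbb{T}^2}$ extends from $C_c^\infty(\mathbb{R}^4)$ to a bounded operator $L^p(\mathbb{R}^4)\to L^q(\mathbb{T}^2,d\sigma)$. *)

theory Defs
  imports "HOL-Analysis.Analysis" "HOL-Probability.Probability_Measure"
begin

text \<open>
  \<open>C_k k f\<close>: all iterated directional derivatives of \<open>f\<close> up to order \<open>k\<close> exist and are continuous
  (for \<open>k = 0\<close> just continuity).
\<close>

primrec C_k :: "nat \<Rightarrow> ('a::euclidean_space \<Rightarrow> 'b::real_normed_vector) \<Rightarrow> bool" where
  "C_k 0 f \<longleftrightarrow> continuous_on UNIV f"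
| "C_k (Suc k) f \<longleftrightarrow> (\<forall>x. f differentiable (at x)) \<and> (\<forall>v. C_k k (\<lambda>x. frechet_derivative f (at x) v))"

definition smooth :: "('a::euclidean_space \<Rightarrow> 'b::real_normed_vector) \<Rightarrow> bool" where
  "smooth f \<longleftrightarrow> (\<forall>k. C_k k f)"

definition test_functions :: "('a::euclidean_space \<Rightarrow> complex) set" where
  "test_functions = {f. smooth f \<and> compact (closure {x. f x \<noteq> 0})}"

definition fourier :: "('a::euclidean_space \<Rightarrow> complex) \<Rightarrow> 'a \<Rightarrow> complex" where
  "fourier f \<xi> = (LINT x|lborel. exp (- (2 * of_real pi * \<i> * of_real (x \<bullet> \<xi>))) * f x)"

text \<open>
  Only meaningful when \<open>|f|\<^sup>p\<close> is integrable, since the Bochner integral of a non-integrable function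
  is \<open>0\<close>.  Intended for test functions, and for their (continuous) Fourier transforms on a
  compact set.
\<close>

definition Lp_norm :: "real \<Rightarrow> 'a measure \<Rightarrow> ('a \<Rightarrow> complex) \<Rightarrow> real" where
  "Lp_norm p M f = (LINT x|M. norm (f x) powr p) powr (1 / p)"

definition conj_exponent :: "real \<Rightarrow> ereal" where
  "conj_exponent p = (if p = 1 then \<infinity> else ereal (p / (p - 1)))"

definition torus2 :: "(real^4) set" where
  "torus2 = {x. (x$1)\<^sup>2 + (x$2)\<^sup>2 = 1 \<and> (x$3)\<^sup>2 + (x$4)\<^sup>2 = 1}"

definition circle_param :: "real \<Rightarrow> real^2" where
  "circle_param t = vector [cos (2 * pi * t), sin (2 * pi * t)]"

definition circle_measure :: "(real^2) measure" where
  "circle_measure =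
     distr (restrict_space lborel {0..<1}) (restrict_space borel (sphere 0 1)) circle_param"

definition join22 :: "(real^2) \<times> (real^2) \<Rightarrow> real^4" where
  "join22 z = vector [fst z $ 1, fst z $ 2, snd z $ 1, snd z $ 2]"

definition torus_measure :: "(real^4) measure" where
  "torus_measure =
     distr (circle_measure \<Otimes>\<^sub>M circle_measure) (restrict_space borel torus2) join22"

text \<open>
  \<^const>\<open>distr\<close> is a push-forward only along measurable maps; the lemmas below show this for
  the two maps above, and that both measures have total mass 1.
\<close>

lemma norm_eq_1_iff_2: "norm (x::real^2) = 1 \<longleftrightarrow> (x$1)\<^sup>2 + (x$2)\<^sup>2 = 1"
  by (simp add: norm_vec_def L2_set_def UNIV_2)

lemma vector_4_nth [simp]:
  "(vector [a, b, c, d] :: 'a::zero^4) $ 1 = a" "(vector [a, b, c, d] :: 'a^4) $ 2 = b"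
  "(vector [a, b, c, d] :: 'a^4) $ 3 = c" "(vector [a, b, c, d] :: 'a^4) $ 4 = d"
  by (simp_all add: vector_def)

lemma circle_param_measurable:
  "circle_param \<in> restrict_space lborel {0..<1} \<rightarrow>\<^sub>M restrict_space borel (sphere 0 1)"
proof (rule measurable_restrict_space2)
  show "circle_param \<in> space (restrict_space lborel {0..<1}) \<rightarrow> sphere 0 1"
    by (auto simp: circle_param_def norm_eq_1_iff_2)
  have "continuous_on UNIV (\<lambda>t. circle_param t $ i)" for i
    using exhaust_2 [of i]
    by (elim disjE; simp add: circle_param_def; intro continuous_intros)
  then have "continuous_on UNIV circle_param"
    by (subst continuous_on_componentwise) (auto simp: Basis_vec_def inner_axis)
  then show "circle_param \<in> restrict_space lborel {0..<1} \<rightarrow>\<^sub>M borel"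
    by (intro measurable_restrict_space1) (simp add: borel_measurable_continuous_onI)
qed

lemma prob_space_circle_measure: "prob_space circle_measure"
  unfolding circle_measure_def
  by (intro prob_space.prob_space_distr circle_param_measurable prob_spaceI)
     (simp add: emeasure_restrict_space space_restrict_space)

lemma join22_measurable:
  "join22 \<in> circle_measure \<Otimes>\<^sub>M circle_measure \<rightarrow>\<^sub>M restrict_space borel torus2"
proof (rule measurable_restrict_space2)
  show "join22 \<in> space (circle_measure \<Otimes>\<^sub>M circle_measure) \<rightarrow> torus2"
    by (auto simp: circle_measure_def space_pair_measure space_restrict_space join22_def torus2_def
        norm_eq_1_iff_2)
  have id: "(\<lambda>x. x) \<in> circle_measure \<rightarrow>\<^sub>M borel"
    unfolding circle_measure_def measurable_distr_eq1 by (intro measurable_restrict_space1) simp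
  have c: "(\<lambda>x. x $ i) \<in> circle_measure \<rightarrow>\<^sub>M borel" for i
    by (rule measurable_compose [OF id]) (intro borel_measurable_continuous_onI continuous_intros)
  have "(\<lambda>z. join22 z $ i) \<in> circle_measure \<Otimes>\<^sub>M circle_measure \<rightarrow>\<^sub>M borel" for i
    using exhaust_4 [of i] measurable_compose [OF measurable_fst c]
      measurable_compose [OF measurable_snd c]
    by (auto simp: join22_def)
  then show "join22 \<in> circle_measure \<Otimes>\<^sub>M circle_measure \<rightarrow>\<^sub>M borel"
    by (subst borel_measurable_euclidean_space) (auto simp: Basis_vec_def inner_axis)
qed

lemma prob_space_torus_measure: "prob_space torus_measure"
proof -
  interpret prob_space circle_measure by (rule prob_space_circle_measure)
  interpret pair_prob_space circle_measure circle_measure ..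
  show ?thesis
    unfolding torus_measure_def by (rule prob_space_distr [OF join22_measurable])
qed

end

theory Submission
  imports Defs "HOL-Probability.Characteristic_Functions"
begin

text \<open>
  Sufficiency. By Minkowski's inequality (using \<open>p \<le> q\<close>) the torus estimate follows by applying the
  circle estimate in each of the two variables.  On the circle, interpolation of a weak-type bound with
  the trivial \<open>L\<^sup>1\<close>--\<open>L\<^sup>\<infinity>\<close> bound reduces matters to a bound for the extension operator on functions dominated by
  the indicator of a subset \<open>E\<close> of a quarter arc.  The square of such an extension is the transform of a measure
  on pairs of points.  Near the diagonal it is trivially small; away from it, it is controlled in
  \<open>L\<^sup>2\<close> because the sum map on pairs of angles \<open>s, t\<close> has Jacobian comparable to \<open>\<bar>s - t\<bar>\<close>.  Instead of
  Plancherel's theorem and a change of variables, Schur's test is applied after inserting a Gaussian weight.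

  Necessity. Tensoring with a fixed Gaussian reduces the torus to the circle.  The Knapp example gives
  \<open>q \<le> p' / 3\<close>.  For \<open>p \<ge> 4 / 3\<close>, the estimate would bound the \<open>L\<^sup>4\<close> norm of the transform of the circle
  measure, which is infinite: with a Gaussian weight, its fourth power is an average of
  Gaussians at \<open>a + b - c - d\<close> over points of the circle, which diverges logarithmically.
\<close>

subsection \<open>Smooth functions and cutoffs\<close>

text \<open>The line \<open>q = p' / 3\<close> dictates the exponents. For every
  \<open>P > 4\<close> there is a weak-type bound from the dual exponent \<open>P / (P - 1)\<close>
  into weak \<open>L^(P/3)\<close>; all these pairs, and the trivial pair of exponents 1 and
  infinity, lie on that line, so interpolation between them reaches the endpoint without loss. At
  \<open>P = 4\<close> the kernel \<open>1 / \<bar>s - t\<bar>\<close> is borderline and costs a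
  logarithm. For \<open>P > 4\<close> a small power \<open>\<eta>\<close> of the distance is traded
  against the level and the measure of \<open>E\<close>. The same logarithm drives the
  counterexample for \<open>p \<ge> 4 / 3\<close>. Quarter arcs keep the sums of two points away
  from the origin, so length and direction of a sum serve as coordinates, and
  \<open>\<bar>s - t\<bar>\<close> becomes the weight in Schur's test. Minkowski needs
  \<open>q / p = 1 / (3 * (p - 1)) > 1\<close> at the endpoint, which is exactly
  \<open>p < 4 / 3\<close>; smaller \<open>q\<close> follow because the torus has mass 1. The test
  functions for necessity are not compactly supported, hence the passage to smooth functions with a
  Gaussian majorant.\<close>

lemma C_k_SucI:
  assumes "\<And>x. (f has_derivative f' x) (at x)" "\<And>v. C_k k (\<lambda>x. f' x v)"
  shows "C_k (Suc k) f"
proof -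
  have "frechet_derivative f (at x) = f' x" for x
    using frechet_derivative_at[OF assms(1)] by simp
  then show ?thesis
    using assms by (auto simp: differentiable_def)
qed

lemma C_k_SucD:
  assumes "C_k (Suc k) f"
  shows "(f has_derivative frechet_derivative f (at x)) (at x)"
    and "C_k k (\<lambda>x. frechet_derivative f (at x) v)"
  using assms by (auto simp: frechet_derivative_works)

lemma C_k_Suc_imp: "C_k (Suc k) f \<Longrightarrow> C_k k f"
proof (induction k arbitrary: f)
  case 0
  then show ?case
    by (auto intro: continuous_at_imp_continuous_on differentiable_imp_continuous_within)
next
  case (Suc k)
  then show ?case
    by (metis C_k.simps(2))
qed

lemma C_k_imp_continuous: "C_k k f \<Longrightarrow> continuous_on UNIV f"
  by (induction k) (use C_k_Suc_imp in auto)

lemma C_k_const: "C_k k (\<lambda>x. c)"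
  by (induction k arbitrary: c) (auto intro!: C_k_SucI[where f'="\<lambda>x v. 0"] simp del: C_k.simps(2))

lemma C_k_linear_comp:
  assumes "bounded_linear L" "C_k k f"
  shows "C_k k (\<lambda>x. L (f x))"
  using assms(2)
proof (induction k arbitrary: f)
  case 0
  then show ?case
    using assms(1) by (auto intro: bounded_linear.continuous_on)
next
  case (Suc k)
  show ?case
    by (rule C_k_SucI[OF bounded_linear.has_derivative[OF assms(1) C_k_SucD(1)[OF Suc.prems]]
          Suc.IH[OF C_k_SucD(2)[OF Suc.prems]]])
qed

lemma C_k_comp_linear:
  assumes "bounded_linear L" "C_k k f"
  shows "C_k k (\<lambda>x. f (L x))"
  using assms(2)
proof (induction k arbitrary: f)
  case 0
  then show ?case
    using continuous_on_compose2[of UNIV f UNIV L] linear_continuous_on[OF assms(1)] by simp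
next
  case (Suc k)
  show ?case
    by (rule C_k_SucI[OF has_derivative_compose[OF bounded_linear.has_derivative[OF assms(1) has_derivative_ident]
          C_k_SucD(1)[OF Suc.prems]]
          Suc.IH[OF C_k_SucD(2)[OF Suc.prems]]])
qed

lemma C_k_linear: "bounded_linear L \<Longrightarrow> C_k k L"
proof (cases k)
  case (Suc j)
  assume "bounded_linear L"
  then show ?thesis
    unfolding Suc
    by (intro C_k_SucI[where f'="\<lambda>x. L"] C_k_const)
       (auto intro: bounded_linear_imp_has_derivative)
qed (auto intro: linear_continuous_on)

lemma C_k_add: "C_k k f \<Longrightarrow> C_k k g \<Longrightarrow> C_k k (\<lambda>x. f x + g x)"
proof (induction k arbitrary: f g)
  case (Suc k)
  show ?case
    by (rule C_k_SucI[OF has_derivative_add[OF C_k_SucD(1)[OF Suc.prems(1)] C_k_SucD(1)[OF Suc.prems(2)]]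
         Suc.IH[OF C_k_SucD(2)[OF Suc.prems(1)] C_k_SucD(2)[OF Suc.prems(2)]]])
qed (auto intro: continuous_on_add)

lemma C_k_mult:
  fixes f g :: "'a::euclidean_space \<Rightarrow> 'b::real_normed_algebra"
  shows "C_k k f \<Longrightarrow> C_k k g \<Longrightarrow> C_k k (\<lambda>x. f x * g x)"
proof (induction k arbitrary: f g)
  case (Suc k)
  show ?case
    by (rule C_k_SucI[OF has_derivative_mult[OF C_k_SucD(1)[OF Suc.prems(1)] C_k_SucD(1)[OF Suc.prems(2)]]
         C_k_add[OF Suc.IH[OF C_k_Suc_imp[OF Suc.prems(1)] C_k_SucD(2)[OF Suc.prems(2)]]
          Suc.IH[OF C_k_SucD(2)[OF Suc.prems(1)] C_k_Suc_imp[OF Suc.prems(2)]]]])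
qed (auto intro: continuous_on_mult)

lemma C_k_prod:
  fixes f :: "'i \<Rightarrow> 'a::euclidean_space \<Rightarrow> 'b::real_normed_field"
  assumes "\<And>i. i \<in> I \<Longrightarrow> C_k k (f i)"
  shows "C_k k (\<lambda>x. \<Prod>i\<in>I. f i x)"
  using assms by (induction I rule: infinite_finite_induct) (auto intro: C_k_mult C_k_const)

lemma C_k_exp:
  fixes f :: "'a::euclidean_space \<Rightarrow> 'b::{real_normed_field, banach}"
  shows "C_k k f \<Longrightarrow> C_k k (\<lambda>x. exp (f x))"
proof (induction k)
  case (Suc k)
  have "((\<lambda>x. exp (f x)) has_derivative (\<lambda>v. exp (f x) * frechet_derivative f (at x) v)) (at x)" for x
    using has_derivative_compose[OF C_k_SucD(1)[OF Suc.prems] DERIV_exp[unfolded has_field_derivative_def]]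
    by simp
  then show ?case
    by (rule C_k_SucI) (intro C_k_mult Suc.IH C_k_Suc_imp[OF Suc.prems] C_k_SucD(2)[OF Suc.prems])
qed (auto intro: continuous_on_exp)

text \<open>All powers of \<open>1 / t\<close> are included because differentiating
  \<open>exp (- (1 / t))\<close> produces them. The family is then closed under derivatives, up to
  linear combinations, and one induction over all \<open>n\<close> gives smoothness.\<close>

definition flat :: "nat \<Rightarrow> real \<Rightarrow> real" where
  "flat n t = (if t \<le> 0 then 0 else exp (- (1 / t)) / t ^ n)"

text \<open>A single term of the exponential series at \<open>u = 1 / t\<close> dominates
  \<open>u ^ (n + 2)\<close>. The two spare powers leave a factor \<open>t^2\<close>, enough for the
  difference quotient at 0 to tend to 0.\<close>

lemma flat_bound: "\<bar>flat n t\<bar> \<le> fact (n + 2) * t\<^sup>2"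
proof (cases "t \<le> 0")
  case False
  define u where "u = 1 / t"
  have u: "u > 0" using False by (simp add: u_def)
  have "u ^ (n + 2) / fact (n + 2) \<le> exp u"
  proof -
    have "u ^ (n + 2) / fact (n + 2) = (\<Sum>k\<in>{n+2}. u ^ k /\<^sub>R fact k)"
      by (simp add: divide_inverse mult.commute)
    also have "\<dots> \<le> exp u"
      using u unfolding exp_def by (intro sum_le_suminf summable_exp_generic) auto
    finally show ?thesis .
  qed
  then have "u ^ (n + 2) \<le> fact (n + 2) * exp u"
    by (simp add: field_simps del: fact_Suc)
  moreover have "flat n t = u ^ n * exp (- u)" "t = 1 / u"
    using False by (auto simp: flat_def u_def power_divide)
  moreover have "u ^ n * exp (- u) = u ^ (n + 2) / exp u * (1 / u)\<^sup>2"
    using u by (simp add: exp_minus field_simps power2_eq_square power_add)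
  ultimately have "flat n t \<le> fact (n + 2) * t\<^sup>2"
    using u by (simp only:) (intro mult_right_mono, simp_all add: divide_le_eq del: fact_Suc)
  then show ?thesis
    using False by (simp add: flat_def)
qed (simp add: flat_def)

lemma flat_derivative:
  "(flat n has_real_derivative (- real n * flat (Suc n) t + flat (n + 2) t)) (at t)"
proof (cases t "0::real" rule: linorder_cases)
  case less
  have "((\<lambda>_. 0) has_real_derivative (- real n * flat (Suc n) t + flat (n + 2) t)) (at t)"
    using less by (simp add: flat_def)
  then show ?thesis
    by (rule has_field_derivative_transform_within_open[of _ _ _ "{..<0}"]) (use less in \<open>auto simp: flat_def\<close>)
next
  case greater
  have "((\<lambda>t. exp (- (1 / t)) / t ^ n) has_real_derivative (- real n * flat (Suc n) t + flat (n + 2) t)) (at t)"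
  proof -
    have "real n * t ^ (n - 1) = real n * t ^ n / t"
      using greater by (cases n) auto
    then have "((\<lambda>t. t ^ n) has_real_derivative real n * t ^ n / t) (at t)"
      by (auto intro!: derivative_eq_intros)
    moreover have "((\<lambda>t. exp (- (1 / t))) has_real_derivative exp (- (1 / t)) / t\<^sup>2) (at t)"
      using greater by (auto intro!: derivative_eq_intros simp: field_simps power2_eq_square)
    ultimately have "((\<lambda>t. exp (- (1 / t)) / t ^ n) has_real_derivative
        (exp (- (1 / t)) / t\<^sup>2 * t ^ n - exp (- (1 / t)) * (real n * t ^ n / t)) / (t ^ n * t ^ n)) (at t)"
      using greater by (intro DERIV_divide) auto
    then show ?thesis
      by (rule DERIV_cong) (use greater in \<open>simp add: flat_def field_simps power2_eq_square power_add\<close>)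
  qed
  then show ?thesis
    by (rule has_field_derivative_transform_within_open[of _ _ _ "{0<..}"]) (use greater in \<open>auto simp: flat_def\<close>)
next
  case equal
  have "((\<lambda>h. (flat n (0 + h) - flat n 0) / h) \<longlongrightarrow> 0) (at 0)"
  proof (rule Lim_null_comparison)
    show "\<forall>\<^sub>F h in at 0. norm ((flat n (0 + h) - flat n 0) / h) \<le> fact (n + 2) * \<bar>h\<bar>"
    proof (rule eventuallyI)
      fix h :: real
      show "norm ((flat n (0 + h) - flat n 0) / h) \<le> fact (n + 2) * \<bar>h\<bar>"
        using flat_bound[of n h]
        by (cases "h = 0") (auto simp: flat_def[of n 0] abs_divide divide_le_eq power2_eq_square
            abs_mult_self_eq mult.assoc simp del: fact_Suc)
    qed
    show "((\<lambda>h. fact (n + 2) * \<bar>h\<bar>) \<longlongrightarrow> (0::real)) (at 0)"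
      by (auto intro!: tendsto_eq_intros)
  qed
  then show ?thesis
    using equal by (simp add: DERIV_def flat_def[of _ 0])
qed

lemma C_k_flat: "C_k k (flat n)"
proof (induction k arbitrary: n)
  case 0
  show ?case
    by (auto intro!: continuous_at_imp_continuous_on DERIV_isCont flat_derivative)
next
  case (Suc k)
  show ?case
    by (rule C_k_SucI[OF flat_derivative[unfolded has_field_derivative_def]])
       (intro C_k_mult C_k_add C_k_const Suc.IH)
qed

text \<open>A product over the coordinates of a bump supported in \<open>[-1, 1]\<close>. The value
  at the origin is not normalised to 1; it is a nonzero constant that is divided out when dilated
  copies serve as truncations.\<close>

lemma smooth_cutoff_exists:
  obtains c :: "'a::euclidean_space \<Rightarrow> complex"
  where "smooth c" "\<And>x. norm (c x) \<le> 1" "c 0 \<noteq> 0" "bounded {x. c x \<noteq> 0}"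
proof
  define b :: "real \<Rightarrow> real" where "b t = flat 0 (1 + t) * flat 0 (1 + - t)" for t
  define c :: "'a \<Rightarrow> complex" where "c x = (\<Prod>i\<in>Basis. of_real (b (x \<bullet> i)))" for x
  have fl: "0 \<le> flat 0 t" "flat 0 t \<le> 1" for t
    by (auto simp: flat_def)
  have b01: "0 \<le> b t" "b t \<le> 1" for t
    using fl by (auto simp: b_def intro: mult_le_one)
  have Ckb: "C_k k b" for k
  proof -
    have aux: "C_k k (\<lambda>t. flat 0 (1 + L t))" if "bounded_linear L" for L
    proof -
      have "C_k k (\<lambda>t. flat 0 (1 + t))"
      proof -
        \<comment> \<open>The shift is affine rather than linear, so \<open>C_k_comp_linear\<close>
          does not cover it; the induction for \<open>flat\<close> is repeated at the shifted
          point.\<close>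
        have "C_k k (\<lambda>t. flat n (1 + t))" for n
        proof (induction k arbitrary: n)
          case 0
          show ?case
            by (auto intro!: continuous_on_compose2[OF C_k_imp_continuous[OF C_k_flat[of 0]]] continuous_intros)
        next
          case (Suc k)
          have "((\<lambda>t. flat n (1 + t)) has_real_derivative
              (- real n * flat (Suc n) (1 + t) + flat (n + 2) (1 + t))) (at t)" for t
            using DERIV_shift[of "flat n" _ t 1] flat_derivative[of n "t + 1"] by (simp add: add.commute)
          then show ?case
            unfolding has_field_derivative_def
            by (rule C_k_SucI) (intro C_k_mult C_k_add C_k_const Suc.IH)
        qed
        then show ?thesis .
      qed
      then show ?thesis by (rule C_k_comp_linear[OF that])
    qed
    show ?thesis
      unfolding b_def
      by (intro C_k_mult aux[OF bounded_linear_ident] aux[OF bounded_linear_minus[OF bounded_linear_ident]])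
  qed
  show "smooth c"
    unfolding smooth_def c_def
    by (intro allI C_k_prod C_k_linear_comp[OF bounded_linear_of_real] C_k_comp_linear[OF bounded_linear_inner_left] Ckb)
  have "norm (c x) = (\<Prod>i\<in>Basis. b (x \<bullet> i))" for x
    using b01 by (simp add: c_def prod_norm [symmetric])
  then show "norm (c x) \<le> 1" for x
    using b01 by (auto intro: prod_le_1)
  show "c 0 \<noteq> 0"
    by (simp add: c_def b_def flat_def)
  have "{x. c x \<noteq> 0} \<subseteq> cbox (- One) One"
  proof clarsimp
    fix x assume x: "c x \<noteq> 0"
    have "\<bar>x \<bullet> i\<bar> \<le> 1" if "i \<in> Basis" for i
    proof -
      have "b (x \<bullet> i) \<noteq> 0" using x that by (auto simp: c_def)
      then show ?thesis by (auto simp: b_def flat_def split: if_splits)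
    qed
    then show "x \<in> cbox (- One) One"
      by (force simp: mem_box)
  qed
  then show "bounded {x. c x \<noteq> 0}"
    using bounded_subset[OF bounded_cbox] by blast
qed

subsection \<open>The Gaussian kernel on sums of two points of an arc\<close>

text \<open>The plane is a product type and angles are fractions of a full turn, so that Fubini for
  \<open>lborel\<close> applies directly and \<open>[0, 1)\<close> carries normalised arc
  length.\<close>

definition circ :: "real \<Rightarrow> real \<times> real" where
  "circ t = (cos (2 * pi * t), sin (2 * pi * t))"

text \<open>The Fourier transform of the Gaussian weight \<open>gauss \<epsilon>\<close>: an
  approximate identity in the plane, of total mass 1 and width
  \<open>sqrt \<epsilon>\<close>.\<close>

definition kern :: "real \<Rightarrow> real \<times> real \<Rightarrow> real" where
  "kern \<epsilon> v = exp (- (pi * (norm v)\<^sup>2 / \<epsilon>)) / \<epsilon>"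

lemma circ_measurable [measurable]: "circ \<in> borel_measurable borel"
  unfolding circ_def by measurable

lemma kern_measurable [measurable]: "kern \<epsilon> \<in> borel_measurable borel"
  unfolding kern_def by measurable

lemma kern_nonneg: "\<epsilon> > 0 \<Longrightarrow> 0 \<le> kern \<epsilon> v"
  by (simp add: kern_def)

section \<open>Elementary estimates and the geometry of sums of two circle points\<close>

lemma sin_ge_half: "x / 2 \<le> sin x" if "0 \<le> x" "x \<le> pi / 2" for x :: real
proof (cases "x \<le> pi / 3")
  case True
  have "sin 0 - 0 / 2 \<le> sin x - x / 2"
  proof (rule DERIV_nonneg_imp_nondecreasing [OF that(1)])
    fix y assume "0 \<le> y" "y \<le> x"
    then have "cos (pi / 3) \<le> cos y"
      using True by (intro cos_monotone_0_pi_le) auto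
    then show "\<exists>d. ((\<lambda>x. sin x - x / 2) has_real_derivative d) (at y) \<and> 0 \<le> d"
      by (intro exI[of _ "cos y - 1 / 2"]) (auto intro!: derivative_eq_intros simp: cos_60)
  qed
  then show ?thesis by simp
next
  case False
  have "sin (pi / 3) \<le> sin x"
    using False that by (intro sin_monotone_2pi_le) auto
  moreover have "x / 2 \<le> 4 / 5"
    using that(2) pi_approx by simp
  moreover have "4 / 5 \<le> sin (pi / 3)"
    unfolding sin_60 using real_le_rsqrt[of "8 / 5" 3] by (simp add: power2_eq_square)
  ultimately show ?thesis by linarith
qed

lemma one_minus_cos_ge: "4 * x\<^sup>2 \<le> 1 - cos (2 * pi * x)" if "\<bar>x\<bar> \<le> 1 / 2" for x :: real
proof -
  have "pi * \<bar>x\<bar> / 2 \<le> sin (pi * \<bar>x\<bar>)"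
    using that by (intro sin_ge_half) (auto simp: field_simps)
  then have "(pi * \<bar>x\<bar> / 2)\<^sup>2 \<le> (sin (pi * \<bar>x\<bar>))\<^sup>2"
    by (intro power_mono) auto
  also have "(sin (pi * \<bar>x\<bar>))\<^sup>2 = (sin (pi * x))\<^sup>2"
    by (cases "x \<ge> 0") (auto simp: abs_if)
  finally have "pi\<^sup>2 * x\<^sup>2 / 2 \<le> 2 * (sin (pi * x))\<^sup>2"
    by (simp add: power_mult_distrib power_divide)
  moreover have "cos (2 * pi * x) = 1 - 2 * (sin (pi * x))\<^sup>2"
    using cos_double_sin[of "pi * x"] by (simp add: mult.assoc)
  moreover have "8 * x\<^sup>2 \<le> pi\<^sup>2 * x\<^sup>2"
  proof (rule mult_right_mono)
    have "3\<^sup>2 \<le> pi\<^sup>2" using pi_gt3 by (intro power_mono) auto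
    then show "8 \<le> pi\<^sup>2" by simp
  qed simp
  ultimately show ?thesis by linarith
qed

lemma gauss_nn_integral:
  fixes m :: real
  assumes "\<epsilon> > 0"
  shows "(\<integral>\<^sup>+x. ennreal (exp (- (pi * (x - m)\<^sup>2 / \<epsilon>)) / sqrt \<epsilon>) \<partial>lborel) = 1"
proof -
  define \<sigma> where "\<sigma> = sqrt (\<epsilon> / (2 * pi))"
  have \<sigma>: "\<sigma> > 0" "2 * \<sigma>\<^sup>2 = \<epsilon> / pi" "2 * pi * \<sigma>\<^sup>2 = \<epsilon>"
    using assms by (auto simp: \<sigma>_def)
  have "normal_density m \<sigma> x = exp (- (pi * (x - m)\<^sup>2 / \<epsilon>)) / sqrt \<epsilon>" for x
    unfolding normal_density_def \<sigma> by (simp add: field_simps)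
  then have "(\<integral>\<^sup>+x. ennreal (exp (- (pi * (x - m)\<^sup>2 / \<epsilon>)) / sqrt \<epsilon>) \<partial>lborel)
      = (\<integral>\<^sup>+x. ennreal (normal_density m \<sigma> x) \<partial>lborel)"
    by simp
  also have "\<dots> = ennreal (\<integral>x. normal_density m \<sigma> x \<partial>lborel)"
    using \<sigma> by (intro nn_integral_eq_integral) auto
  finally show ?thesis using \<sigma> by simp
qed

text \<open>The unit window for the angle is free, so that the direction of \<open>v\<close> can
  later be compared with the midpoint angles of a given arc up to at most one turn.\<close>

lemma polar_unit_interval:
  fixes v :: "real \<times> real" and a :: real
  obtains r b where "r \<ge> 0" "v = (r * cos (2 * pi * b), r * sin (2 * pi * b))" "a \<le> b" "b \<le> a + 1"
proof -
  obtain r \<phi> where "Complex (fst v) (snd v) = rcis r \<phi>" "r \<ge> 0"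
    using rcis_Ex[of "Complex (fst v) (snd v)"] rcis_cmod_Arg norm_ge_zero by metis
  then have r: "fst v = r * cos \<phi>" "snd v = r * sin \<phi>"
    by (metis Re_rcis complex.sel(1), metis Im_rcis complex.sel(2))
  define n where "n = \<lceil>a - \<phi> / (2 * pi)\<rceil>"
  define b where "b = \<phi> / (2 * pi) + of_int n"
  have "2 * pi * b = \<phi> + (2 * pi) * of_int n"
    by (simp add: b_def field_simps)
  then have "cos (2 * pi * b) = cos \<phi>" "sin (2 * pi * b) = sin \<phi>"
    by (simp_all add: cos_add sin_add cos_int_2pin sin_int_2pin)
  moreover have "a \<le> b" "b \<le> a + 1"
    unfolding b_def n_def by linarith+
  ultimately show ?thesis
    using that[of r b] r \<open>r \<ge> 0\<close> by (simp add: prod_eq_iff)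
qed

text \<open>The sum of two circle points has signed length \<open>2 * cos (pi * (s - t))\<close> and
  the direction of the midpoint angle \<open>(s + t) / 2\<close>; the formula is the law of cosines
  against a vector of length \<open>r\<close> at angle \<open>b\<close>. Difference and midpoint
  thus act as radius and angle of the sum.\<close>

lemma circ_sum_dist:
  assumes "v = (r * cos (2 * pi * b), r * sin (2 * pi * b))"
  shows "(norm (v - circ s - circ t))\<^sup>2 = (r - 2 * cos (pi * (s - t)))\<^sup>2
     + 2 * r * (2 * cos (pi * (s - t))) * (1 - cos (2 * pi * ((s + t) / 2 - b)))"
proof -
  have n: "(norm (x, y))\<^sup>2 = x\<^sup>2 + y\<^sup>2" for x y :: real
    by (simp add: norm_Pair)
  have expand: "(r * a - b - c)\<^sup>2 + (r * d - e - f)\<^sup>2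
      = r\<^sup>2 * (a\<^sup>2 + d\<^sup>2) + (b\<^sup>2 + e\<^sup>2) + (c\<^sup>2 + f\<^sup>2)
        + 2 * (b * c + e * f) - 2 * r * (b * a + e * d + (c * a + f * d))" for a b c d e f :: real
    by (simp add: power2_eq_square algebra_simps)
  have half: "cos x = 2 * (cos (x / 2))\<^sup>2 - 1" for x :: real
    using cos_double_cos[of "x / 2"] by simp
  define \<alpha> \<beta> \<phi> where "\<alpha> = 2 * pi * s" "\<beta> = 2 * pi * t" "\<phi> = 2 * pi * b"
  have 1: "(norm (v - circ s - circ t))\<^sup>2
      = (r * cos \<phi> - cos \<alpha> - cos \<beta>)\<^sup>2 + (r * sin \<phi> - sin \<alpha> - sin \<beta>)\<^sup>2"
    unfolding assms circ_def \<alpha>_\<beta>_\<phi>_def by (simp add: n)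
  also have "\<dots> = r\<^sup>2 * ((cos \<phi>)\<^sup>2 + (sin \<phi>)\<^sup>2) + ((cos \<alpha>)\<^sup>2 + (sin \<alpha>)\<^sup>2) + ((cos \<beta>)\<^sup>2 + (sin \<beta>)\<^sup>2)
      + 2 * (cos \<alpha> * cos \<beta> + sin \<alpha> * sin \<beta>)
      - 2 * r * (cos \<alpha> * cos \<phi> + sin \<alpha> * sin \<phi> + (cos \<beta> * cos \<phi> + sin \<beta> * sin \<phi>))"
    by (rule expand)
  also have "\<dots> = r\<^sup>2 + 2 + 2 * cos (\<alpha> - \<beta>) - 2 * r * (cos (\<alpha> - \<phi>) + cos (\<beta> - \<phi>))"
    by (simp only: cos_diff sin_cos_squared_add2)
  finally have 2: "(norm (v - circ s - circ t))\<^sup>2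
      = r\<^sup>2 + 2 + 2 * cos (\<alpha> - \<beta>) - 2 * r * (cos (\<alpha> - \<phi>) + cos (\<beta> - \<phi>))" .
  have 3: "cos (\<alpha> - \<phi>) + cos (\<beta> - \<phi>) = 2 * cos ((\<alpha> + \<beta>) / 2 - \<phi>) * cos ((\<alpha> - \<beta>) / 2)"
    by (simp add: cos_plus_cos field_simps)
  have 4: "cos (\<alpha> - \<beta>) = 2 * (cos ((\<alpha> - \<beta>) / 2))\<^sup>2 - 1"
    by (rule half)
  have 5: "(\<alpha> - \<beta>) / 2 = pi * (s - t)" "(\<alpha> + \<beta>) / 2 - \<phi> = 2 * pi * ((s + t) / 2 - b)"
    by (simp_all add: \<alpha>_\<beta>_\<phi>_def field_simps)
  show ?thesis
    unfolding 2 3 4 5 by (simp add: power2_eq_square algebra_simps)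
qed

text \<open>When both lengths are at least 1, the squared distance dominates a radial square plus an
  angular square, and the Gaussian factorises. The angular factor is written in terms of
  \<open>t\<close> and \<open>s - t\<close>, ready for integration over \<open>t\<close> with the
  difference frozen.\<close>

lemma kern_bound_near:
  assumes "v = (r * cos (2 * pi * b), r * sin (2 * pi * b))" "r \<ge> 1" "\<epsilon> > 0"
    "\<bar>s - t\<bar> \<le> 1 / 4" "\<bar>(s + t) / 2 - b\<bar> \<le> 1"
  shows "kern \<epsilon> (v - circ s - circ t) \<le> exp (- (pi * (r - 2 * cos (pi * (s - t)))\<^sup>2 / \<epsilon>)) / sqrt \<epsilon>
     * (\<Sum>k\<in>{-1,0,1}. exp (- (pi * (t - (b + k - (s - t) / 2))\<^sup>2 / \<epsilon>)) / sqrt \<epsilon>)"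
proof -
  define u where "u = (s + t) / 2 - b"
  define \<rho> where "\<rho> = 2 * cos (pi * (s - t))"
  have \<rho>: "\<rho> \<ge> 1"
  proof -
    have "pi * \<bar>s - t\<bar> \<le> pi / 3" using assms(4) by (auto simp: field_simps)
    then have "cos (pi / 3) \<le> cos (pi * \<bar>s - t\<bar>)" by (intro cos_monotone_0_pi_le) auto
    also have "\<dots> = cos (pi * (s - t))"
      using cos_abs_real[of "pi * (s - t)"] by (simp add: abs_mult)
    finally show ?thesis by (simp add: \<rho>_def cos_60)
  qed
  \<comment> \<open>The angle \<open>u\<close> matters only modulo full turns, and
    \<open>\<bar>u\<bar> \<le> 1\<close> leaves three candidates for the nearest turn.\<close>
  obtain k where k: "k \<in> {-1, 0, 1::real}" "\<bar>u - k\<bar> \<le> 1 / 2"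
  proof (cases "\<bar>u\<bar> \<le> 1 / 2")
    case False
    then show ?thesis
      using assms(5) that[of 1] that[of "-1"] by (cases "u \<ge> 0") (auto simp: u_def)
  qed (use that[of 0] in auto)
  have "cos (2 * pi * u) = cos (2 * pi * (u - k))"
  proof -
    have "2 * pi * (u - 1) = 2 * pi * u - 2 * pi" "2 * pi * (u - (-1)) = 2 * pi * u + 2 * pi"
      by (simp_all add: algebra_simps)
    then show ?thesis
      using k(1) cos_periodic[of "2 * pi * u"] cos_periodic[of "2 * pi * u - 2 * pi"] by auto
  qed
  then have "4 * (u - k)\<^sup>2 \<le> 1 - cos (2 * pi * u)"
    using one_minus_cos_ge[OF k(2)] by simp
  moreover have "1 \<le> r * \<rho>"
    using mult_mono[of 1 r 1 \<rho>] assms(2) \<rho> by simp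
  ultimately have 1: "1 * (4 * (u - k)\<^sup>2) \<le> (r * \<rho>) * (1 - cos (2 * pi * u))"
    by (intro mult_mono) auto
  have aux: "w \<le> 2 * r * \<rho> * c" if "1 * (4 * w) \<le> (r * \<rho>) * c" "0 \<le> w" for w c
    using that by simp
  have "(u - k)\<^sup>2 \<le> 2 * r * \<rho> * (1 - cos (2 * pi * u))"
    by (rule aux[OF 1 zero_le_power2])
  then have "(r - \<rho>)\<^sup>2 + (u - k)\<^sup>2 \<le> (norm (v - circ s - circ t))\<^sup>2"
    unfolding circ_sum_dist[OF assms(1)] \<rho>_def[symmetric] u_def[symmetric] by (rule add_left_mono)
  then have "kern \<epsilon> (v - circ s - circ t) \<le> exp (- (pi * ((r - \<rho>)\<^sup>2 + (u - k)\<^sup>2) / \<epsilon>)) / \<epsilon>"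
    using assms(3) by (auto simp: kern_def intro!: divide_right_mono mult_left_mono)
  also have "\<dots> = exp (- (pi * (r - \<rho>)\<^sup>2 / \<epsilon>)) / sqrt \<epsilon> * (exp (- (pi * (t - (b + k - (s - t) / 2))\<^sup>2 / \<epsilon>)) / sqrt \<epsilon>)"
  proof -
    have "t - (b + k - (s - t) / 2) = u - k" by (simp add: u_def field_simps)
    moreover have "exp (- (pi * (X + Y) / \<epsilon>)) / \<epsilon> = exp (- (pi * X / \<epsilon>)) / sqrt \<epsilon> * (exp (- (pi * Y / \<epsilon>)) / sqrt \<epsilon>)" for X Y
    proof -
      have "- (pi * (X + Y) / \<epsilon>) = - (pi * X / \<epsilon>) + - (pi * Y / \<epsilon>)"
        by (simp add: distrib_left add_divide_distrib)
      moreover have "sqrt \<epsilon> * sqrt \<epsilon> = \<epsilon>" using assms(3) by simp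
      ultimately show ?thesis by (simp only: exp_add times_divide_times_eq)
    qed
    ultimately show ?thesis by (simp only:)
  qed
  also have "\<dots> \<le> exp (- (pi * (r - \<rho>)\<^sup>2 / \<epsilon>)) / sqrt \<epsilon> *
     (\<Sum>k\<in>{-1,0,1}. exp (- (pi * (t - (b + k - (s - t) / 2))\<^sup>2 / \<epsilon>)) / sqrt \<epsilon>)"
    using k(1) assms(3)
    by (intro mult_left_mono member_le_sum[of k]) auto
  finally show ?thesis unfolding \<rho>_def .
qed

text \<open>The radius \<open>2 * cos (pi * d)\<close> has a derivative of size
  \<open>\<bar>d\<bar>\<close> near 0. The weight \<open>\<bar>d\<bar>\<close> is dominated by this
  Jacobian, so substituting the radius leaves at most the mass of a Gaussian, one half from each
  sign of \<open>d\<close>.\<close>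

lemma radial_integral_bound:
  assumes "\<epsilon> > 0"
  shows "(\<integral>\<^sup>+d\<in>{-1/4..1/4}. ennreal (\<bar>d\<bar> * (exp (- (pi * (r - 2 * cos (pi * d))\<^sup>2 / \<epsilon>)) / sqrt \<epsilon>)) \<partial>lborel) \<le> 1"
proof -
  \<comment> \<open>The substitution uses \<open>y = - 2 * cos (pi * d)\<close>, which is increasing
    on \<open>[0, 1/4]\<close>; this is why the Gaussian is centred at \<open>- r\<close>.\<close>
  define f where "f y = exp (- (pi * (y - (- r))\<^sup>2 / \<epsilon>)) / sqrt \<epsilon>" for y :: real
  have [measurable]: "f \<in> borel_measurable borel" unfolding f_def by measurable
  have f0: "f y \<ge> 0" for y using assms by (simp add: f_def)
  define h where "h d = ennreal (d * f (- 2 * cos (pi * d))) * indicator {0..1/4} d" for d :: real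
  have [measurable]: "h \<in> borel_measurable borel" unfolding h_def by measurable
  have "(\<integral>\<^sup>+d\<in>{-1/4..1/4}. ennreal (\<bar>d\<bar> * (exp (- (pi * (r - 2 * cos (pi * d))\<^sup>2 / \<epsilon>)) / sqrt \<epsilon>)) \<partial>lborel)
      \<le> (\<integral>\<^sup>+d. h d + h (0 + (-1) * d) \<partial>lborel)"
    by (intro nn_integral_mono) (auto simp: h_def f_def indicator_def add.commute)
  also have "\<dots> = (\<integral>\<^sup>+d. h d \<partial>lborel) + (\<integral>\<^sup>+d. h (0 + (-1) * d) \<partial>lborel)"
    by (rule nn_integral_add) auto
  also have "(\<integral>\<^sup>+d. h (0 + (-1) * d) \<partial>lborel) = (\<integral>\<^sup>+d. h d \<partial>lborel)"
    using nn_integral_real_affine[of h "-1" 0] by simp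
  also have "(\<integral>\<^sup>+d. h d \<partial>lborel) \<le> (\<integral>\<^sup>+d. ennreal (1/2) * (ennreal (f (- 2 * cos (pi * d)) * (2 * pi * sin (pi * d)) * indicator {0..1/4} d)) \<partial>lborel)"
  proof (intro nn_integral_mono)
    fix d :: real
    show "h d \<le> ennreal (1/2) * (ennreal (f (- 2 * cos (pi * d)) * (2 * pi * sin (pi * d)) * indicator {0..1/4} d))"
    proof (cases "d \<in> {0..1/4}")
      case True
      then have "pi * d / 2 \<le> sin (pi * d)"
        by (intro sin_ge_half) (auto simp: field_simps)
      then have 1: "pi * (pi * d / 2) \<le> pi * sin (pi * d)"
        by (intro mult_left_mono) auto
      have "2 * 1 \<le> pi * pi"
        by (rule mult_mono) (use pi_gt3 in auto)
      then have 2: "2 * d \<le> (pi * pi) * d"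
        using True by (intro mult_right_mono) auto
      from 2 have "2 * d / 2 \<le> (pi * pi) * d / 2"
        by (rule divide_right_mono) simp
      also have "(pi * pi) * d / 2 = pi * (pi * d / 2)" by simp
      also note 1
      finally have "d \<le> pi * sin (pi * d)" by simp
      then have "d * f (- 2 * cos (pi * d)) \<le> (pi * sin (pi * d)) * f (- 2 * cos (pi * d))"
        by (rule mult_right_mono) (rule f0)
      also have "\<dots> = 1 / 2 * (f (- 2 * cos (pi * d)) * (2 * pi * sin (pi * d)))"
        by simp
      finally have "d * f (- 2 * cos (pi * d)) \<le> 1 / 2 * (f (- 2 * cos (pi * d)) * (2 * pi * sin (pi * d)))" .
      then show ?thesis
        using True f0[of "- 2 * cos (pi * d)"]
        by (simp add: h_def ennreal_mult'[symmetric] ennreal_leI del: ennreal_half)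
    qed (simp add: h_def)
  qed
  also have "\<dots> = ennreal (1/2) * (\<integral>\<^sup>+d. ennreal (f (- 2 * cos (pi * d)) * (2 * pi * sin (pi * d)) * indicator {0..1/4} d) \<partial>lborel)"
    by (rule nn_integral_cmult) measurable
  also have "(\<integral>\<^sup>+d. ennreal (f (- 2 * cos (pi * d)) * (2 * pi * sin (pi * d)) * indicator {0..1/4} d) \<partial>lborel)
     = (\<integral>\<^sup>+y. ennreal (f y * indicator {- 2 * cos (pi * 0).. - 2 * cos (pi * (1/4))} y) \<partial>lborel)"
  proof (rule nn_integral_substitution [symmetric])
    show "set_borel_measurable borel {- 2 * cos (pi * 0).. - 2 * cos (pi * (1/4))} f"
      unfolding set_borel_measurable_def by measurable
    show "((\<lambda>d. - 2 * cos (pi * d)) has_real_derivative 2 * pi * sin (pi * d)) (at d)" for d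
      by (auto intro!: derivative_eq_intros)
    show "0 \<le> 2 * pi * sin (pi * d)" if "d \<in> {0..1/4}" for d
      using that by (intro mult_nonneg_nonneg sin_ge_zero) (auto simp: field_simps)
  qed (auto intro!: continuous_intros)
  also have "\<dots> \<le> (\<integral>\<^sup>+y. ennreal (f y) \<partial>lborel)"
    by (intro nn_integral_mono) (auto simp: indicator_def f0)
  also have "\<dots> = 1"
    unfolding f_def by (rule gauss_nn_integral[OF assms])
  finally have "(\<integral>\<^sup>+d\<in>{-1/4..1/4}. ennreal (\<bar>d\<bar> * (exp (- (pi * (r - 2 * cos (pi * d))\<^sup>2 / \<epsilon>)) / sqrt \<epsilon>)) \<partial>lborel)
     \<le> ennreal (1/2) * 1 + ennreal (1/2) * 1"
    by (metis (no_types, lifting) add_mono mult_left_mono order_trans zero_le)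
  also have "\<dots> = ennreal (1/2 + 1/2)"
    by (subst ennreal_plus) auto
  finally show ?thesis by simp
qed

text \<open>This is the hypothesis of Schur's test for the sum map on pairs from a quarter arc. If
  \<open>v\<close> has length at least 1, the coordinates \<open>d = s - t\<close> and
  \<open>t\<close> separate the integrals: the three angular Gaussians have total mass 3, the
  weighted radial one at most 1. A shorter \<open>v\<close> stays away from all the sums.\<close>

lemma kernel_bound:
  assumes "\<epsilon> > 0"
  shows "(\<integral>\<^sup>+z\<in>{a..a+1/4} \<times> {a..a+1/4}. ennreal (\<bar>fst z - snd z\<bar> * kern \<epsilon> (v - circ (fst z) - circ (snd z))) \<partial>(lborel \<Otimes>\<^sub>M lborel)) \<le> 3"
proof -
  let ?A = "{a..a+1/4}"
  \<comment> \<open>The window for \<open>b\<close> is centred at the midpoint of the arc, which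
    keeps every \<open>(s + t) / 2\<close> within distance 1 of \<open>b\<close>.\<close>
  obtain r b where rb: "r \<ge> 0" "v = (r * cos (2 * pi * b), r * sin (2 * pi * b))"
      "a + 1/8 - 1/2 \<le> b" "b \<le> a + 1/8 - 1/2 + 1"
    using polar_unit_interval[of v "a + 1/8 - 1/2"] by metis
  show ?thesis
  proof (cases "r \<ge> 1")
    case True
    define R where "R d = exp (- (pi * (r - 2 * cos (pi * d))\<^sup>2 / \<epsilon>)) / sqrt \<epsilon>" for d
    define T where "T d t = (\<Sum>k\<in>{-1,0,1}. exp (- (pi * (t - (b + k - d / 2))\<^sup>2 / \<epsilon>)) / sqrt \<epsilon>)" for d t
    have [measurable]: "R \<in> borel_measurable borel" "case_prod T \<in> borel_measurable (borel \<Otimes>\<^sub>M borel)"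
      unfolding R_def T_def by measurable
    have T1: "(\<integral>\<^sup>+t. ennreal (T d t) \<partial>lborel) = 3" for d
    proof -
      have "(\<integral>\<^sup>+t. ennreal (T d t) \<partial>lborel)
         = (\<integral>\<^sup>+t. (\<Sum>k\<in>{-1,0,1}. ennreal (exp (- (pi * (t - (b + k - d / 2))\<^sup>2 / \<epsilon>)) / sqrt \<epsilon>)) \<partial>lborel)"
        unfolding T_def using assms by (subst sum_ennreal) auto
      also have "\<dots> = (\<Sum>k\<in>{-1,0,1::real}. 1)"
        by (subst nn_integral_sum) (auto simp: gauss_nn_integral[OF assms])
      finally show ?thesis by simp
    qed
    have "(\<integral>\<^sup>+z\<in>?A \<times> ?A. ennreal (\<bar>fst z - snd z\<bar> * kern \<epsilon> (v - circ (fst z) - circ (snd z))) \<partial>(lborel \<Otimes>\<^sub>M lborel))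
       = (\<integral>\<^sup>+t. \<integral>\<^sup>+s. ennreal (\<bar>s - t\<bar> * kern \<epsilon> (v - circ s - circ t)) * indicator (?A \<times> ?A) (s, t) \<partial>lborel \<partial>lborel)"
      by (subst lborel_pair.nn_integral_snd [symmetric]) auto
    also have "\<dots> = (\<integral>\<^sup>+t. \<integral>\<^sup>+d. ennreal (\<bar>d\<bar> * kern \<epsilon> (v - circ (t + d) - circ t)) * indicator (?A \<times> ?A) (t + d, t) \<partial>lborel \<partial>lborel)"
    proof (rule nn_integral_cong)
      fix t :: real
      show "(\<integral>\<^sup>+s. ennreal (\<bar>s - t\<bar> * kern \<epsilon> (v - circ s - circ t)) * indicator (?A \<times> ?A) (s, t) \<partial>lborel)
          = (\<integral>\<^sup>+d. ennreal (\<bar>d\<bar> * kern \<epsilon> (v - circ (t + d) - circ t)) * indicator (?A \<times> ?A) (t + d, t) \<partial>lborel)"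
        by (subst nn_integral_real_affine[where c=1 and t=t]) auto
    qed
    also have "\<dots> \<le> (\<integral>\<^sup>+t. \<integral>\<^sup>+d. ennreal (\<bar>d\<bar> * R d) * indicator {-1/4..1/4} d * ennreal (T d t) \<partial>lborel \<partial>lborel)"
    proof (intro nn_integral_mono)
      fix t d :: real
      show "ennreal (\<bar>d\<bar> * kern \<epsilon> (v - circ (t + d) - circ t)) * indicator (?A \<times> ?A) (t + d, t)
         \<le> ennreal (\<bar>d\<bar> * R d) * indicator {-1/4..1/4} d * ennreal (T d t)"
      proof (cases "(t + d, t) \<in> ?A \<times> ?A")
        case T: True
        have "kern \<epsilon> (v - circ (t + d) - circ t) \<le> R d * T d t"
        proof -
          have "\<bar>t + d - t\<bar> \<le> 1 / 4" "\<bar>(t + d + t) / 2 - b\<bar> \<le> 1"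
          proof -
            have "a \<le> t + d" "t + d \<le> a + 1/4" "a \<le> t" "t \<le> a + 1/4" using T by auto
            note T' = this
            show "\<bar>t + d - t\<bar> \<le> 1 / 4"
              using T' by (intro abs_leI) linarith+
            have "(t + d + t) / 2 \<le> a + 1/4" "a \<le> (t + d + t) / 2"
              using T' by simp_all
            then show "\<bar>(t + d + t) / 2 - b\<bar> \<le> 1"
              using rb(3,4) by (intro abs_leI) linarith+
          qed
          from kern_bound_near[OF rb(2) \<open>r \<ge> 1\<close> assms this, unfolded add_diff_cancel_left']
          show ?thesis
            unfolding R_def T_def .
        qed
        then have "\<bar>d\<bar> * kern \<epsilon> (v - circ (t + d) - circ t) \<le> \<bar>d\<bar> * R d * T d t"
          by (simp add: mult_left_mono mult.assoc)
        moreover have "d \<in> {-1/4..1/4}" using T by auto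
        moreover have "0 \<le> R d" "0 \<le> T d t" using assms by (auto simp: R_def T_def intro!: add_nonneg_nonneg)
        ultimately show ?thesis
          using T by (simp add: ennreal_mult[symmetric] ennreal_leI)
      qed auto
    qed
    also have "\<dots> = (\<integral>\<^sup>+d. \<integral>\<^sup>+t. ennreal (\<bar>d\<bar> * R d) * indicator {-1/4..1/4} d * ennreal (T d t) \<partial>lborel \<partial>lborel)"
      by (rule lborel_pair.Fubini') measurable
    also have "\<dots> = (\<integral>\<^sup>+d. ennreal (\<bar>d\<bar> * R d) * indicator {-1/4..1/4} d * 3 \<partial>lborel)"
      by (subst nn_integral_cmult) (auto simp: T1)
    also have "\<dots> = (\<integral>\<^sup>+d. ennreal (\<bar>d\<bar> * R d) * indicator {-1/4..1/4} d \<partial>lborel) * 3"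
      by (rule nn_integral_multc) measurable
    also have "\<dots> \<le> 1 * 3"
      using radial_integral_bound[OF assms, of r] unfolding R_def by (intro mult_right_mono) auto
    finally show ?thesis by simp
  next
    case False
    \<comment> \<open>On a quarter arc the sums have length at least \<open>sqrt 2\<close>, more
      than \<open>14 / 10\<close>, hence distance at least \<open>4 / 10\<close> from
      \<open>v\<close>. Then \<open>x * exp (- x) \<le> 1\<close> bounds the kernel independently of
      \<open>\<epsilon>\<close>.\<close>
    have bd: "\<bar>s - t\<bar> * kern \<epsilon> (v - circ s - circ t) \<le> 3" if "s \<in> ?A" "t \<in> ?A" for s t
    proof -
      have d: "\<bar>s - t\<bar> \<le> 1/4" using that by (auto simp: abs_if)
      then have "pi * \<bar>s - t\<bar> \<le> pi / 4" by (auto simp: field_simps)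
      then have "cos (pi / 4) \<le> cos (pi * \<bar>s - t\<bar>)" by (intro cos_monotone_0_pi_le) auto
      also have "cos (pi * \<bar>s - t\<bar>) = cos (pi * (s - t))"
        using cos_abs_real[of "pi * (s - t)"] by (simp add: abs_mult)
      finally have "sqrt 2 \<le> 2 * cos (pi * (s - t))" by (simp add: cos_45)
      moreover have "14 / 10 \<le> sqrt 2" by (rule real_le_rsqrt) (simp add: power2_eq_square)
      ultimately have c: "14 / 10 \<le> 2 * cos (pi * (s - t))" by linarith
      then have "(4 / 10)\<^sup>2 \<le> (2 * cos (pi * (s - t)) - r)\<^sup>2"
        using False by (intro power_mono) auto
      also have "\<dots> \<le> (norm (v - circ s - circ t))\<^sup>2"
        unfolding circ_sum_dist[OF rb(2)] using c rb(1)
        by (simp add: power2_commute)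
      finally have n: "4 / 25 \<le> (norm (v - circ s - circ t))\<^sup>2" by (simp add: power2_eq_square)
      define x where "x = pi * (norm (v - circ s - circ t))\<^sup>2 / \<epsilon>"
      have "(norm (v - circ s - circ t))\<^sup>2 > 0" using n by linarith
      then have x: "x > 0" unfolding x_def by (intro divide_pos_pos mult_pos_pos pi_gt_zero assms)
      have "x \<le> exp x" using exp_ge_add_one_self[of x] by linarith
      then have "exp (- x) \<le> 1 / x" using x by (simp add: exp_minus field_simps)
      then have "kern \<epsilon> (v - circ s - circ t) \<le> 1 / x / \<epsilon>"
        unfolding kern_def x_def[symmetric] using assms by (intro divide_right_mono) auto
      also have "\<dots> = 1 / (pi * (norm (v - circ s - circ t))\<^sup>2)"
        using assms by (simp add: x_def)
      also have "\<dots> \<le> 1 / (3 * (4 / 25))"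
      proof (intro divide_left_mono mult_mono)
        show "0 < pi * (norm (v - circ s - circ t))\<^sup>2 * (3 * (4 / 25))"
          using n by (intro mult_pos_pos pi_gt_zero) linarith+
      qed (use n pi_gt3 in auto)
      finally have "kern \<epsilon> (v - circ s - circ t) \<le> 3" by simp
      then have "\<bar>s - t\<bar> * kern \<epsilon> (v - circ s - circ t) \<le> 1 * 3"
        using d by (intro mult_mono) (auto simp: kern_nonneg assms)
      then show ?thesis by simp
    qed
    have "(\<integral>\<^sup>+z\<in>?A \<times> ?A. ennreal (\<bar>fst z - snd z\<bar> * kern \<epsilon> (v - circ (fst z) - circ (snd z))) \<partial>(lborel \<Otimes>\<^sub>M lborel))
       \<le> (\<integral>\<^sup>+z. ennreal 3 * indicator (?A \<times> ?A) z \<partial>(lborel \<Otimes>\<^sub>M lborel))"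
      using bd by (intro nn_integral_mono) (auto simp: indicator_def simp del: ennreal_numeral intro!: ennreal_leI)
    also have "\<dots> = ennreal 3 * emeasure (lborel \<Otimes>\<^sub>M lborel) (?A \<times> ?A)"
      by (rule nn_integral_cmult_indicator) auto
    also have "emeasure (lborel \<Otimes>\<^sub>M lborel) (?A \<times> ?A) = ennreal (1/16)"
      by (subst lborel.emeasure_pair_measure_Times) (auto simp: ennreal_mult'[symmetric])
    also have "ennreal 3 * ennreal (1/16) \<le> 3"
      by (simp add: ennreal_mult'[symmetric] ennreal_le_iff flip: ennreal_numeral)
    finally show ?thesis .
  qed
qed

subsection \<open>Gaussian regularization and Schur's test\<close>

abbreviation wave :: "'a::real_inner \<Rightarrow> 'a \<Rightarrow> complex" where
  "wave x \<xi> \<equiv> cis (- 2 * pi * (x \<bullet> \<xi>))"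

lemma wave_add: "wave x (u + v) = wave x u * wave x v"
  by (simp only: cis_mult inner_add_right distrib_left)

lemma wave_diff: "wave x (u - v) = wave x u * cnj (wave x v)"
proof -
  have "- 2 * pi * (x \<bullet> (u - v)) = - 2 * pi * (x \<bullet> u) + - (- 2 * pi * (x \<bullet> v))"
    by (simp add: inner_diff_right right_diff_distrib)
  then show ?thesis by (simp only: cis_mult cis_cnj)
qed

lemma wave_prod: "wave z \<zeta> = wave (fst z) (fst \<zeta>) * wave (snd z) (snd \<zeta>)"
  by (simp only: cis_mult inner_prod_def distrib_left)

lemma fourier_exp_eq: "exp (- (2 * of_real pi * \<i> * of_real r)) = cis (- 2 * pi * r)"
  by (simp add: cis_conv_exp mult_ac)

lemma cis_measurable [measurable]: "cis \<in> borel_measurable borel"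
  by (intro borel_measurable_continuous_onI continuous_intros)

lemma cnj_measurable [measurable]: "cnj \<in> borel_measurable borel"
  by (intro borel_measurable_continuous_onI continuous_intros)

lemma norm_integral_le_nn_integral:
  fixes f :: "'a \<Rightarrow> 'b::{banach, second_countable_topology}"
  shows "ennreal (norm (integral\<^sup>L M f)) \<le> (\<integral>\<^sup>+x. ennreal (norm (f x)) \<partial>M)"
  by (cases "integrable M f") (auto simp: integral_norm_bound_ennreal not_integrable_integral_eq)

text \<open>The characteristic function of the standard normal distribution, rescaled by
  \<open>sqrt (2 * pi * \<epsilon>)\<close>.\<close>

lemma gauss_fourier_1:
  fixes u :: real
  assumes "\<epsilon> > 0"
  shows "(LINT x|lborel. of_real (exp (- (pi * \<epsilon> * x\<^sup>2))) * cis (- 2 * pi * (x * u))) = of_real (exp (- (pi * u\<^sup>2 / \<epsilon>)) / sqrt \<epsilon>)"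
proof -
  define c where "c = sqrt (2 * pi * \<epsilon>)"
  have c: "c > 0" "c\<^sup>2 = 2 * pi * \<epsilon>" using assms by (auto simp: c_def)
  define g where "g x = of_real (exp (- (pi * \<epsilon> * x\<^sup>2))) * cis (- 2 * pi * (x * u))" for x :: real
  define t where "t = - 2 * pi * u / c"
  have "of_real (exp (- (t\<^sup>2) / 2)) = char std_normal_distribution t"
    by (simp add: char_std_normal_distribution)
  also have "\<dots> = (LINT x|lborel. std_normal_density x *\<^sub>R iexp (t * x))"
    unfolding char_def by (subst integral_density) auto
  also have "\<dots> = \<bar>c\<bar> *\<^sub>R (LINT x|lborel. std_normal_density (0 + c * x) *\<^sub>R iexp (t * (0 + c * x)))"
    using c by (intro lborel_integral_real_affine) auto
  also have "(\<lambda>x. std_normal_density (0 + c * x) *\<^sub>R iexp (t * (0 + c * x))) = (\<lambda>x. of_real (1 / sqrt (2 * pi)) * g x)"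
  proof
    fix x
    have "- (c * x)\<^sup>2 / 2 = - (pi * \<epsilon> * x\<^sup>2)" using c by (simp add: power_mult_distrib)
    moreover have "t * (c * x) = - 2 * pi * (x * u)" using c by (simp add: t_def)
    ultimately show "std_normal_density (0 + c * x) *\<^sub>R iexp (t * (0 + c * x)) = of_real (1 / sqrt (2 * pi)) * g x"
      unfolding std_normal_density_def g_def by (simp add: cis_conv_exp scaleR_conv_of_real)
  qed
  also have "\<bar>c\<bar> *\<^sub>R (LINT x|lborel. of_real (1 / sqrt (2 * pi)) * g x) = of_real (sqrt \<epsilon>) * (LINT x|lborel. g x)"
    using assms by (simp add: c_def scaleR_conv_of_real real_sqrt_mult)
  finally have "(LINT x|lborel. g x) = of_real (exp (- (t\<^sup>2) / 2) / sqrt \<epsilon>)"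
    using assms by (simp add: field_simps)
  moreover have "- (t\<^sup>2) / 2 = - (pi * u\<^sup>2 / \<epsilon>)"
    using c assms by (simp add: t_def power_divide power_mult_distrib power2_eq_square)
  ultimately show ?thesis by (simp add: g_def)
qed

lemma gauss_integrable_1:
  assumes "\<epsilon> > 0"
  shows "integrable lborel (\<lambda>x::real. exp (- (pi * \<epsilon> * x\<^sup>2)))"
proof (rule integrableI_nonneg)
  have "(\<integral>\<^sup>+x. ennreal (exp (- (pi * \<epsilon> * x\<^sup>2))) \<partial>lborel)
    = (\<integral>\<^sup>+x. ennreal (sqrt (1/\<epsilon>)) * ennreal (exp (- (pi * (x - 0)\<^sup>2 / (1/\<epsilon>))) / sqrt (1/\<epsilon>)) \<partial>lborel)"
    using assms by (intro nn_integral_cong) (auto simp: ennreal_mult'[symmetric] mult_ac)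
  also have "\<dots> = ennreal (sqrt (1/\<epsilon>))"
    using gauss_nn_integral[of "1 / \<epsilon>" 0] assms by (subst nn_integral_cmult) simp_all
  finally show "(\<integral>\<^sup>+x. ennreal (exp (- (pi * \<epsilon> * x\<^sup>2))) \<partial>lborel) < \<infinity>" by simp
qed auto

definition gauss :: "real \<Rightarrow> real \<times> real \<Rightarrow> real" where
  "gauss \<epsilon> x = exp (- (pi * \<epsilon> * (norm x)\<^sup>2))"

lemma gauss_measurable [measurable]: "gauss \<epsilon> \<in> borel_measurable borel"
  unfolding gauss_def by measurable

lemma gauss_prod: "gauss \<epsilon> (x, y) = exp (- (pi * \<epsilon> * x\<^sup>2)) * exp (- (pi * \<epsilon> * y\<^sup>2))"
proof -
  have "- (pi * \<epsilon> * (x\<^sup>2 + y\<^sup>2)) = - (pi * \<epsilon> * x\<^sup>2) + - (pi * \<epsilon> * y\<^sup>2)"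
    by (simp add: distrib_left)
  then show ?thesis
    by (simp add: gauss_def norm_Pair flip: exp_add)
qed

lemma gauss_pos: "gauss \<epsilon> x > 0"
  by (simp add: gauss_def)

lemma lborel_prod_integrable_mult:
  fixes f :: "'a::euclidean_space \<Rightarrow> 'c::{real_normed_field, banach, second_countable_topology}"
    and g :: "'b::euclidean_space \<Rightarrow> 'c"
  assumes "integrable lborel f" "integrable lborel g"
  shows "integrable lborel (\<lambda>z. f (fst z) * g (snd z))"
    and "(LINT z|lborel. f (fst z) * g (snd z)) = (LINT x|lborel. f x) * (LINT y|lborel. g y)"
proof -
  have [measurable]: "f \<in> borel_measurable borel" "g \<in> borel_measurable borel"
    using assms by (auto dest: borel_measurable_integrable)
  have 1: "integrable (lborel \<Otimes>\<^sub>M lborel) (\<lambda>(x, y). f x * g y)"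
    by (rule lborel_pair.Fubini_integrable)
       (use assms in \<open>auto simp: norm_mult intro!: integrable_mult_right integrable_mult_left\<close>)
  then show "integrable lborel (\<lambda>z. f (fst z) * g (snd z))"
    by (simp add: lborel_prod case_prod_beta')
  show "(LINT z|lborel. f (fst z) * g (snd z)) = (LINT x|lborel. f x) * (LINT y|lborel. g y)"
    using lborel_pair.integral_fst'[OF 1] by (simp add: lborel_prod case_prod_beta')
qed

lemma gauss_integrable: "\<epsilon> > 0 \<Longrightarrow> integrable lborel (gauss \<epsilon>)"
  using lborel_prod_integrable_mult(1)[OF gauss_integrable_1 gauss_integrable_1, of \<epsilon> \<epsilon>]
  by (simp flip: gauss_prod)

lemma gauss_fourier:
  assumes "\<epsilon> > 0"
  shows "(LINT x|lborel. of_real (gauss \<epsilon> x) * wave x u) = of_real (kern \<epsilon> u)"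
proof -
  have int: "integrable lborel (\<lambda>x::real. of_real (exp (- (pi * \<epsilon> * x\<^sup>2))) * cis (- 2 * pi * (x * v)))" for v
    by (rule Bochner_Integration.integrable_bound[OF gauss_integrable_1[OF assms]]) (auto simp: norm_mult)
  have "of_real (gauss \<epsilon> x) * wave x u
    = (of_real (exp (- (pi * \<epsilon> * (fst x)\<^sup>2))) * cis (- 2 * pi * (fst x * fst u)))
    * (of_real (exp (- (pi * \<epsilon> * (snd x)\<^sup>2))) * cis (- 2 * pi * (snd x * snd u)))" for x
  proof -
    have "wave x u = cis (- 2 * pi * (fst x * fst u)) * cis (- 2 * pi * (snd x * snd u))"
      by (simp only: wave_prod inner_real_def)
    then show ?thesis
      using gauss_prod[of \<epsilon> "fst x" "snd x"] by (simp only: of_real_mult mult_ac prod.collapse)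
  qed
  then have "(LINT x|lborel. of_real (gauss \<epsilon> x) * wave x u)
      = of_real (exp (- (pi * (fst u)\<^sup>2 / \<epsilon>)) / sqrt \<epsilon>) * of_real (exp (- (pi * (snd u)\<^sup>2 / \<epsilon>)) / sqrt \<epsilon>)"
    by (simp only: lborel_prod_integrable_mult(2)[OF int int] gauss_fourier_1[OF assms])
  also have "\<dots> = of_real (kern \<epsilon> u)"
  proof -
    have "- (pi * (norm u)\<^sup>2 / \<epsilon>) = - (pi * (fst u)\<^sup>2 / \<epsilon>) + - (pi * (snd u)\<^sup>2 / \<epsilon>)"
      by (simp add: norm_prod_def distrib_left add_divide_distrib)
    moreover have "sqrt \<epsilon> * sqrt \<epsilon> = \<epsilon>" using assms by simp
    ultimately show ?thesis
      by (simp only: kern_def exp_add times_divide_times_eq flip: of_real_mult)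
  qed
  finally show ?thesis .
qed

text \<open>The function \<open>H\<close> below is the Fourier transform of the push-forward of the
  complex measure with density \<open>G\<close> under \<open>\<Phi>\<close>. The setting serves
  twice, with \<open>\<Phi>\<close> the sum of two circle points: for a density supported off the
  diagonal of a squared arc, where an upper bound is wanted, and for \<open>G = 1\<close> on the
  unit square, where the exact formula yields the fourth moment.\<close>

locale finite_extension = finite_measure M for M :: "'a measure" +
  fixes \<Phi> :: "'a \<Rightarrow> real \<times> real" and G :: "'a \<Rightarrow> complex" and B :: real
  assumes \<Phi>_measurable [measurable]: "\<Phi> \<in> borel_measurable M"
    and G_measurable [measurable]: "G \<in> borel_measurable M"
    and G_bound: "\<And>a. norm (G a) \<le> B"
begin

definition H :: "real \<times> real \<Rightarrow> complex" where
  "H x = (LINT a|M. G a * wave x (\<Phi> a))"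

sublocale MM: pair_sigma_finite M M ..

lemma H_measurable [measurable]: "H \<in> borel_measurable borel"
  unfolding H_def by measurable

lemma H_bound: "norm (H x) \<le> (LINT a|M. norm (G a))"
  unfolding H_def by (rule order_trans[OF integral_norm_bound]) (simp add: norm_mult)

text \<open>Takes the place of Plancherel: \<open>H\<close> times its conjugate is a double integral
  of waves at \<open>\<Phi> a - \<Phi> b\<close>, and integrating a wave against the Gaussian gives
  \<open>kern\<close>. The Gaussian makes the triple integral absolutely convergent.\<close>

lemma H_gauss_integral:
  assumes "\<epsilon> > 0"
  shows "(LINT x|lborel. of_real (gauss \<epsilon> x) * (H x * cnj (H x)))
     = (LINT z|(M \<Otimes>\<^sub>M M). G (fst z) * cnj (G (snd z)) * of_real (kern \<epsilon> (\<Phi> (fst z) - \<Phi> (snd z))))"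
proof -
  interpret P: finite_measure "M \<Otimes>\<^sub>M M"
    by (rule finite_measure_pair_measure) unfold_locales
  have prod: "H x * cnj (H x) = (LINT z|(M \<Otimes>\<^sub>M M). (G (fst z) * cnj (G (snd z))) * wave x (\<Phi> (fst z) - \<Phi> (snd z)))" for x
  proof -
    have "integrable (M \<Otimes>\<^sub>M M) (\<lambda>(a, b). (G a * wave x (\<Phi> a)) * cnj (G b * wave x (\<Phi> b)))"
      by (rule P.integrable_const_bound[of _ "B * B"])
         (auto simp: norm_mult complex_mod_cnj G_bound case_prod_beta simp del: complex_cnj_mult intro!: AE_I2 mult_mono order_trans[OF norm_ge_zero G_bound])
    from MM.integral_fst'[OF this]
    have "(LINT z|(M \<Otimes>\<^sub>M M). (G (fst z) * wave x (\<Phi> (fst z))) * cnj (G (snd z) * wave x (\<Phi> (snd z))))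
        = H x * cnj (H x)"
      by (simp add: case_prod_beta' H_def del: complex_cnj_mult)
    moreover have "(G a * wave x (\<Phi> a)) * cnj (G b * wave x (\<Phi> b))
        = (G a * cnj (G b)) * wave x (\<Phi> a - \<Phi> b)" for a b
      unfolding wave_diff complex_cnj_mult by (simp only: mult_ac)
    ultimately show ?thesis by (simp only:)
  qed
  interpret Q: pair_sigma_finite lborel "M \<Otimes>\<^sub>M M" ..
  have int: "integrable (lborel \<Otimes>\<^sub>M (M \<Otimes>\<^sub>M M)) (\<lambda>(x, z). of_real (gauss \<epsilon> x) * ((G (fst z) * cnj (G (snd z))) * wave x (\<Phi> (fst z) - \<Phi> (snd z))))"
  proof (rule Q.Fubini_integrable)
    have "norm (of_real (gauss \<epsilon> x) * (G (fst z) * cnj (G (snd z)) * wave x (\<Phi> (fst z) - \<Phi> (snd z))))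
        = gauss \<epsilon> x * (norm (G (fst z)) * norm (G (snd z)))" for x z
      by (simp add: norm_mult gauss_pos less_imp_le)
    then show "integrable lborel (\<lambda>x. LINT z|(M \<Otimes>\<^sub>M M). norm (case (x, z) of (x, z) \<Rightarrow> of_real (gauss \<epsilon> x) * (G (fst z) * cnj (G (snd z)) * wave x (\<Phi> (fst z) - \<Phi> (snd z)))))"
      using gauss_integrable[OF assms] by simp
    show "AE x in lborel. integrable (M \<Otimes>\<^sub>M M) (\<lambda>z. case (x, z) of (x, z) \<Rightarrow> of_real (gauss \<epsilon> x) * (G (fst z) * cnj (G (snd z)) * wave x (\<Phi> (fst z) - \<Phi> (snd z))))"
      by (intro AE_I2) (auto simp: norm_mult G_bound intro!: AE_I2 integrable_mult_right P.integrable_const_bound[of _ "B * B"] mult_mono order_trans[OF norm_ge_zero G_bound])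
  qed measurable
  have "(LINT x|lborel. of_real (gauss \<epsilon> x) * (H x * cnj (H x)))
    = (LINT x|lborel. LINT z|(M \<Otimes>\<^sub>M M). of_real (gauss \<epsilon> x) * ((G (fst z) * cnj (G (snd z))) * wave x (\<Phi> (fst z) - \<Phi> (snd z))))"
    unfolding prod by simp
  also have "\<dots> = (LINT z|(M \<Otimes>\<^sub>M M). LINT x|lborel. of_real (gauss \<epsilon> x) * ((G (fst z) * cnj (G (snd z))) * wave x (\<Phi> (fst z) - \<Phi> (snd z))))"
    by (rule Q.Fubini_integral[OF int, symmetric])
  also have "\<dots> = (LINT z|(M \<Otimes>\<^sub>M M). (G (fst z) * cnj (G (snd z))) * (LINT x|lborel. of_real (gauss \<epsilon> x) * wave x (\<Phi> (fst z) - \<Phi> (snd z))))"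
    by (subst integral_mult_right_zero [symmetric]) (simp add: mult_ac)
  finally show ?thesis
    by (simp only: gauss_fourier[OF assms])
qed

lemma H_gauss_integrable:
  assumes "\<epsilon> > 0"
  shows "integrable lborel (\<lambda>x. gauss \<epsilon> x * (norm (H x))\<^sup>2)"
proof (rule Bochner_Integration.integrable_bound)
  define K where "K = (LINT a|M. norm (G a))"
  show "integrable lborel (\<lambda>x. gauss \<epsilon> x * K\<^sup>2)"
    using gauss_integrable[OF assms] by simp
  have "(norm (H x))\<^sup>2 \<le> K\<^sup>2" for x
    using H_bound[of x] by (intro power_mono) (auto simp: K_def)
  then show "AE x in lborel. norm (gauss \<epsilon> x * (norm (H x))\<^sup>2) \<le> norm (gauss \<epsilon> x * K\<^sup>2)"
    using gauss_pos[of \<epsilon>] by (auto simp: abs_mult less_imp_le intro!: mult_left_mono)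
qed measurable

lemma H_gauss_integral_real:
  assumes "\<epsilon> > 0"
  shows "(LINT x|lborel. gauss \<epsilon> x * (norm (H x))\<^sup>2)
     = Re (LINT z|(M \<Otimes>\<^sub>M M). G (fst z) * cnj (G (snd z)) * of_real (kern \<epsilon> (\<Phi> (fst z) - \<Phi> (snd z))))"
proof -
  have "of_real (gauss \<epsilon> x) * (H x * cnj (H x)) = of_real (gauss \<epsilon> x * (norm (H x))\<^sup>2)" for x
    by (simp only: of_real_mult complex_norm_square)
  then have "(LINT x|lborel. of_real (gauss \<epsilon> x) * (H x * cnj (H x))) = of_real (LINT x|lborel. gauss \<epsilon> x * (norm (H x))\<^sup>2)"
    by (simp only: integral_complex_of_real)
  then show ?thesis
    unfolding H_gauss_integral[OF assms, symmetric] by (simp only: Re_complex_of_real)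
qed

text \<open>Schur's test for the kernel \<open>kern \<epsilon> (\<Phi> a - \<Phi> b)\<close>, uniformly in \<open>\<epsilon>\<close>.\<close>

lemma H_square_bound:
  fixes w :: "'a \<Rightarrow> real"
  assumes w [measurable]: "w \<in> borel_measurable M" and w0: "\<And>a. w a \<ge> 0"
    and wG: "\<And>a. w a = 0 \<Longrightarrow> G a = 0"
    and schur: "\<And>\<epsilon> v. \<epsilon> > 0 \<Longrightarrow> (\<integral>\<^sup>+a. ennreal (w a * kern \<epsilon> (v - \<Phi> a)) \<partial>M) \<le> K"
  shows "(\<integral>\<^sup>+x. ennreal ((norm (H x))\<^sup>2) \<partial>lborel) \<le> K * (\<integral>\<^sup>+a. ennreal ((norm (G a))\<^sup>2 / w a) \<partial>M)"
proof -
  define J where "J = (\<integral>\<^sup>+a. ennreal ((norm (G a))\<^sup>2 / w a) \<partial>M)"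
  have kern_sym: "kern \<epsilon> (u - v) = kern \<epsilon> (v - u)" for \<epsilon> u v
    by (simp add: kern_def norm_minus_commute)
  have eps: "(\<integral>\<^sup>+x. ennreal (gauss \<epsilon> x * (norm (H x))\<^sup>2) \<partial>lborel) \<le> K * J"
    if \<epsilon>: "\<epsilon> > 0" for \<epsilon>
  proof -
    define k where "k z = kern \<epsilon> (\<Phi> (fst z) - \<Phi> (snd z))" for z
    have [measurable]: "k \<in> borel_measurable (M \<Otimes>\<^sub>M M)" unfolding k_def by measurable
    have k0: "k z \<ge> 0" for z unfolding k_def by (rule kern_nonneg[OF \<epsilon>])
    define q where "q z = ennreal ((norm (G (fst z)))\<^sup>2 / w (fst z)) * ennreal (w (snd z) * k z)" for z
    have [measurable]: "q \<in> borel_measurable (M \<Otimes>\<^sub>M M)" unfolding q_def by measurable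
    define q' where "q' z = ennreal ((norm (G (snd z)))\<^sup>2 / w (snd z)) * ennreal (w (fst z) * k z)" for z
    have [measurable]: "q' \<in> borel_measurable (M \<Otimes>\<^sub>M M)" unfolding q'_def by measurable
    have "(\<integral>\<^sup>+x. ennreal (gauss \<epsilon> x * (norm (H x))\<^sup>2) \<partial>lborel) = ennreal (LINT x|lborel. gauss \<epsilon> x * (norm (H x))\<^sup>2)"
      by (rule nn_integral_eq_integral[OF H_gauss_integrable[OF \<epsilon>]]) (simp add: gauss_pos less_imp_le)
    also have "\<dots> \<le> ennreal (norm (LINT z|(M \<Otimes>\<^sub>M M). G (fst z) * cnj (G (snd z)) * of_real (k z)))"
      unfolding H_gauss_integral_real[OF \<epsilon>] k_def by (intro ennreal_leI complex_Re_le_cmod)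
    also have "\<dots> \<le> (\<integral>\<^sup>+z. ennreal (norm (G (fst z) * cnj (G (snd z)) * of_real (k z))) \<partial>(M \<Otimes>\<^sub>M M))"
      by (rule norm_integral_le_nn_integral)
    also have "\<dots> \<le> (\<integral>\<^sup>+z. ennreal (1/2) * (q z + q' z) \<partial>(M \<Otimes>\<^sub>M M))"
    proof (rule nn_integral_mono)
      fix z
      show "ennreal (norm (G (fst z) * cnj (G (snd z)) * of_real (k z))) \<le> ennreal (1/2) * (q z + q' z)"
      proof (cases "w (fst z) = 0 \<or> w (snd z) = 0")
        case False
        define a b s t where "a = norm (G (fst z))" "b = norm (G (snd z))" "s = w (fst z)" "t = w (snd z)"
        have st: "s > 0" "t > 0" using False w0[of "fst z"] w0[of "snd z"] by (auto simp: a_b_s_t_def)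
        \<comment> \<open>Expanding \<open>(a * t - b * s)^2 \<ge> 0\<close> and dividing by
          \<open>2 * s * t\<close> gives a weighted arithmetic-geometric mean. Each
          \<open>a^2 / s\<close> meets the weight \<open>t\<close> of the other variable, which is
          the product that \<open>schur\<close> can integrate.\<close>
        have "2 * (a * b) * (s * t) \<le> a\<^sup>2 * t\<^sup>2 + b\<^sup>2 * s\<^sup>2"
          using sum_squares_ge_zero[of "a * t - b * s" 0] by (simp add: power2_eq_square algebra_simps)
        then have "a * b \<le> 1/2 * (a\<^sup>2 / s * t + b\<^sup>2 / t * s)"
          using st by (simp add: field_simps power2_eq_square)
        then have "a * b * k z \<le> 1/2 * (a\<^sup>2 / s * t + b\<^sup>2 / t * s) * k z"
          by (rule mult_right_mono) (rule k0)
        also have "\<dots> = 1/2 * (a\<^sup>2 / s * (t * k z) + b\<^sup>2 / t * (s * k z))"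
          by (simp add: algebra_simps)
        finally have "ennreal (a * b * k z) \<le> ennreal (1/2 * (a\<^sup>2 / s * (t * k z) + b\<^sup>2 / t * (s * k z)))"
          by (rule ennreal_leI)
        also have "\<dots> = ennreal (1/2) * (ennreal (a\<^sup>2 / s) * ennreal (t * k z) + ennreal (b\<^sup>2 / t) * ennreal (s * k z))"
          using st k0[of z] by (subst ennreal_mult') (auto simp: ennreal_mult'[symmetric] ennreal_plus[symmetric] simp del: ennreal_plus)
        finally show ?thesis
          unfolding q_def q'_def using k0[of z] by (simp add: norm_mult a_b_s_t_def)
      qed (auto simp: wG)
    qed
    also have "\<dots> = ennreal (1/2) * ((\<integral>\<^sup>+z. q z \<partial>(M \<Otimes>\<^sub>M M)) + (\<integral>\<^sup>+z. q' z \<partial>(M \<Otimes>\<^sub>M M)))"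
      by (simp add: nn_integral_cmult nn_integral_add)
    also have "\<dots> \<le> ennreal (1/2) * (K * J + K * J)"
    proof (intro mult_left_mono add_mono)
      show "(\<integral>\<^sup>+z. q z \<partial>(M \<Otimes>\<^sub>M M)) \<le> K * J"
      proof -
        have "(\<integral>\<^sup>+z. q z \<partial>(M \<Otimes>\<^sub>M M)) = (\<integral>\<^sup>+a. \<integral>\<^sup>+b. q (a, b) \<partial>M \<partial>M)"
          by (rule nn_integral_fst[symmetric]) measurable
        also have "\<dots> = (\<integral>\<^sup>+a. ennreal ((norm (G a))\<^sup>2 / w a) * (\<integral>\<^sup>+b. ennreal (w b * kern \<epsilon> (\<Phi> a - \<Phi> b)) \<partial>M) \<partial>M)"
          unfolding q_def k_def by (simp add: nn_integral_cmult)
        also have "\<dots> \<le> (\<integral>\<^sup>+a. ennreal ((norm (G a))\<^sup>2 / w a) * K \<partial>M)"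
          by (intro nn_integral_mono mult_left_mono schur[OF \<epsilon>]) auto
        also have "\<dots> = J * K"
          unfolding J_def by (rule nn_integral_multc) measurable
        finally show ?thesis by (simp only: mult.commute[of _ K])
      qed
      show "(\<integral>\<^sup>+z. q' z \<partial>(M \<Otimes>\<^sub>M M)) \<le> K * J"
      proof -
        have "(\<integral>\<^sup>+z. q' z \<partial>(M \<Otimes>\<^sub>M M)) = (\<integral>\<^sup>+b. \<integral>\<^sup>+a. q' (a, b) \<partial>M \<partial>M)"
          by (rule MM.nn_integral_snd[symmetric]) measurable
        also have "\<dots> = (\<integral>\<^sup>+b. ennreal ((norm (G b))\<^sup>2 / w b) * (\<integral>\<^sup>+a. ennreal (w a * kern \<epsilon> (\<Phi> b - \<Phi> a)) \<partial>M) \<partial>M)"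
          unfolding q'_def k_def by (simp add: nn_integral_cmult kern_sym[of \<epsilon> "\<Phi> a" "\<Phi> b" for a b])
        also have "\<dots> \<le> (\<integral>\<^sup>+a. ennreal ((norm (G a))\<^sup>2 / w a) * K \<partial>M)"
          by (intro nn_integral_mono mult_left_mono schur[OF \<epsilon>]) auto
        also have "\<dots> = J * K"
          unfolding J_def by (rule nn_integral_multc) measurable
        finally show ?thesis by (simp only: mult.commute[of _ K])
      qed
    qed simp
    also have "\<dots> = (ennreal (1/2) + ennreal (1/2)) * (K * J)"
      by (simp only: distrib_left distrib_right)
    also have "ennreal (1/2) + ennreal (1/2) = 1"
      by (subst ennreal_plus[symmetric]) auto
    finally show ?thesis by (simp only: mult_1)
  qed
  have "(\<integral>\<^sup>+x. ennreal ((norm (H x))\<^sup>2) \<partial>lborel)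
      = (\<integral>\<^sup>+x. liminf (\<lambda>n. ennreal (gauss (1 / real (Suc n)) x * (norm (H x))\<^sup>2)) \<partial>lborel)"
  proof (rule nn_integral_cong)
    fix x
    have "(\<lambda>n. gauss (1 / real (Suc n)) x * (norm (H x))\<^sup>2) \<longlonglongrightarrow> exp (- (pi * 0 * (norm x)\<^sup>2)) * (norm (H x))\<^sup>2"
      unfolding gauss_def by (intro tendsto_intros LIMSEQ_Suc[OF lim_1_over_n])
    then have "(\<lambda>n. ennreal (gauss (1 / real (Suc n)) x * (norm (H x))\<^sup>2)) \<longlonglongrightarrow> ennreal ((norm (H x))\<^sup>2)"
      by (intro tendsto_ennrealI) simp
    then show "ennreal ((norm (H x))\<^sup>2) = liminf (\<lambda>n. ennreal (gauss (1 / real (Suc n)) x * (norm (H x))\<^sup>2))"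
      using lim_imp_Liminf[of sequentially] by force
  qed
  \<comment> \<open>Fatou along \<open>\<epsilon> = 1 / (n + 1)\<close> removes the Gaussian weight,
    since the bound \<open>eps\<close> does not depend on \<open>\<epsilon>\<close>.\<close>
  also have "\<dots> \<le> liminf (\<lambda>n. \<integral>\<^sup>+x. ennreal (gauss (1 / real (Suc n)) x * (norm (H x))\<^sup>2) \<partial>lborel)"
    by (rule nn_integral_liminf) measurable
  also have "\<dots> \<le> liminf (\<lambda>n. K * J)"
    by (intro Liminf_mono always_eventually allI eps) simp
  also have "\<dots> = K * J"
    by (simp add: Liminf_const)
  finally show ?thesis unfolding J_def .
qed

end

subsection \<open>The restricted extension estimate\<close>

lemma nn_integral_powr:
  fixes e y :: real
  assumes "e > 0" "y \<ge> 0"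
  shows "(\<integral>\<^sup>+l. ennreal (l powr (e - 1)) * indicator {0<..<y} l \<partial>lborel) = ennreal (y powr e / e)"
proof -
  have "((\<lambda>l. l powr (e - 1)) has_integral (y powr (e - 1 + 1) / (e - 1 + 1))) {0..y}"
    using assms by (intro has_integral_powr_from_0) auto
  then have "(\<integral>\<^sup>+l. ennreal (indicator {0..y} l * l powr (e - 1)) \<partial>lborel) = ennreal (y powr e / e)"
    using nn_integral_has_integral_lebesgue[of "{0..y}" "\<lambda>l. l powr (e - 1)"] by simp
  moreover have "ennreal (indicator {0..y} l * l powr (e - 1)) = ennreal (l powr (e - 1)) * indicator {0..y} l" for l
    by (simp add: indicator_def)
  moreover have "(\<integral>\<^sup>+l. ennreal (l powr (e - 1)) * indicator {0..y} l \<partial>lborel)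
      = (\<integral>\<^sup>+l. ennreal (l powr (e - 1)) * indicator {0<..<y} l \<partial>lborel)"
  proof (rule nn_integral_cong_AE)
    have "AE l in lborel. l \<noteq> 0 \<and> l \<noteq> y"
      using AE_lborel_singleton[of 0] AE_lborel_singleton[of y] by eventually_elim auto
    then show "AE l in lborel. ennreal (l powr (e - 1)) * indicator {0..y} l = ennreal (l powr (e - 1)) * indicator {0<..<y} l"
      by eventually_elim (auto simp: indicator_def)
  qed
  ultimately show ?thesis by simp
qed

lemma (in sigma_finite_measure) layer_cake:
  fixes F :: "'a \<Rightarrow> real"
  assumes [measurable]: "F \<in> borel_measurable M" and F0: "\<And>x. F x \<ge> 0" and "P > 0"
  shows "(\<integral>\<^sup>+x. ennreal (F x powr P) \<partial>M)
    = (\<integral>\<^sup>+l. ennreal (P * l powr (P - 1)) * indicator {0<..} l * emeasure M {x \<in> space M. l < F x} \<partial>lborel)"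
proof -
  interpret Q: pair_sigma_finite M "lborel :: real measure" ..
  have "(\<integral>\<^sup>+x. ennreal (F x powr P) \<partial>M)
     = (\<integral>\<^sup>+x. \<integral>\<^sup>+l. ennreal P * (ennreal (l powr (P - 1)) * indicator {0<..<F x} l) \<partial>lborel \<partial>M)"
    using assms(3) F0 by (intro nn_integral_cong, subst nn_integral_cmult)
      (auto simp: nn_integral_powr ennreal_mult'[symmetric])
  also have "\<dots> = (\<integral>\<^sup>+x. \<integral>\<^sup>+l. ennreal (P * l powr (P - 1)) * indicator {0<..} l * indicator {x \<in> space M. l < F x} x \<partial>lborel \<partial>M)"
    using assms(3) by (intro nn_integral_cong) (auto simp: indicator_def ennreal_mult')
  also have "\<dots> = (\<integral>\<^sup>+l. \<integral>\<^sup>+x. ennreal (P * l powr (P - 1)) * indicator {0<..} l * indicator {x \<in> space M. l < F x} x \<partial>M \<partial>lborel)"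
  proof (rule Q.Fubini'[symmetric])
    have "(\<lambda>(x, l). ennreal (P * l powr (P - 1)) * indicator {0<..} l * indicator {z \<in> space (M \<Otimes>\<^sub>M lborel). snd z < F (fst z)} (x, l)) \<in> borel_measurable (M \<Otimes>\<^sub>M lborel)"
      by measurable
    also have "?this \<longleftrightarrow> (\<lambda>(x, l). ennreal (P * l powr (P - 1)) * indicator {0<..} l * indicator {x \<in> space M. l < F x} x) \<in> borel_measurable (M \<Otimes>\<^sub>M lborel)"
      by (intro measurable_cong) (auto simp: indicator_def space_pair_measure)
    finally show "(\<lambda>(x, l). ennreal (P * l powr (P - 1)) * indicator {0<..} l * indicator {x \<in> space M. l < F x} x) \<in> borel_measurable (M \<Otimes>\<^sub>M lborel)" .
  qed
  also have "\<dots> = (\<integral>\<^sup>+l. ennreal (P * l powr (P - 1)) * indicator {0<..} l * emeasure M {x \<in> space M. l < F x} \<partial>lborel)"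
    by (intro nn_integral_cong nn_integral_cmult_indicator) measurable
  finally show ?thesis .
qed

text \<open>The sup bound stops the layer-cake integral at \<open>l = m\<close>, and
  \<open>Q < P\<close> makes it converge at \<open>l = 0\<close>.\<close>

lemma (in sigma_finite_measure) weak_bound_imp_powr_bound:
  fixes F :: "'a \<Rightarrow> real"
  assumes [measurable]: "F \<in> borel_measurable M" and F0: "\<And>x. F x \<ge> 0" and Fm: "\<And>x. F x \<le> m"
    and PQ: "0 < Q" "Q < P" and B: "B \<ge> 0"
    and weak: "\<And>l. l > 0 \<Longrightarrow> emeasure M {x \<in> space M. l < F x} \<le> ennreal (B * l powr (- Q))"
  shows "(\<integral>\<^sup>+x. ennreal (F x powr P) \<partial>M) \<le> ennreal (P / (P - Q) * B * m powr (P - Q))"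
proof (cases "m \<ge> 0")
  case True
  have "(\<integral>\<^sup>+x. ennreal (F x powr P) \<partial>M)
    = (\<integral>\<^sup>+l. ennreal (P * l powr (P - 1)) * indicator {0<..} l * emeasure M {x \<in> space M. l < F x} \<partial>lborel)"
    using PQ by (intro layer_cake) (auto simp: F0)
  also have "\<dots> \<le> (\<integral>\<^sup>+l. ennreal (P * B) * (ennreal (l powr (P - Q - 1)) * indicator {0<..<m} l) \<partial>lborel)"
  proof (rule nn_integral_mono)
    fix l :: real
    show "ennreal (P * l powr (P - 1)) * indicator {0<..} l * emeasure M {x \<in> space M. l < F x}
       \<le> ennreal (P * B) * (ennreal (l powr (P - Q - 1)) * indicator {0<..<m} l)"
    proof (cases "0 < l \<and> l < m")
      case l: True
      have "ennreal (P * l powr (P - 1)) * emeasure M {x \<in> space M. l < F x}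
        \<le> ennreal (P * l powr (P - 1)) * ennreal (B * l powr (- Q))"
        using l by (intro mult_left_mono weak) auto
      also have "\<dots> = ennreal (P * B * l powr (P - Q - 1))"
      proof -
        have "l powr (P - 1) * l powr (- Q) = l powr (P - Q - 1)"
          using powr_add[of l "P - 1" "- Q"] by (simp add: algebra_simps)
        then have "P * l powr (P - 1) * (B * l powr (- Q)) = P * B * l powr (P - Q - 1)"
          by (simp only: mult_ac)
        then show ?thesis
          using PQ B by (subst ennreal_mult'[symmetric]) auto
      qed
      finally show ?thesis using l PQ B by (simp add: ennreal_mult')
    next
      case False
      then have "l \<le> 0 \<or> {x \<in> space M. l < F x} = {}"
        using Fm by (force simp: not_less dest: order_trans)
      then show ?thesis
        by (elim disjE) (simp, simp only: emeasure_empty mult_zero_right zero_le)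
    qed
  qed
  also have "\<dots> = ennreal (P * B) * ennreal (m powr (P - Q) / (P - Q))"
    using PQ True by (subst nn_integral_cmult) (auto simp: nn_integral_powr)
  also have "\<dots> = ennreal (P / (P - Q) * B * m powr (P - Q))"
    using PQ B by (subst ennreal_mult'[symmetric]) (auto simp: mult_ac)
  finally show ?thesis .
next
  case False
  then have "\<not> (\<exists>x. True)" using F0 Fm order_trans by (metis (full_types))
  then show ?thesis by simp
qed

text \<open>Within distance \<open>m\<close> of \<open>s\<close> the kernel is integrated in full,
  which gives \<open>2 / \<eta> * m powr \<eta>\<close>; farther out it is at most
  \<open>m powr (\<eta> - 1)\<close> on a set of measure at most \<open>m\<close>.\<close>

lemma fractional_integral_bound:
  fixes E :: "real set" and \<eta> s :: real
  assumes [measurable]: "E \<in> sets borel" and fin: "emeasure lborel E = ennreal m" "m > 0" and \<eta>: "0 < \<eta>" "\<eta> \<le> 1"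
  shows "(\<integral>\<^sup>+t. ennreal (\<bar>s - t\<bar> powr (\<eta> - 1)) * indicator E t \<partial>lborel) \<le> ennreal ((2 / \<eta> + 1) * m powr \<eta>)"
proof -
  define h where "h d = ennreal (d powr (\<eta> - 1)) * indicator {0<..<m} d" for d :: real
  have [measurable]: "h \<in> borel_measurable borel" unfolding h_def by measurable
  have h: "(\<integral>\<^sup>+d. h d \<partial>lborel) = ennreal (m powr \<eta> / \<eta>)"
    unfolding h_def using \<eta> fin by (intro nn_integral_powr) auto
  have "(\<integral>\<^sup>+t. ennreal (\<bar>s - t\<bar> powr (\<eta> - 1)) * indicator E t \<partial>lborel)
     \<le> (\<integral>\<^sup>+t. h (- s + 1 * t) + h (s + (-1) * t) + ennreal (m powr (\<eta> - 1)) * indicator E t \<partial>lborel)"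
  proof (rule nn_integral_mono)
    fix t :: real
    show "ennreal (\<bar>s - t\<bar> powr (\<eta> - 1)) * indicator E t \<le> h (- s + 1 * t) + h (s + (-1) * t) + ennreal (m powr (\<eta> - 1)) * indicator E t"
    proof (cases "\<bar>s - t\<bar> < m")
      case True
      then consider "t = s" | "0 < t - s" "t - s < m" | "0 < s - t" "s - t < m" by linarith
      then show ?thesis
        by cases (auto simp: h_def indicator_def abs_if add_increasing2)
    next
      case False
      have "\<bar>s - t\<bar> powr (\<eta> - 1) \<le> m powr (\<eta> - 1)"
        using False \<eta> fin by (intro powr_mono2') auto
      then show ?thesis by (auto simp: indicator_def intro!: add_increasing ennreal_leI)
    qed
  qed
  also have "\<dots> = (\<integral>\<^sup>+t. h (- s + 1 * t) \<partial>lborel) + (\<integral>\<^sup>+t. h (s + (-1) * t) \<partial>lborel) + ennreal (m powr (\<eta> - 1)) * emeasure lborel E"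
    by (simp add: nn_integral_add nn_integral_cmult_indicator)
  also have "(\<integral>\<^sup>+t. h (- s + 1 * t) \<partial>lborel) = (\<integral>\<^sup>+d. h d \<partial>lborel)"
    using nn_integral_real_affine[of h 1 "- s"] by simp
  also have "(\<integral>\<^sup>+t. h (s + (-1) * t) \<partial>lborel) = (\<integral>\<^sup>+d. h d \<partial>lborel)"
    using nn_integral_real_affine[of h "-1" s] by simp
  also have "(\<integral>\<^sup>+d. h d \<partial>lborel) + (\<integral>\<^sup>+d. h d \<partial>lborel) + ennreal (m powr (\<eta> - 1)) * emeasure lborel E
      = ennreal (m powr \<eta> / \<eta> + m powr \<eta> / \<eta> + m powr (\<eta> - 1) * m)"
  proof -
    have "ennreal u + ennreal u' + ennreal v * ennreal m = ennreal (u + u' + v * m)" if "u \<ge> 0" "u' \<ge> 0" "v \<ge> 0" for u u' v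
      using that fin by (simp add: ennreal_mult)
    from this[of "m powr \<eta> / \<eta>" "m powr \<eta> / \<eta>" "m powr (\<eta> - 1)"] show ?thesis
      unfolding h fin using \<eta> by simp
  qed
  also have "m powr (\<eta> - 1) * m = m powr \<eta>"
    using fin by (simp add: powr_diff)
  finally show ?thesis by (simp add: algebra_simps)
qed

text \<open>For \<open>d > \<tau>\<close> one has
  \<open>1 / d \<le> \<tau> powr (- \<eta>) * d powr (\<eta> - 1)\<close>. Giving up the power
  \<open>\<eta>\<close> to the cutoff replaces the borderline kernel by a locally integrable
  one.\<close>

lemma double_fractional_bound:
  fixes E :: "real set" and \<eta> \<tau> :: real
  assumes E[measurable]: "E \<in> sets borel" and fin: "emeasure lborel E = ennreal m" "m > 0" and \<eta>: "0 < \<eta>" "\<eta> \<le> 1" and "\<tau> > 0"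
  shows "(\<integral>\<^sup>+z. ennreal (indicator {z. \<tau> < \<bar>fst z - snd z\<bar>} z / \<bar>fst z - snd z\<bar>) * indicator (E \<times> E) z \<partial>(lborel \<Otimes>\<^sub>M lborel))
     \<le> ennreal ((2 / \<eta> + 1) * \<tau> powr (- \<eta>) * m powr (1 + \<eta>))"
proof -
  have "(\<integral>\<^sup>+z. ennreal (indicator {z. \<tau> < \<bar>fst z - snd z\<bar>} z / \<bar>fst z - snd z\<bar>) * indicator (E \<times> E) z \<partial>(lborel \<Otimes>\<^sub>M lborel))
     \<le> (\<integral>\<^sup>+z. ennreal (\<tau> powr (- \<eta>)) * (indicator E (fst z) * (ennreal (\<bar>fst z - snd z\<bar> powr (\<eta> - 1)) * indicator E (snd z))) \<partial>(lborel \<Otimes>\<^sub>M lborel))"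
  proof (rule nn_integral_mono)
    fix z :: "real \<times> real"
    define d where "d = \<bar>fst z - snd z\<bar>"
    show "ennreal (indicator {z. \<tau> < \<bar>fst z - snd z\<bar>} z / \<bar>fst z - snd z\<bar>) * indicator (E \<times> E) z
      \<le> ennreal (\<tau> powr (- \<eta>)) * (indicator E (fst z) * (ennreal (\<bar>fst z - snd z\<bar> powr (\<eta> - 1)) * indicator E (snd z)))"
    proof (cases "\<tau> < d \<and> z \<in> E \<times> E")
      case True
      have "1 / d = d powr (- \<eta>) * d powr (\<eta> - 1)"
        using True \<open>\<tau> > 0\<close> powr_add[of d "- \<eta>" "\<eta> - 1"] by (simp add: powr_minus_divide)
      also have "\<dots> \<le> \<tau> powr (- \<eta>) * d powr (\<eta> - 1)"
        using True \<open>\<tau> > 0\<close> \<eta> by (intro mult_right_mono powr_mono2') auto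
      finally show ?thesis
        using True by (cases z) (simp add: d_def ennreal_mult'[symmetric] ennreal_leI)
    qed (auto simp: d_def indicator_def)
  qed
  also have "\<dots> = ennreal (\<tau> powr (- \<eta>)) * (\<integral>\<^sup>+z. indicator E (fst z) * (ennreal (\<bar>fst z - snd z\<bar> powr (\<eta> - 1)) * indicator E (snd z)) \<partial>(lborel \<Otimes>\<^sub>M lborel))"
    by (rule nn_integral_cmult) measurable
  also have "(\<integral>\<^sup>+z. indicator E (fst z) * (ennreal (\<bar>fst z - snd z\<bar> powr (\<eta> - 1)) * indicator E (snd z)) \<partial>(lborel \<Otimes>\<^sub>M lborel))
     = (\<integral>\<^sup>+s. indicator E s * (\<integral>\<^sup>+t. ennreal (\<bar>s - t\<bar> powr (\<eta> - 1)) * indicator E t \<partial>lborel) \<partial>lborel)"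
    by (subst lborel.nn_integral_fst[symmetric]) (auto simp: nn_integral_cmult)
  also have "\<dots> \<le> (\<integral>\<^sup>+s. indicator E s * ennreal ((2 / \<eta> + 1) * m powr \<eta>) \<partial>lborel)"
    by (intro nn_integral_mono mult_left_mono fractional_integral_bound assms) auto
  also have "\<dots> = ennreal m * ennreal ((2 / \<eta> + 1) * m powr \<eta>)"
    by (simp add: nn_integral_multc fin)
  finally have "(\<integral>\<^sup>+z. ennreal (indicator {z. \<tau> < \<bar>fst z - snd z\<bar>} z / \<bar>fst z - snd z\<bar>) * indicator (E \<times> E) z \<partial>(lborel \<Otimes>\<^sub>M lborel))
     \<le> ennreal (\<tau> powr (- \<eta>)) * (ennreal m * ennreal ((2 / \<eta> + 1) * m powr \<eta>))"
    by (simp add: mult_left_mono)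
  also have "\<dots> = ennreal (\<tau> powr (- \<eta>) * (m * ((2 / \<eta> + 1) * m powr \<eta>)))"
    using fin \<eta> by (simp add: ennreal_mult)
  also have "\<tau> powr (- \<eta>) * (m * ((2 / \<eta> + 1) * m powr \<eta>)) = (2 / \<eta> + 1) * \<tau> powr (- \<eta>) * m powr (1 + \<eta>)"
    using fin by (simp add: powr_add)
  finally show ?thesis .
qed

lemma near_diagonal_bound:
  fixes E :: "real set"
  assumes E[measurable]: "E \<in> sets borel" and fin: "emeasure lborel E = ennreal m" "m \<ge> 0" and "\<tau> \<ge> 0"
  shows "(\<integral>\<^sup>+z. indicator {z. \<bar>fst z - snd z\<bar> \<le> \<tau>} z * indicator (E \<times> E) z \<partial>(lborel \<Otimes>\<^sub>M lborel)) \<le> ennreal (2 * m * \<tau>)"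
proof -
  have "(\<integral>\<^sup>+z. indicator {z. \<bar>fst z - snd z\<bar> \<le> \<tau>} z * indicator (E \<times> E) z \<partial>(lborel \<Otimes>\<^sub>M lborel))
      \<le> (\<integral>\<^sup>+z. indicator E (fst z) * indicator {fst z - \<tau>..fst z + \<tau>} (snd z) \<partial>(lborel \<Otimes>\<^sub>M lborel :: (real \<times> real) measure))"
    by (intro nn_integral_mono) (auto simp: indicator_def)
  also have "\<dots> = (\<integral>\<^sup>+s. \<integral>\<^sup>+t. indicator E s * indicator {s - \<tau>..s + \<tau>} t \<partial>lborel \<partial>lborel)"
  proof (subst lborel.nn_integral_fst[symmetric])
    have [measurable]: "{z::real\<times>real. fst z - \<tau> \<le> snd z \<and> snd z \<le> fst z + \<tau>} \<in> sets (borel \<Otimes>\<^sub>M borel)"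
      unfolding borel_prod
      by (intro borel_closed closed_Collect_conj closed_Collect_le continuous_intros)
    have "(\<lambda>z::real\<times>real. indicator E (fst z) * indicator {z. fst z - \<tau> \<le> snd z \<and> snd z \<le> fst z + \<tau>} z :: ennreal) \<in> borel_measurable (lborel \<Otimes>\<^sub>M lborel)"
      by measurable
    also have "(\<lambda>z::real\<times>real. indicator E (fst z) * indicator {z. fst z - \<tau> \<le> snd z \<and> snd z \<le> fst z + \<tau>} z)
      = (\<lambda>z. indicator E (fst z) * indicator {fst z - \<tau>..fst z + \<tau>} (snd z) :: ennreal)"
      by (auto simp: indicator_def fun_eq_iff)
    finally show "(\<lambda>z::real\<times>real. indicator E (fst z) * indicator {fst z - \<tau>..fst z + \<tau>} (snd z) :: ennreal) \<in> borel_measurable (lborel \<Otimes>\<^sub>M lborel)" .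
  qed simp
  also have "\<dots> = (\<integral>\<^sup>+s. indicator E s * ennreal (2 * \<tau>) \<partial>lborel)"
    using \<open>\<tau> \<ge> 0\<close> by (simp add: nn_integral_cmult)
  also have "\<dots> = ennreal m * ennreal (2 * \<tau>)"
    by (simp add: nn_integral_multc fin)
  also have "\<dots> = ennreal (2 * m * \<tau>)"
    using fin \<open>\<tau> \<ge> 0\<close> by (simp add: ennreal_mult[symmetric] mult_ac)
  finally show ?thesis .
qed

section \<open>The extension operator and its level sets\<close>

definition extension :: "(real \<Rightarrow> complex) \<Rightarrow> real \<times> real \<Rightarrow> complex" where
  "extension g x = (LINT t|lborel. g t * wave x (circ t))"

lemma extension_measurable [measurable]:
  assumes [measurable]: "g \<in> borel_measurable borel"
  shows "extension g \<in> borel_measurable borel"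
  unfolding extension_def by measurable

text \<open>The squared extension is split at a distance \<open>\<tau>\<close> from the diagonal
  that depends on the level. The near part is at most \<open>l^2 / 2\<close> everywhere, so every
  point of the level set has \<open>norm (H x) \<ge> l^2 / 2\<close>, and Chebyshev with the
  \<open>L^2\<close> bound for \<open>H\<close> measures these points. The exponents are those of
  \<open>m powr (P - 3)\<close> and \<open>l powr (- P)\<close> at
  \<open>P = 4 + 2 * \<eta>\<close>.\<close>

lemma extension_level_set:
  fixes g :: "real \<Rightarrow> complex" and E :: "real set"
  assumes g[measurable]: "g \<in> borel_measurable borel" and E[measurable]: "E \<in> sets borel"
    and EA: "E \<subseteq> {a..a+1/4}" and gE: "\<And>t. norm (g t) \<le> indicator E t"
    and m: "m = measure lborel E" "m > 0" and \<eta>: "0 < \<eta>" "\<eta> \<le> 1" and l: "l > 0"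
  shows "emeasure lborel {x. l < norm (extension g x)} \<le> ennreal (12 * (2 / \<eta> + 1) * 4 powr \<eta> * m powr (1 + 2 * \<eta>) * l powr (- (4 + 2 * \<eta>)))"
proof -
  define A where "A = {a..a+1/4} \<times> {a..a+1/4}"
  define N where "N = (lborel \<Otimes>\<^sub>M lborel :: (real \<times> real) measure)"
  define M where "M = restrict_space N A"
  \<comment> \<open>The part of \<open>E \<times> E\<close> within distance \<open>\<tau>\<close> of
    the diagonal has measure at most \<open>2 * m * \<tau>\<close>; this choice makes it
    \<open>l^2 / 2\<close>.\<close>
  define \<tau> where "\<tau> = l\<^sup>2 / (4 * m)"
  have \<tau>: "\<tau> > 0" using l m by (simp add: \<tau>_def)
  define \<Phi> where "\<Phi> z = circ (fst z) + circ (snd z)" for z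
  define D where "D = {z::real\<times>real. \<tau> < \<bar>fst z - snd z\<bar>}"
  define gg where "gg z = g (fst z) * g (snd z)" for z
  define G where "G z = gg z * indicator D z" for z
  have finE: "emeasure lborel E < \<infinity>"
    using emeasure_mono[OF EA, of lborel] by (auto intro: le_less_trans)
  have emE: "emeasure lborel E = ennreal m"
    unfolding m using finE by (intro emeasure_eq_ennreal_measure) auto
  have [measurable_cong]: "sets N = sets (borel \<Otimes>\<^sub>M borel)"
    unfolding N_def by (intro sets_pair_measure_cong) auto
  have AB: "A \<in> sets (borel \<Otimes>\<^sub>M borel)" unfolding A_def by measurable
  then have [measurable]: "A \<in> sets N" by (simp add: N_def)
  have [measurable]: "D \<in> sets N"
  proof -
    have "{z \<in> space N. \<tau> < \<bar>fst z - snd z\<bar>} \<in> sets N" by measurable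
    then show ?thesis by (simp add: D_def N_def space_pair_measure)
  qed
  have [measurable]: "\<Phi> \<in> borel_measurable N" unfolding \<Phi>_def by measurable
  have [measurable]: "gg \<in> borel_measurable N" unfolding gg_def by measurable
  have [measurable]: "G \<in> borel_measurable N" unfolding G_def by measurable
  have ggb: "norm (gg z) \<le> indicator (E \<times> E) z" for z
  proof -
    have "norm (gg z) \<le> indicator E (fst z) * indicator E (snd z)"
      unfolding gg_def norm_mult by (intro mult_mono gE) auto
    then show ?thesis by (auto simp: indicator_def mem_Times_iff split: if_splits)
  qed
  have Gb: "norm (G z) \<le> indicator (E \<times> E) z * indicator D z" for z
    using ggb[of z] by (auto simp: G_def indicator_def split: if_splits)
  have "finite_measure M"
  proof (rule finite_measureI)
    have "emeasure N A = ennreal (1/16)"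
      unfolding A_def N_def by (subst lborel.emeasure_pair_measure_Times) (auto simp: ennreal_mult'[symmetric])
    then show "emeasure M (space M) \<noteq> \<infinity>"
      unfolding M_def using AB by (subst emeasure_restrict_space) (auto simp: space_restrict_space N_def space_pair_measure)
  qed
  moreover have "finite_extension_axioms M \<Phi> G 1"
  proof
    show "\<Phi> \<in> borel_measurable M" "G \<in> borel_measurable M"
      unfolding M_def by (intro measurable_restrict_space1; measurable)+
    show "norm (G z) \<le> 1" for z
      using Gb[of z] by (auto simp: indicator_def of_bool_def split: if_splits)
  qed
  ultimately interpret finite_extension M \<Phi> G 1
    by (rule finite_extension.intro)
  have sq: "(\<integral>\<^sup>+x. ennreal ((norm (H x))\<^sup>2) \<partial>lborel) \<le> 3 * ennreal ((2 / \<eta> + 1) * \<tau> powr (- \<eta>) * m powr (1 + \<eta>))"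
  proof -
    \<comment> \<open>The Schur weight is comparable to the Jacobian of the sum map. Dividing the
      square of \<open>G\<close> by it produces the kernel \<open>1 / \<bar>s - t\<bar>\<close>,
      which stays bounded because \<open>G\<close> vanishes up to distance
      \<open>\<tau>\<close>.\<close>
    define w where "w z = \<bar>fst z - snd z\<bar>" for z :: "real \<times> real"
    have "(\<integral>\<^sup>+x. ennreal ((norm (H x))\<^sup>2) \<partial>lborel) \<le> 3 * (\<integral>\<^sup>+z. ennreal ((norm (G z))\<^sup>2 / w z) \<partial>M)"
    proof (rule H_square_bound)
      show "w \<in> borel_measurable M" unfolding M_def w_def N_def by (intro measurable_restrict_space1) measurable
      show "w z \<ge> 0" for z by (simp add: w_def)
      show "G z = 0" if "w z = 0" for z using that \<tau> by (simp add: w_def G_def D_def)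
      fix \<epsilon> :: real and v assume "\<epsilon> > 0"
      have "(\<integral>\<^sup>+z. ennreal (w z * kern \<epsilon> (v - \<Phi> z)) \<partial>M) = (\<integral>\<^sup>+z. ennreal (w z * kern \<epsilon> (v - \<Phi> z)) * indicator A z \<partial>N)"
        unfolding M_def by (intro nn_integral_restrict_space) (simp add: N_def A_def space_pair_measure)
      also have "\<dots> \<le> 3"
        using kernel_bound[OF \<open>\<epsilon> > 0\<close>, where a=a and v=v] unfolding w_def \<Phi>_def A_def N_def by (simp add: diff_diff_eq)
      finally show "(\<integral>\<^sup>+z. ennreal (w z * kern \<epsilon> (v - \<Phi> z)) \<partial>M) \<le> 3" .
    qed
    also have "(\<integral>\<^sup>+z. ennreal ((norm (G z))\<^sup>2 / w z) \<partial>M) = (\<integral>\<^sup>+z. ennreal ((norm (G z))\<^sup>2 / w z) * indicator A z \<partial>N)"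
      unfolding M_def by (intro nn_integral_restrict_space) (simp add: N_def A_def space_pair_measure)
    also have "\<dots> \<le> (\<integral>\<^sup>+z. ennreal (indicator {z. \<tau> < \<bar>fst z - snd z\<bar>} z / \<bar>fst z - snd z\<bar>) * indicator (E \<times> E) z \<partial>N)"
    proof (rule nn_integral_mono)
      fix z
      have "norm (G z) = 0 \<or> z \<in> E \<times> E \<and> z \<in> D \<and> norm (G z) \<le> 1"
        using Gb[of z] by (auto simp: indicator_def of_bool_def split: if_splits)
      then show "ennreal ((norm (G z))\<^sup>2 / w z) * indicator A z \<le> ennreal (indicator {z. \<tau> < \<bar>fst z - snd z\<bar>} z / \<bar>fst z - snd z\<bar>) * indicator (E \<times> E) z"
        by (auto simp: w_def D_def indicator_def power_le_one intro!: ennreal_leI divide_right_mono)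
    qed
    also have "\<dots> \<le> ennreal ((2 / \<eta> + 1) * \<tau> powr (- \<eta>) * m powr (1 + \<eta>))"
      unfolding N_def by (rule double_fractional_bound[OF E emE m(2) \<eta> \<tau>])
    finally show ?thesis by (simp add: mult_left_mono)
  qed
  have g_int: "integrable lborel g"
    by (rule Bochner_Integration.integrable_bound[of _ "indicator E :: real \<Rightarrow> real"])
       (use finE gE in \<open>auto simp: integrable_indicator_iff\<close>)
  have close: "norm ((extension g x)\<^sup>2 - H x) \<le> l\<^sup>2 / 2" for x
  proof -
    define c where "c t = wave x (circ t)" for t
    have [measurable]: "c \<in> borel_measurable borel" unfolding c_def by measurable
    have cc: "wave x (\<Phi> z) = c (fst z) * c (snd z)" for z
      by (simp only: c_def \<Phi>_def wave_add)
    have gc: "integrable lborel (\<lambda>t. g t * c t)"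
      by (rule Bochner_Integration.integrable_bound[OF g_int]) (auto simp: norm_mult c_def)
    have 1: "integrable N (\<lambda>z. gg z * (c (fst z) * c (snd z)))"
      "(extension g x)\<^sup>2 = (LINT z|N. gg z * (c (fst z) * c (snd z)))"
      using lborel_prod_integrable_mult[OF gc gc]
      by (simp_all add: N_def lborel_prod gg_def extension_def c_def power2_eq_square mult_ac)
    have gA: "gg z * indicator A z = gg z" for z
    proof (cases "z \<in> A")
      case False
      then have "z \<notin> E \<times> E" using EA by (auto simp: A_def)
      then show ?thesis using ggb[of z] by (simp add: indicator_def)
    qed simp
    have 2: "integrable N (\<lambda>z. G z * (c (fst z) * c (snd z)))"
      by (rule Bochner_Integration.integrable_bound[OF 1(1)])
         (auto simp: N_def[symmetric] G_def norm_mult indicator_def c_def)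
    have "H x = (LINT z|N. indicator A z *\<^sub>R (G z * (c (fst z) * c (snd z))))"
      unfolding H_def cc unfolding M_def by (rule integral_restrict_space) (simp add: N_def A_def space_pair_measure)
    also have "\<dots> = (LINT z|N. G z * (c (fst z) * c (snd z)))"
    proof (rule Bochner_Integration.integral_cong)
      fix z
      show "indicator A z *\<^sub>R (G z * (c (fst z) * c (snd z))) = G z * (c (fst z) * c (snd z))"
        using gA[of z] by (auto simp: G_def indicator_def)
    qed simp
    finally have "(extension g x)\<^sup>2 - H x = (LINT z|N. gg z * (c (fst z) * c (snd z)) - G z * (c (fst z) * c (snd z)))"
      unfolding 1(2) using 1(1) 2 by simp
    then have "ennreal (norm ((extension g x)\<^sup>2 - H x)) \<le> (\<integral>\<^sup>+z. ennreal (norm (gg z * (c (fst z) * c (snd z)) - G z * (c (fst z) * c (snd z)))) \<partial>N)"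
      by (simp only: norm_integral_le_nn_integral)
    also have "\<dots> \<le> (\<integral>\<^sup>+z. indicator {z. \<bar>fst z - snd z\<bar> \<le> \<tau>} z * indicator (E \<times> E) z \<partial>N)"
    proof (rule nn_integral_mono)
      fix z
      have "norm (gg z * (c (fst z) * c (snd z)) - G z * (c (fst z) * c (snd z))) = norm (gg z) * indicator (- D) z"
        by (auto simp: G_def indicator_def norm_mult c_def)
      also have "ennreal \<dots> \<le> indicator {z. \<bar>fst z - snd z\<bar> \<le> \<tau>} z * indicator (E \<times> E) z"
        using ggb[of z] by (auto simp: D_def indicator_def split: if_splits)
      finally show "ennreal (norm (gg z * (c (fst z) * c (snd z)) - G z * (c (fst z) * c (snd z)))) \<le> indicator {z. \<bar>fst z - snd z\<bar> \<le> \<tau>} z * indicator (E \<times> E) z" .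
    qed
    also have "\<dots> \<le> ennreal (2 * m * \<tau>)"
      unfolding N_def using m \<tau> by (intro near_diagonal_bound[OF E emE]) auto
    also have "2 * m * \<tau> = l\<^sup>2 / 2"
      using m by (simp add: \<tau>_def)
    finally show ?thesis by simp
  qed
  have "emeasure lborel {x. l < norm (extension g x)} \<le> emeasure lborel {x \<in> UNIV. 1 \<le> ennreal (4 / l ^ 4) * ennreal ((norm (H x))\<^sup>2)}"
  proof (rule emeasure_mono)
    show "{x. l < norm (extension g x)} \<subseteq> {x \<in> UNIV. 1 \<le> ennreal (4 / l ^ 4) * ennreal ((norm (H x))\<^sup>2)}"
    proof (rule subsetI)
      fix x assume "x \<in> {x. l < norm (extension g x)}"
      then have "l\<^sup>2 \<le> norm ((extension g x)\<^sup>2)"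
        using l by (auto simp: norm_power intro: power_mono)
      also have "\<dots> \<le> norm ((extension g x)\<^sup>2 - H x) + norm (H x)"
        using norm_triangle_ineq[of "(extension g x)\<^sup>2 - H x" "H x"] by simp
      also have "\<dots> \<le> l\<^sup>2 / 2 + norm (H x)" using close[of x] by simp
      finally have "l\<^sup>2 / 2 \<le> norm (H x)" by simp
      then have "(l\<^sup>2 / 2)\<^sup>2 \<le> (norm (H x))\<^sup>2" by (intro power_mono) auto
      then have "1 \<le> 4 / l ^ 4 * (norm (H x))\<^sup>2"
        using l by (simp add: field_simps power_divide flip: power_mult)
      then have "1 \<le> ennreal (4 / l ^ 4) * ennreal ((norm (H x))\<^sup>2)"
        using l by (simp add: ennreal_mult'[symmetric] flip: ennreal_1)
      then show "x \<in> {x \<in> UNIV. 1 \<le> ennreal (4 / l ^ 4) * ennreal ((norm (H x))\<^sup>2)}"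
        by simp
    qed
  qed measurable
  also have "\<dots> \<le> ennreal (4 / l ^ 4) * (\<integral>\<^sup>+x. ennreal ((norm (H x))\<^sup>2) * indicator UNIV x \<partial>lborel)"
    using nn_integral_Markov_inequality[of "\<lambda>x. ennreal ((norm (H x))\<^sup>2)" UNIV lborel "ennreal (4 / l ^ 4)"] by simp
  also have "\<dots> \<le> ennreal (4 / l ^ 4) * (3 * ennreal ((2 / \<eta> + 1) * \<tau> powr (- \<eta>) * m powr (1 + \<eta>)))"
    using sq by (intro mult_left_mono) auto
  also have "\<dots> = ennreal (4 / l ^ 4 * (3 * ((2 / \<eta> + 1) * \<tau> powr (- \<eta>) * m powr (1 + \<eta>))))"
    using l \<eta> by (subst ennreal_numeral[symmetric], subst ennreal_mult'[symmetric], simp, subst ennreal_mult'[symmetric]) auto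
  also have "4 / l ^ 4 * (3 * ((2 / \<eta> + 1) * \<tau> powr (- \<eta>) * m powr (1 + \<eta>)))
      = 12 * (2 / \<eta> + 1) * 4 powr \<eta> * m powr (1 + 2 * \<eta>) * l powr (- (4 + 2 * \<eta>))"
  proof -
    have "\<tau> powr (- \<eta>) = (4 powr \<eta> * m powr \<eta>) / l powr (2 * \<eta>)"
      using l m by (simp add: \<tau>_def powr_minus_divide powr_divide powr_mult powr_powr flip: powr_numeral)
    moreover have "m powr (1 + 2 * \<eta>) = m powr (1 + \<eta>) * m powr \<eta>"
      using powr_add[of m "1 + \<eta>" \<eta>] by (simp add: algebra_simps)
    moreover have "l powr (- (4 + 2 * \<eta>)) = 1 / (l ^ 4 * l powr (2 * \<eta>))"
      using l powr_minus_divide[of l "4 + 2 * \<eta>"] powr_add[of l 4 "2 * \<eta>"] powr_numeral[of l "num.Bit0 (num.Bit0 num.One)"]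
      by (simp only:)
    ultimately show ?thesis by simp
  qed
  finally show ?thesis .
qed

text \<open>The weak bound at a smaller exponent \<open>Q\<close> is combined with the trivial bound
  by the measure \<open>m\<close> of \<open>E\<close>. The powers of \<open>m\<close> add up to
  \<open>1 + 2 * \<eta> + (P - Q) = P - 3\<close>, so the choice of \<open>\<eta>\<close> affects
  the constant only.\<close>

theorem restricted_extension_bound:
  assumes P: "P > 4"
  obtains C :: real where "C > 0" 
    "\<And>a E g. g \<in> borel_measurable borel \<Longrightarrow> E \<in> sets borel \<Longrightarrow> E \<subseteq> {a..a+1/4} \<Longrightarrow> (\<And>t. norm (g t) \<le> indicator E t) \<Longrightarrow>
      (\<integral>\<^sup>+x. ennreal (norm (extension g x) powr P) \<partial>lborel) \<le> ennreal (C * measure lborel E powr (P - 3))"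
proof -
  \<comment> \<open>\<open>\<eta> \<le> (P - 4) / 4\<close> gives \<open>4 + 2 * \<eta> < P\<close>;
    the cap at 1 is the range of the fractional integral bound.\<close>
  define \<eta> where "\<eta> = min 1 ((P - 4) / 4)"
  have \<eta>: "0 < \<eta>" "\<eta> \<le> 1" "4 + 2 * \<eta> < P"
    using P by (auto simp: \<eta>_def min_def field_simps)
  define Q where "Q = 4 + 2 * \<eta>"
  have Q: "0 < Q" "Q < P" using \<eta> by (auto simp: Q_def)
  define B where "B = 12 * (2 / \<eta> + 1) * 4 powr \<eta>"
  have B: "B > 0" using \<eta> by (simp add: B_def add_pos_pos)
  show ?thesis
  proof
    show "P / (P - Q) * B > 0" using Q B by simp
    fix a :: real and E :: "real set" and g :: "real \<Rightarrow> complex"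
    assume g[measurable]: "g \<in> borel_measurable borel" and E: "E \<in> sets borel" "E \<subseteq> {a..a+1/4}" and gE: "\<And>t. norm (g t) \<le> indicator E t"
    define m where "m = measure lborel E"
    have finE: "emeasure lborel E < \<infinity>"
      using emeasure_mono[OF E(2), of lborel] by (auto intro: le_less_trans)
    have bd: "norm (extension g x) \<le> m" for x
    proof -
      have "ennreal (norm (extension g x)) \<le> (\<integral>\<^sup>+t. ennreal (norm (g t * wave x (circ t))) \<partial>lborel)"
        unfolding extension_def by (rule norm_integral_le_nn_integral)
      also have "\<dots> \<le> (\<integral>\<^sup>+t. indicator E t \<partial>lborel)"
        using gE by (intro nn_integral_mono) (auto simp: norm_mult ennreal_indicator[symmetric] intro!: ennreal_leI)
      also have "\<dots> = ennreal m"
        using E finE by (simp add: m_def emeasure_eq_ennreal_measure)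
      finally show ?thesis by (simp add: m_def)
    qed
    show "(\<integral>\<^sup>+x. ennreal (norm (extension g x) powr P) \<partial>lborel) \<le> ennreal (P / (P - Q) * B * measure lborel E powr (P - 3))"
    proof (cases "m = 0")
      case True
      then have "extension g x = 0" for x using bd[of x] by simp
      then show ?thesis by simp
    next
      case False
      then have m: "m > 0" by (simp add: m_def less_le)
      have "(\<integral>\<^sup>+x. ennreal (norm (extension g x) powr P) \<partial>lborel) \<le> ennreal (P / (P - Q) * (B * m powr (1 + 2 * \<eta>)) * m powr (P - Q))"
      proof (rule lborel.weak_bound_imp_powr_bound[OF _ _ bd Q])
        fix l :: real assume "l > 0"
        from extension_level_set[OF g E gE m_def m \<eta>(1,2) this]
        show "emeasure lborel {x \<in> space lborel. l < norm (extension g x)} \<le> ennreal (B * m powr (1 + 2 * \<eta>) * l powr - Q)"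
          by (simp add: B_def Q_def)
      qed (use B in auto)
      also have "P / (P - Q) * (B * m powr (1 + 2 * \<eta>)) * m powr (P - Q) = P / (P - Q) * B * m powr (P - 3)"
      proof -
        have "m powr (1 + 2 * \<eta>) * m powr (P - Q) = m powr (P - 3)"
          using powr_add[of m "1 + 2 * \<eta>" "P - Q"] by (simp add: Q_def)
        then show ?thesis by simp
      qed
      finally show ?thesis by (simp add: m_def)
    qed
  qed
qed

subsection \<open>Restriction to the circle\<close>

text \<open>Real upper bounds \<open>U\<close> and \<open>V\<close> in place of the integrals keep
  the conclusion finite. Young's inequality is integrated after normalising both functions, hence
  the separate case of a zero bound.\<close>

lemma nn_integral_holder:
  fixes u v :: "'a \<Rightarrow> real"
  assumes [measurable]: "u \<in> borel_measurable M" "v \<in> borel_measurable M"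
    and u0: "\<And>x. u x \<ge> 0" and v0: "\<And>x. v x \<ge> 0"
    and pq: "p > 1" "q > 1" "1 / p + 1 / q = 1"
    and U: "(\<integral>\<^sup>+x. ennreal (u x powr p) \<partial>M) \<le> ennreal U" "U \<ge> 0"
    and V: "(\<integral>\<^sup>+x. ennreal (v x powr q) \<partial>M) \<le> ennreal V" "V \<ge> 0"
  shows "(\<integral>\<^sup>+x. ennreal (u x * v x) \<partial>M) \<le> ennreal (U powr (1 / p) * V powr (1 / q))"
proof (cases "U = 0 \<or> V = 0")
  case True
  have "AE x in M. u x * v x = 0"
  proof (cases "U = 0")
    case True
    then have "AE x in M. ennreal (u x powr p) = 0"
      using U(1) by (subst nn_integral_0_iff_AE[symmetric]) auto
    then show ?thesis by eventually_elim auto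
  next
    case False
    then have "V = 0" using \<open>U = 0 \<or> V = 0\<close> by simp
    then have "AE x in M. ennreal (v x powr q) = 0"
      using V(1) by (subst nn_integral_0_iff_AE[symmetric]) auto
    then show ?thesis by eventually_elim auto
  qed
  then have "(\<integral>\<^sup>+x. ennreal (u x * v x) \<partial>M) = (\<integral>\<^sup>+x. 0 \<partial>M)"
    by (intro nn_integral_cong_AE) auto
  then show ?thesis by simp
next
  case False
  then have UV: "U > 0" "V > 0" using U V by auto
  define K where "K = U powr (1 / p) * V powr (1 / q)"
  have K: "K > 0" using UV by (simp add: K_def)
  have pt: "u x * v x \<le> K / (p * U) * u x powr p + K / (q * V) * v x powr q" for x
  proof -
    define a b where "a = u x / U powr (1 / p)" and "b = v x / V powr (1 / q)"
    have ab: "a \<ge> 0" "b \<ge> 0" using u0 v0 by (auto simp: a_def b_def)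
    have "u x * v x = K * (a * b)"
      using UV by (simp add: a_def b_def K_def)
    also have "\<dots> \<le> K * (a powr p / p + b powr q / q)"
      using Youngs_inequality[OF pq ab] K by (intro mult_left_mono) auto
    also have "a powr p = u x powr p / U"
      using UV pq u0 by (simp add: a_def powr_divide powr_powr)
    also have "b powr q = v x powr q / V"
      using UV pq v0 by (simp add: b_def powr_divide powr_powr)
    finally show ?thesis by (simp add: algebra_simps)
  qed
  have "(\<integral>\<^sup>+x. ennreal (u x * v x) \<partial>M)
     \<le> (\<integral>\<^sup>+x. ennreal (K / (p * U)) * ennreal (u x powr p) + ennreal (K / (q * V)) * ennreal (v x powr q) \<partial>M)"
    using pt K UV pq by (intro nn_integral_mono) (simp add: ennreal_mult[symmetric] ennreal_plus[symmetric] ennreal_leI del: ennreal_plus)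
  also have "\<dots> = ennreal (K / (p * U)) * (\<integral>\<^sup>+x. ennreal (u x powr p) \<partial>M) + ennreal (K / (q * V)) * (\<integral>\<^sup>+x. ennreal (v x powr q) \<partial>M)"
    by (simp add: nn_integral_add nn_integral_cmult)
  also have "\<dots> \<le> ennreal (K / (p * U)) * ennreal U + ennreal (K / (q * V)) * ennreal V"
    by (intro add_mono mult_left_mono U V) auto
  also have "\<dots> = ennreal (K / (p * U) * U + K / (q * V) * V)"
    using K UV pq by (simp add: ennreal_mult[symmetric] del: times_divide_eq_left)
  also have "K / (p * U) * U + K / (q * V) * V = K * (1 / p + 1 / q)"
    using UV by (simp add: distrib_left)
  finally show ?thesis using pq by (simp add: K_def)
qed

section \<open>Elementary properties of the Fourier transform\<close>

lemma fourier_wave: "fourier f \<xi> = (LINT x|lborel. wave x \<xi> * f x)"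
  unfolding fourier_def fourier_exp_eq ..

lemma fourier_measurable [measurable]:
  fixes f :: "'a::euclidean_space \<Rightarrow> complex"
  assumes [measurable]: "f \<in> borel_measurable borel"
  shows "fourier f \<in> borel_measurable borel"
  unfolding fourier_wave by measurable

lemma fourier_integrable:
  fixes f :: "'a::euclidean_space \<Rightarrow> complex"
  assumes "integrable lborel f"
  shows "integrable lborel (\<lambda>x. wave x \<xi> * f x)"
proof -
  have [measurable]: "f \<in> borel_measurable borel" using assms by (auto dest: borel_measurable_integrable)
  show ?thesis
    by (rule Bochner_Integration.integrable_bound[OF assms]) (auto simp: norm_mult)
qed

lemma norm_fourier_le:
  fixes f :: "'a::euclidean_space \<Rightarrow> complex"
  shows "norm (fourier f \<xi>) \<le> (LINT x|lborel. norm (f x))"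
  unfolding fourier_wave by (rule order_trans[OF integral_norm_bound]) (simp add: norm_mult)

lemma fourier_add:
  fixes f g :: "'a::euclidean_space \<Rightarrow> complex"
  assumes "integrable lborel f" "integrable lborel g"
  shows "fourier (\<lambda>x. f x + g x) \<xi> = fourier f \<xi> + fourier g \<xi>"
  unfolding fourier_wave distrib_left
  by (rule Bochner_Integration.integral_add) (intro fourier_integrable assms)+

lemma fourier_cmult:
  fixes f :: "'a::euclidean_space \<Rightarrow> complex"
  shows "fourier (\<lambda>x. c * f x) \<xi> = c * fourier f \<xi>"
  unfolding fourier_wave by (subst mult.left_commute) simp

lemma fourier_tensor:
  fixes f :: "'a::euclidean_space \<Rightarrow> complex" and g :: "'b::euclidean_space \<Rightarrow> complex"
  assumes "integrable lborel f" "integrable lborel g"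
  shows "fourier (\<lambda>z. f (fst z) * g (snd z)) \<zeta> = fourier f (fst \<zeta>) * fourier g (snd \<zeta>)"
proof -
  have "wave z \<zeta> * (f (fst z) * g (snd z))
      = (wave (fst z) (fst \<zeta>) * f (fst z)) * (wave (snd z) (snd \<zeta>) * g (snd z))" for z
    unfolding wave_prod[of z \<zeta>] by (simp only: mult_ac)
  then show ?thesis
    unfolding fourier_wave
    using lborel_prod_integrable_mult(2)[OF fourier_integrable[OF assms(1), of "fst \<zeta>"]
        fourier_integrable[OF assms(2), of "snd \<zeta>"]]
    by (simp only:)
qed

text \<open>Extension is the transpose of restriction; absolute integrability of \<open>f\<close>
  and \<open>g\<close> is all that Fubini asks for.\<close>

lemma extension_duality:
  fixes f :: "real \<times> real \<Rightarrow> complex" and g :: "real \<Rightarrow> complex"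
  assumes f: "integrable lborel f" and g: "integrable lborel g"
  shows "(LINT t|lborel. g t * fourier f (circ t)) = (LINT x|lborel. f x * extension g x)"
proof -
  have [measurable]: "f \<in> borel_measurable borel" "g \<in> borel_measurable borel"
    using assms by (auto dest: borel_measurable_integrable)
  have int: "integrable (lborel \<Otimes>\<^sub>M lborel) (\<lambda>(t, x). g t * (wave x (circ t) * f x))"
  proof (rule lborel_pair.Fubini_integrable)
    show "integrable lborel (\<lambda>t. LINT x|lborel. norm (case (t, x) of (t, x) \<Rightarrow> g t * (wave x (circ t) * f x)))"
      using g by (simp add: norm_mult)
    show "AE t in lborel. integrable lborel (\<lambda>x. case (t, x) of (t, x) \<Rightarrow> g t * (wave x (circ t) * f x))"
      using fourier_integrable[OF f] by auto
  qed measurable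
  have "(LINT t|lborel. g t * fourier f (circ t)) = (LINT t|lborel. LINT x|lborel. g t * (wave x (circ t) * f x))"
    unfolding fourier_wave by simp
  also have "\<dots> = (LINT x|lborel. LINT t|lborel. g t * (wave x (circ t) * f x))"
    using lborel_pair.Fubini_integral[OF int] by simp
  also have "\<dots> = (LINT x|lborel. f x * extension g x)"
  proof (rule Bochner_Integration.integral_cong)
    fix x
    have "(LINT t|lborel. g t * (wave x (circ t) * f x)) = (LINT t|lborel. f x * (g t * wave x (circ t)))"
      by (simp only: mult_ac)
    then show "(LINT t|lborel. g t * (wave x (circ t) * f x)) = f x * extension g x"
      by (simp add: extension_def)
  qed simp
  finally show ?thesis .
qed

text \<open>The level set \<open>E\<close> is tested against itself: with \<open>g\<close> of
  modulus 1 on \<open>E\<close>, the product \<open>l * m\<close> is at most the pairing of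
  \<open>f\<close> with \<open>extension g\<close>. Hoelder and the restricted bound give
  \<open>l * m\<close> at most a multiple of \<open>m powr (1 - 3 / P)\<close>; cancelling leaves a
  bound for \<open>m powr (3 / P)\<close>.\<close>

theorem restriction_weak_type:
  assumes P: "P > 4"
  obtains C :: real where "C > 0"
    "\<And>a (f :: real \<times> real \<Rightarrow> complex) N l. integrable lborel f \<Longrightarrow>
      (\<integral>\<^sup>+x. ennreal (norm (f x) powr (P / (P - 1))) \<partial>lborel) \<le> ennreal N \<Longrightarrow> N \<ge> 0 \<Longrightarrow> l > 0 \<Longrightarrow>
      emeasure lborel {t \<in> {a..a+1/4}. l < norm (fourier f (circ t))} \<le> ennreal (C * N powr ((P - 1) / 3) * l powr (- (P / 3)))"
proof -
  obtain C where C: "C > 0" 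
    "\<And>a E g. g \<in> borel_measurable borel \<Longrightarrow> E \<in> sets borel \<Longrightarrow> E \<subseteq> {a..a+1/4} \<Longrightarrow> (\<And>t. norm (g t) \<le> indicator E t) \<Longrightarrow>
      (\<integral>\<^sup>+x. ennreal (norm (extension g x) powr P) \<partial>lborel) \<le> ennreal (C * measure lborel E powr (P - 3))"
    using restricted_extension_bound[OF P] by metis
  show ?thesis
  proof
    show "C powr (1 / 3) > 0" using C by simp
    fix a :: real and f :: "real \<times> real \<Rightarrow> complex" and N l :: real
    assume f: "integrable lborel f" and fN: "(\<integral>\<^sup>+x. ennreal (norm (f x) powr (P / (P - 1))) \<partial>lborel) \<le> ennreal N"
      and N: "N \<ge> 0" and l: "l > 0"
    have [measurable]: "f \<in> borel_measurable borel" using f by (auto dest: borel_measurable_integrable)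
    define F where "F t = fourier f (circ t)" for t
    have [measurable]: "F \<in> borel_measurable borel" unfolding F_def by measurable
    define E where "E = {t \<in> {a..a+1/4}. l < norm (F t)}"
    have E[measurable]: "E \<in> sets borel" unfolding E_def by measurable
    have EA: "E \<subseteq> {a..a+1/4}" by (auto simp: E_def)
    define m where "m = measure lborel E"
    have finE: "emeasure lborel E < \<infinity>"
      using emeasure_mono[OF EA, of lborel] by (auto intro: le_less_trans)
    have emE: "emeasure lborel E = ennreal m" using finE by (simp add: m_def emeasure_eq_ennreal_measure)
    \<comment> \<open>The conjugate phase turns the pairing with \<open>F\<close> into the integral
      of \<open>norm (F t)\<close> over \<open>E\<close>.\<close>
    define g where "g t = indicator E t * cnj (sgn (F t))" for t
    have [measurable]: "g \<in> borel_measurable borel" unfolding g_def sgn_div_norm by measurable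
    have gE: "norm (g t) \<le> indicator E t" for t
      by (auto simp: g_def norm_mult norm_sgn indicator_def)
    have gF: "g t * F t = of_real (indicator E t * norm (F t))" for t
    proof -
      have "cnj (sgn z) * z = of_real (norm z)" for z
      proof (cases "z = 0")
        case False
        then show ?thesis
          using complex_norm_square[of z] by (simp add: sgn_eq field_simps power2_eq_square)
      qed simp
      then show ?thesis by (simp add: g_def indicator_def)
    qed
    have g_int: "integrable lborel g"
      by (rule Bochner_Integration.integrable_bound[of _ "indicator E :: real \<Rightarrow> real"])
         (use finE gE in \<open>auto simp: integrable_indicator_iff\<close>)
    show "emeasure lborel {t \<in> {a..a+1/4}. l < norm (fourier f (circ t))} \<le> ennreal (C powr (1 / 3) * N powr ((P - 1) / 3) * l powr (- (P / 3)))"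
    proof (cases "m = 0")
      case True
      then show ?thesis using emE by (simp add: E_def F_def)
    next
      case False
      then have m: "m > 0" by (simp add: m_def less_le)
      have "integrable lborel (\<lambda>t. g t * F t)"
      proof (rule Bochner_Integration.integrable_bound[of _ "\<lambda>t. (LINT x|lborel. norm (f x)) * norm (g t)"])
        show "AE t in lborel. norm (g t * F t) \<le> norm ((LINT x|lborel. norm (f x)) * norm (g t))"
        proof (intro AE_I2)
          fix t
          have "norm (g t * F t) \<le> norm (g t) * (LINT x|lborel. norm (f x))"
            unfolding norm_mult F_def by (intro mult_left_mono norm_fourier_le) auto
          then show "norm (g t * F t) \<le> norm ((LINT x|lborel. norm (f x)) * norm (g t))"
            by (simp add: mult.commute)
        qed
      qed (use g_int in auto)
      then have int: "integrable lborel (\<lambda>t. indicator E t * norm (F t))"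
        unfolding gF by (subst (asm) complex_of_real_integrable_eq)
      have "ennreal (l * m) = (\<integral>\<^sup>+t. ennreal l * indicator E t \<partial>lborel)"
        using l m by (simp add: nn_integral_cmult_indicator emE ennreal_mult)
      also have "\<dots> \<le> (\<integral>\<^sup>+t. ennreal (indicator E t * norm (F t)) \<partial>lborel)"
        by (intro nn_integral_mono) (auto simp: indicator_def E_def intro: ennreal_leI)
      also have "\<dots> = ennreal (LINT t|lborel. indicator E t * norm (F t))"
        by (rule nn_integral_eq_integral[OF int]) auto
      also have "\<dots> = ennreal (norm (LINT t|lborel. g t * F t))"
        unfolding gF by (subst integral_complex_of_real) (simp add: integral_nonneg_AE)
      also have "\<dots> = ennreal (norm (LINT x|lborel. f x * extension g x))"
        unfolding F_def extension_duality[OF f g_int] ..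
      also have "\<dots> \<le> (\<integral>\<^sup>+x. ennreal (norm (f x) * norm (extension g x)) \<partial>lborel)"
        using norm_integral_le_nn_integral[of lborel "\<lambda>x. f x * extension g x"] by (simp add: norm_mult)
      also have "\<dots> \<le> ennreal (N powr (1 / (P / (P - 1))) * (C * m powr (P - 3)) powr (1 / P))"
      proof (rule nn_integral_holder[OF _ _ _ _ _ _ _ fN N])
        show "(\<integral>\<^sup>+x. ennreal (norm (extension g x) powr P) \<partial>lborel) \<le> ennreal (C * m powr (P - 3))"
          unfolding m_def by (rule C(2)[OF _ E EA gE]) measurable
      qed (use P C in \<open>auto simp: field_simps\<close>)
      finally have "l * m \<le> N powr (1 / (P / (P - 1))) * (C * m powr (P - 3)) powr (1 / P)"
        by (subst (asm) ennreal_le_iff) (use C in auto)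
      also have "(C * m powr (P - 3)) powr (1 / P) = C powr (1 / P) * (m powr (1 - 3 / P))"
        using C m P by (simp add: powr_mult powr_powr diff_divide_distrib)
      also have "m powr (1 - 3 / P) = m / m powr (3 / P)"
        using m by (simp add: powr_diff)
      finally have "l * m powr (3 / P) \<le> N powr ((P - 1) / P) * C powr (1 / P)"
        using m by (simp add: field_simps)
      then have "m powr (3 / P) \<le> N powr ((P - 1) / P) * C powr (1 / P) / l"
        using l by (simp add: field_simps)
      then have "(m powr (3 / P)) powr (P / 3) \<le> (N powr ((P - 1) / P) * C powr (1 / P) / l) powr (P / 3)"
        using P by (intro powr_mono2) auto
      also have "(m powr (3 / P)) powr (P / 3) = m"
        using P m by (simp add: powr_powr)
      also have "(N powr ((P - 1) / P) * C powr (1 / P) / l) powr (P / 3) = C powr (1 / 3) * N powr ((P - 1) / 3) * l powr (- (P / 3))"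
        using P C l N by (simp add: powr_divide powr_mult powr_powr powr_minus_divide)
      finally have "emeasure lborel E \<le> ennreal (C powr (1 / 3) * N powr ((P - 1) / 3) * l powr (- (P / 3)))"
        unfolding emE by (rule ennreal_leI)
      then show ?thesis by (simp add: E_def F_def)
    qed
  qed
qed

text \<open>Marcinkiewicz interpolation between the weak type at \<open>p0\<close> and the bound
  from \<open>L^1\<close> to \<open>L^\<infinity>\<close>. The height at which \<open>f\<close> is
  cut depends on the level \<open>l\<close>, so that the tall part contributes at most
  \<open>l / 2\<close> uniformly and only the low part is left to the weak-type bound.\<close>

lemma arc_restriction_normalized:
  fixes p :: real
  assumes p: "1 < p" "p < 4 / 3"
  obtains C :: real where "C > 0"
    "\<And>a (f :: real \<times> real \<Rightarrow> complex). integrable lborel f \<Longrightarrow>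
      (\<integral>\<^sup>+x. ennreal (norm (f x) powr p) \<partial>lborel) \<le> 1 \<Longrightarrow>
      (\<integral>\<^sup>+t. ennreal (norm (fourier f (circ t)) powr (p / (3 * (p - 1)))) * indicator {a..a+1/4} t \<partial>lborel) \<le> ennreal C"
proof -
  define q where "q = p / (3 * (p - 1))"
  \<comment> \<open>The midpoint of 4 and \<open>p' = p / (p - 1)\<close>; the dual exponent
    \<open>p0\<close> of a \<open>P\<close> below \<open>p'\<close> exceeds
    \<open>p\<close>.\<close>
  define P where "P = (4 + p / (p - 1)) / 2"
  define p0 where "p0 = P / (P - 1)"
  define r where "r = p - 1"
  define e where "e = (p0 - p) / r"
  have r: "r > 0" using p by (simp add: r_def)
  have h4: "4 < p / (p - 1)" using p by (simp add: field_simps)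
  have mid: "4 < (4 + x) / 2 \<and> (4 + x) / 2 < x" if "4 < x" for x :: real
    using that by simp
  have P: "4 < P" "P < p / (p - 1)"
    unfolding P_def using mid[OF h4] by blast+
  have "p * (P - 1) < P" using P(2) p by (simp add: field_simps)
  then have p0: "p < p0" using P(1) by (simp add: p0_def field_simps)
  have e: "e > 0" using p0 r by (simp add: e_def)
  have re: "r * e = p0 - p" using r by (simp add: e_def)
  have q: "q > 0" using p by (simp add: q_def)
  \<comment> \<open>Both interpolation endpoints lie on the line \<open>q = p' / 3\<close>; this is
    why the powers of \<open>l\<close> collected in \<open>level\<close> combine to
    \<open>e - 1\<close>, which is integrable at 0.\<close>
  have ident: "q - P / 3 - e * ((P - 4) / 3) = e"
  proof -
    have "e * (P - 1) = (P - p * (P - 1)) / r"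
      using P(1) r by (simp add: e_def p0_def field_simps)
    also have "\<dots> = p / r - P"
      using r by (simp add: r_def field_simps)
    also have "p / r = 3 * q"
      unfolding q_def r_def[symmetric] by simp
    finally have "e * (P - 1) = 3 * q - P" .
    then show ?thesis by (simp add: field_simps)
  qed
  obtain C0 where C0: "C0 > 0"
    "\<And>a (f :: real \<times> real \<Rightarrow> complex) N l. integrable lborel f \<Longrightarrow>
      (\<integral>\<^sup>+x. ennreal (norm (f x) powr p0) \<partial>lborel) \<le> ennreal N \<Longrightarrow> N \<ge> 0 \<Longrightarrow> l > 0 \<Longrightarrow>
      emeasure lborel {t \<in> {a..a+1/4}. l < norm (fourier f (circ t))} \<le> ennreal (C0 * N powr ((P - 1) / 3) * l powr (- (P / 3)))"
    by (rule restriction_weak_type[OF P(1), folded p0_def]) (rule that)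
  define K where "K = q * 2 powr (q - 1) * C0 * 2 powr (1 - e)"
  have K: "K > 0" using q C0 by (simp add: K_def)
  show ?thesis
  proof
    show "K * 2 powr e / e > 0" using K e by simp
    fix a :: real and f :: "real \<times> real \<Rightarrow> complex"
    assume f: "integrable lborel f" and fp: "(\<integral>\<^sup>+x. ennreal (norm (f x) powr p) \<partial>lborel) \<le> 1"
    have [measurable]: "f \<in> borel_measurable borel" using f by (auto dest: borel_measurable_integrable)
    define F where "F t = fourier f (circ t)" for t
    have [measurable]: "F \<in> borel_measurable borel" unfolding F_def by measurable
    \<comment> \<open>Solves \<open>\<gamma> l powr (1 - p) = l / 2\<close>. Where
      \<open>norm (f x) \<ge> \<gamma> l\<close>, the value \<open>norm (f x)\<close> is at most
      \<open>l / 2\<close> times its \<open>p\<close>-th power, so the tall part has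
      \<open>L^1\<close> norm at most \<open>l / 2\<close>.\<close>
    define \<gamma> where "\<gamma> l = (l / 2) powr (- (1 / r))" for l :: real
    have [measurable]: "\<gamma> \<in> borel_measurable borel" unfolding \<gamma>_def by measurable
    define N where "N l = (\<integral>\<^sup>+x. ennreal (norm (f x) powr p0) * indicator {x. norm (f x) < \<gamma> l} x \<partial>lborel)" for l
    have level: "ennreal (q * l powr (q - 1)) * emeasure lborel {t \<in> {a..a+1/4}. l < norm (F t)}
        \<le> ennreal (K * l powr (e - 1)) * N l" if l: "l > 0" for l
    proof -
      have g: "\<gamma> l > 0" using l by (simp add: \<gamma>_def)
      have g1: "\<gamma> l powr (1 - p) = l / 2"
      proof -
        have "1 - p = - r" by (simp add: r_def)
        then show ?thesis using l r by (simp add: \<gamma>_def powr_powr)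
      qed
      define S where "S = {x. norm (f x) < \<gamma> l}"
      have [measurable]: "S \<in> sets borel" unfolding S_def by measurable
      define f1 f2 where "f1 x = f x * indicator (- S) x" and "f2 x = f x * indicator S x" for x
      have [measurable]: "f1 \<in> borel_measurable borel" "f2 \<in> borel_measurable borel"
        unfolding f1_def f2_def by measurable
      have f12: "integrable lborel f1" "integrable lborel f2"
        by (rule Bochner_Integration.integrable_bound[OF f]; auto simp: f1_def f2_def norm_mult indicator_def)+
      have "f = (\<lambda>x. f1 x + f2 x)"
        by (auto simp: f1_def f2_def indicator_def fun_eq_iff)
      then have dec: "F t = fourier f1 (circ t) + fourier f2 (circ t)" for t
        unfolding F_def using fourier_add[OF f12] by simp
      have "ennreal (LINT x|lborel. norm (f1 x)) = (\<integral>\<^sup>+x. ennreal (norm (f1 x)) \<partial>lborel)"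
        using f12 by (intro nn_integral_eq_integral[symmetric]) auto
      also have "\<dots> \<le> (\<integral>\<^sup>+x. ennreal (l / 2) * ennreal (norm (f x) powr p) \<partial>lborel)"
      proof (rule nn_integral_mono)
        fix x
        have "norm (f x) \<le> l / 2 * norm (f x) powr p" if "x \<notin> S"
        proof -
          have y: "\<gamma> l \<le> norm (f x)" using that by (simp add: S_def)
          have "norm (f x) = norm (f x) powr (1 - p) * norm (f x) powr p"
            using y g powr_add[of "norm (f x)" "1 - p" p] by simp
          also have "\<dots> \<le> \<gamma> l powr (1 - p) * norm (f x) powr p"
            using y g p by (intro mult_right_mono powr_mono2') auto
          finally show ?thesis by (simp add: g1)
        qed
        then show "ennreal (norm (f1 x)) \<le> ennreal (l / 2) * ennreal (norm (f x) powr p)"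
          using l by (auto simp: f1_def indicator_def ennreal_mult'[symmetric] intro: ennreal_leI)
      qed
      also have "\<dots> = ennreal (l / 2) * (\<integral>\<^sup>+x. ennreal (norm (f x) powr p) \<partial>lborel)"
        by (rule nn_integral_cmult) measurable
      also have "\<dots> \<le> ennreal (l / 2) * 1"
        by (intro mult_left_mono fp) auto
      finally have "(LINT x|lborel. norm (f1 x)) \<le> l / 2"
        using l by (simp add: ennreal_le_iff)
      then have f1b: "norm (fourier f1 (circ t)) \<le> l / 2" for t
        using norm_fourier_le[of f1 "circ t"] by linarith
      have sub: "{t \<in> {a..a+1/4}. l < norm (F t)} \<subseteq> {t \<in> {a..a+1/4}. l / 2 < norm (fourier f2 (circ t))}"
      proof (rule subsetI)
        fix t assume t: "t \<in> {t \<in> {a..a+1/4}. l < norm (F t)}"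
        then have "l < norm (fourier f1 (circ t)) + norm (fourier f2 (circ t))"
          using norm_triangle_ineq[of "fourier f1 (circ t)" "fourier f2 (circ t)"] by (simp add: dec)
        then have "l / 2 < norm (fourier f2 (circ t))" using f1b[of t] by linarith
        then show "t \<in> {t \<in> {a..a+1/4}. l / 2 < norm (fourier f2 (circ t))}" using t by simp
      qed
      have Neq: "N l = (\<integral>\<^sup>+x. ennreal (norm (f2 x) powr p0) \<partial>lborel)"
        unfolding N_def S_def[symmetric] using p p0
        by (intro nn_integral_cong) (auto simp: f2_def indicator_def)
      have "N l \<le> (\<integral>\<^sup>+x. ennreal (\<gamma> l powr (p0 - p)) * ennreal (norm (f x) powr p) \<partial>lborel)"
        unfolding N_def S_def[symmetric]
      proof (rule nn_integral_mono)
        fix x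
        have "norm (f x) powr p0 \<le> \<gamma> l powr (p0 - p) * norm (f x) powr p" if "x \<in> S"
        proof -
          have "norm (f x) powr p0 = norm (f x) powr (p0 - p) * norm (f x) powr p"
            using powr_add[of "norm (f x)" "p0 - p" p] by simp
          also have "\<dots> \<le> \<gamma> l powr (p0 - p) * norm (f x) powr p"
            using that p0 by (intro mult_right_mono powr_mono2) (auto simp: S_def)
          finally show ?thesis .
        qed
        then show "ennreal (norm (f x) powr p0) * indicator S x \<le> ennreal (\<gamma> l powr (p0 - p)) * ennreal (norm (f x) powr p)"
          by (auto simp: indicator_def ennreal_mult'[symmetric] intro: ennreal_leI)
      qed
      also have "\<dots> = ennreal (\<gamma> l powr (p0 - p)) * (\<integral>\<^sup>+x. ennreal (norm (f x) powr p) \<partial>lborel)"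
        by (rule nn_integral_cmult) measurable
      also have "\<dots> \<le> ennreal (\<gamma> l powr (p0 - p)) * 1"
        by (intro mult_left_mono fp) auto
      finally have Nle: "N l \<le> ennreal (\<gamma> l powr (p0 - p))" by simp
      define n where "n = enn2real (N l)"
      have "N l < \<infinity>" using Nle by (auto intro: le_less_trans)
      then have n: "N l = ennreal n" "n \<ge> 0" by (auto simp: n_def)
      have nle: "n \<le> \<gamma> l powr (p0 - p)" using Nle unfolding n by (subst (asm) ennreal_le_iff) auto
      \<comment> \<open>The exponent \<open>(P - 1) / 3\<close> exceeds 1. Keeping one factor
        \<open>n\<close> and estimating the rest by \<open>nle\<close> leaves an expression linear
        in \<open>N l\<close>, to which Fubini in \<open>l\<close> and \<open>x\<close>
        applies.\<close>
      have npow: "n powr ((P - 1) / 3) \<le> n * (l / 2) powr (- (e * ((P - 4) / 3)))"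
      proof -
        have "n powr ((P - 1) / 3) = n powr 1 * n powr ((P - 4) / 3)"
          by (simp only: powr_add[symmetric]) (simp add: field_simps)
        also have "\<dots> \<le> n powr 1 * (\<gamma> l powr (p0 - p)) powr ((P - 4) / 3)"
          using n nle P by (intro mult_left_mono powr_mono2) auto
        also have "(\<gamma> l powr (p0 - p)) powr ((P - 4) / 3) = (l / 2) powr (- (e * ((P - 4) / 3)))"
          unfolding \<gamma>_def powr_powr by (simp add: e_def)
        finally show ?thesis using n by simp
      qed
      have "emeasure lborel {t \<in> {a..a+1/4}. l < norm (F t)} \<le> emeasure lborel {t \<in> {a..a+1/4}. l / 2 < norm (fourier f2 (circ t))}"
        by (rule emeasure_mono[OF sub]) measurable
      also have "\<dots> \<le> ennreal (C0 * n powr ((P - 1) / 3) * (l / 2) powr (- (P / 3)))"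
        using l n Neq by (intro C0(2) f12) auto
      finally have "ennreal (q * l powr (q - 1)) * emeasure lborel {t \<in> {a..a+1/4}. l < norm (F t)}
         \<le> ennreal (q * l powr (q - 1)) * ennreal (C0 * n powr ((P - 1) / 3) * (l / 2) powr (- (P / 3)))"
        by (intro mult_left_mono) auto
      also have "\<dots> = ennreal (q * l powr (q - 1) * (C0 * n powr ((P - 1) / 3) * (l / 2) powr (- (P / 3))))"
        using q by (intro ennreal_mult'[symmetric]) auto
      also have "\<dots> \<le> ennreal (q * l powr (q - 1) * (C0 * (n * (l / 2) powr (- (e * ((P - 4) / 3)))) * (l / 2) powr (- (P / 3))))"
        using q C0 npow by (intro ennreal_leI mult_left_mono mult_right_mono) auto
      also have "q * l powr (q - 1) * (C0 * (n * (l / 2) powr (- (e * ((P - 4) / 3)))) * (l / 2) powr (- (P / 3))) = K * l powr (e - 1) * n"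
      proof -
        have "(l / 2) powr (q - 1) * ((l / 2) powr (- (e * ((P - 4) / 3))) * (l / 2) powr (- (P / 3))) = (l / 2) powr (e - 1)"
        proof -
          have "q - 1 + (- (e * ((P - 4) / 3)) + - (P / 3)) = e - 1" using ident by simp
          then show ?thesis by (simp only: powr_add[symmetric])
        qed
        moreover have "l powr (q - 1) = 2 powr (q - 1) * (l / 2) powr (q - 1)" "(l / 2) powr (e - 1) = 2 powr (1 - e) * l powr (e - 1)"
          using l by (simp_all add: powr_divide powr_diff)
        ultimately show ?thesis by (simp add: K_def mult_ac)
      qed
      also have "ennreal (K * l powr (e - 1) * n) = ennreal (K * l powr (e - 1)) * N l"
        unfolding n using K n by (intro ennreal_mult) auto
      finally show ?thesis .
    qed
    have "(\<integral>\<^sup>+t. ennreal (norm (F t) powr q) * indicator {a..a+1/4} t \<partial>lborel)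
        = (\<integral>\<^sup>+t. ennreal ((norm (F t) * indicator {a..a+1/4} t) powr q) \<partial>lborel)"
      using q by (intro nn_integral_cong) (auto simp: indicator_def)
    also have "\<dots> = (\<integral>\<^sup>+l. ennreal (q * l powr (q - 1)) * indicator {0<..} l * emeasure lborel {t \<in> space lborel. l < norm (F t) * indicator {a..a+1/4} t} \<partial>lborel)"
      using q by (intro lborel.layer_cake) auto
    also have "\<dots> \<le> (\<integral>\<^sup>+l. ennreal (K * l powr (e - 1)) * indicator {0<..} l * N l \<partial>lborel)"
    proof (rule nn_integral_mono)
      fix l :: real
      have "{t \<in> space lborel. l < norm (F t) * indicator {a..a+1/4} t} = {t \<in> {a..a+1/4}. l < norm (F t)}" if "l > 0"
        using that by (auto simp: indicator_def split: if_splits)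
      then show "ennreal (q * l powr (q - 1)) * indicator {0<..} l * emeasure lborel {t \<in> space lborel. l < norm (F t) * indicator {a..a+1/4} t}
         \<le> ennreal (K * l powr (e - 1)) * indicator {0<..} l * N l"
        using level[of l] by (auto simp: indicator_def)
    qed
    also have "\<dots> = (\<integral>\<^sup>+l. \<integral>\<^sup>+x. ennreal (K * l powr (e - 1)) * indicator {0<..} l * (ennreal (norm (f x) powr p0) * indicator {x. norm (f x) < \<gamma> l} x) \<partial>lborel \<partial>lborel)"
      unfolding N_def by (simp add: nn_integral_cmult)
    also have "\<dots> \<le> (\<integral>\<^sup>+l. \<integral>\<^sup>+x. ennreal (norm (f x) powr p0) * (ennreal K * (ennreal (l powr (e - 1)) * indicator {z. 0 < fst z \<and> fst z < 2 * norm (f (snd z)) powr (- r)} (l, x))) \<partial>lborel \<partial>lborel)"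
    proof (intro nn_integral_mono)
      fix l :: real and x :: "real \<times> real"
      \<comment> \<open>The cut condition read as a condition on \<open>l\<close>: after Fubini the
        inner integral runs over \<open>0 < l < 2 * norm (f x) powr (- r)\<close> and lowers the
        exponent \<open>p0\<close> to \<open>p\<close>, because
        \<open>r * e = p0 - p\<close>.\<close>
      have "l < 2 * norm (f x) powr (- r)" if "0 < l" "norm (f x) < \<gamma> l" "f x \<noteq> 0"
      proof -
        have "\<gamma> l powr (- r) < norm (f x) powr (- r)"
          using that r by (intro powr_less_mono2_neg) auto
        moreover have "\<gamma> l powr (- r) = l / 2"
          using that r by (simp add: \<gamma>_def powr_powr)
        ultimately show ?thesis by simp
      qed
      then show "ennreal (K * l powr (e - 1)) * indicator {0<..} l * (ennreal (norm (f x) powr p0) * indicator {x. norm (f x) < \<gamma> l} x)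
         \<le> ennreal (norm (f x) powr p0) * (ennreal K * (ennreal (l powr (e - 1)) * indicator {z. 0 < fst z \<and> fst z < 2 * norm (f (snd z)) powr (- r)} (l, x)))"
        using K by (cases "f x = 0") (auto simp: indicator_def ennreal_mult' mult_ac)
    qed
    also have "\<dots> = (\<integral>\<^sup>+x. \<integral>\<^sup>+l. ennreal (norm (f x) powr p0) * (ennreal K * (ennreal (l powr (e - 1)) * indicator {z. 0 < fst z \<and> fst z < 2 * norm (f (snd z)) powr (- r)} (l, x))) \<partial>lborel \<partial>lborel)"
    proof (rule lborel_pair.Fubini'[symmetric])
      have [measurable]: "{z. 0 < fst z \<and> fst z < 2 * norm (f (snd z)) powr (- r)} \<in> sets (lborel \<Otimes>\<^sub>M lborel)"
      proof -
        have "{z \<in> space (lborel \<Otimes>\<^sub>M lborel). 0 < fst z \<and> fst z < 2 * norm (f (snd z)) powr (- r)} \<in> sets (lborel \<Otimes>\<^sub>M lborel)"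
          by measurable
        then show ?thesis by (simp add: space_pair_measure)
      qed
      show "(\<lambda>(l, x). ennreal (norm (f x) powr p0) * (ennreal K * (ennreal (l powr (e - 1)) * indicator {z. 0 < fst z \<and> fst z < 2 * norm (f (snd z)) powr (- r)} (l, x)))) \<in> borel_measurable (lborel \<Otimes>\<^sub>M lborel)"
        by measurable
    qed
    also have "\<dots> = (\<integral>\<^sup>+x. ennreal (K * 2 powr e / e) * ennreal (norm (f x) powr p) \<partial>lborel)"
    proof (rule nn_integral_cong)
      fix x
      have "(\<integral>\<^sup>+l. ennreal (norm (f x) powr p0) * (ennreal K * (ennreal (l powr (e - 1)) * indicator {z. 0 < fst z \<and> fst z < 2 * norm (f (snd z)) powr (- r)} (l, x))) \<partial>lborel)
        = (\<integral>\<^sup>+l. ennreal (norm (f x) powr p0) * (ennreal K * (ennreal (l powr (e - 1)) * indicator {0<..<2 * norm (f x) powr (- r)} l)) \<partial>lborel)"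
        by (intro nn_integral_cong) (auto simp: indicator_def)
      also have "\<dots> = ennreal (norm (f x) powr p0) * (ennreal K * ennreal ((2 * norm (f x) powr (- r)) powr e / e))"
        using e by (simp add: nn_integral_cmult nn_integral_powr)
      also have "\<dots> = ennreal (norm (f x) powr p0 * (K * ((2 * norm (f x) powr (- r)) powr e / e)))"
        using e K by (subst ennreal_mult'[symmetric], simp, subst ennreal_mult'[symmetric]) auto
      also have "norm (f x) powr p0 * (K * ((2 * norm (f x) powr (- r)) powr e / e)) = K * 2 powr e / e * norm (f x) powr p"
      proof -
        have "(2 * norm (f x) powr (- r)) powr e = 2 powr e * norm (f x) powr (- (p0 - p))"
          by (simp add: powr_mult powr_powr re)
        moreover have "norm (f x) powr p0 * norm (f x) powr (- (p0 - p)) = norm (f x) powr p"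
          by (simp only: powr_add[symmetric]) simp
        ultimately show ?thesis by (simp add: mult_ac)
      qed
      also have "ennreal (K * 2 powr e / e * norm (f x) powr p) = ennreal (K * 2 powr e / e) * ennreal (norm (f x) powr p)"
        using K e by (intro ennreal_mult) auto
      finally show "(\<integral>\<^sup>+l. ennreal (norm (f x) powr p0) * (ennreal K * (ennreal (l powr (e - 1)) * indicator {z. 0 < fst z \<and> fst z < 2 * norm (f (snd z)) powr (- r)} (l, x))) \<partial>lborel)
         = ennreal (K * 2 powr e / e) * ennreal (norm (f x) powr p)"
        .
    qed
    also have "\<dots> = ennreal (K * 2 powr e / e) * (\<integral>\<^sup>+x. ennreal (norm (f x) powr p) \<partial>lborel)"
      by (rule nn_integral_cmult) measurable
    also have "\<dots> \<le> ennreal (K * 2 powr e / e) * 1"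
      by (intro mult_left_mono fp) auto
    finally show "(\<integral>\<^sup>+t. ennreal (norm (fourier f (circ t)) powr (p / (3 * (p - 1)))) * indicator {a..a+1/4} t \<partial>lborel) \<le> ennreal (K * 2 powr e / e)"
      by (simp add: F_def q_def)
  qed
qed

text \<open>Homogeneity removes the normalisation, the power \<open>1 / (3 * (p - 1))\<close> being
  \<open>q / p\<close>, and four quarter arcs cover the circle.\<close>

theorem circle_restriction:
  fixes p :: real
  assumes p: "1 < p" "p < 4 / 3"
  obtains C :: real where "C > 0"
    "\<And>f :: real \<times> real \<Rightarrow> complex. integrable lborel f \<Longrightarrow> integrable lborel (\<lambda>x. norm (f x) powr p) \<Longrightarrow>
      (\<integral>\<^sup>+t. ennreal (norm (fourier f (circ t)) powr (p / (3 * (p - 1)))) * indicator {0..<1} t \<partial>lborel)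
        \<le> ennreal (C * (LINT x|lborel. norm (f x) powr p) powr (1 / (3 * (p - 1))))"
proof -
  define q where "q = p / (3 * (p - 1))"
  have q: "q > 0" using p by (simp add: q_def)
  obtain C where C: "C > 0"
    "\<And>a (f :: real \<times> real \<Rightarrow> complex). integrable lborel f \<Longrightarrow>
      (\<integral>\<^sup>+x. ennreal (norm (f x) powr p) \<partial>lborel) \<le> 1 \<Longrightarrow>
      (\<integral>\<^sup>+t. ennreal (norm (fourier f (circ t)) powr q) * indicator {a..a+1/4} t \<partial>lborel) \<le> ennreal C"
    by (rule arc_restriction_normalized[OF p, folded q_def]) (rule that)
  show ?thesis
  proof
    show "4 * C > 0" using C by simp
    fix f :: "real \<times> real \<Rightarrow> complex"
    assume f: "integrable lborel f" and fp: "integrable lborel (\<lambda>x. norm (f x) powr p)"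
    have [measurable]: "f \<in> borel_measurable borel" using f by (auto dest: borel_measurable_integrable)
    define I where "I = (LINT x|lborel. norm (f x) powr p)"
    have I0: "I \<ge> 0" by (simp add: I_def integral_nonneg_AE)
    have nnI: "(\<integral>\<^sup>+x. ennreal (norm (f x) powr p) \<partial>lborel) = ennreal I"
      unfolding I_def by (rule nn_integral_eq_integral[OF fp]) simp
    have "(\<integral>\<^sup>+t. ennreal (norm (fourier f (circ t)) powr q) * indicator {0..<1} t \<partial>lborel) \<le> ennreal (4 * C * I powr (q / p))"
    proof (cases "I = 0")
      case True
      then have "AE x in lborel. ennreal (norm (f x) powr p) = 0"
        using nnI by (subst nn_integral_0_iff_AE[symmetric]) auto
      then have "AE x in lborel. f x = 0" by eventually_elim auto
      then have "fourier f \<xi> = 0" for \<xi>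
        unfolding fourier_wave by (intro integral_eq_zero_AE) auto
      then show ?thesis using q by simp
    next
      case False
      then have I: "I > 0" using I0 by simp
      define c where "c = I powr (- (1 / p))"
      have c: "c > 0" "c powr p = 1 / I" "c powr q = 1 / I powr (q / p)"
      proof -
        show "c > 0" using I by (simp add: c_def)
        have "c powr p = I powr (- 1)" unfolding c_def powr_powr using p by simp
        then show "c powr p = 1 / I" using I by (simp add: powr_minus_divide)
        have "c powr q = I powr (- (q / p))" unfolding c_def powr_powr by simp
        then show "c powr q = 1 / I powr (q / p)" by (simp only: powr_minus_divide)
      qed
      define h where "h x = of_real c * f x" for x
      have h: "integrable lborel h" unfolding h_def using f by simp
      have hn: "norm (h x) powr p = norm (f x) powr p / I" for x
        using c by (simp add: h_def norm_mult powr_mult)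
      have hp: "(\<integral>\<^sup>+x. ennreal (norm (h x) powr p) \<partial>lborel) \<le> 1"
      proof -
        have "(\<integral>\<^sup>+x. ennreal (norm (h x) powr p) \<partial>lborel) = (\<integral>\<^sup>+x. ennreal (1 / I) * ennreal (norm (f x) powr p) \<partial>lborel)"
          using I by (intro nn_integral_cong) (simp add: hn ennreal_mult'[symmetric])
        also have "\<dots> = ennreal (1 / I) * ennreal I" by (simp add: nn_integral_cmult nnI)
        also have "\<dots> = 1" using I by (simp add: ennreal_mult'[symmetric])
        finally show ?thesis by simp
      qed
      have fh: "norm (fourier f \<xi>) powr q = I powr (q / p) * norm (fourier h \<xi>) powr q" for \<xi>
      proof -
        have "norm (fourier h \<xi>) = c * norm (fourier f \<xi>)"
          using c unfolding h_def fourier_cmult by (simp add: norm_mult)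
        then have "norm (fourier h \<xi>) powr q = 1 / I powr (q / p) * norm (fourier f \<xi>) powr q"
          using c by (simp add: powr_mult)
        then show ?thesis using I by simp
      qed
      have "(\<integral>\<^sup>+t. ennreal (norm (fourier f (circ t)) powr q) * indicator {0..<1} t \<partial>lborel)
        \<le> (\<integral>\<^sup>+t. ennreal (I powr (q / p)) * (\<Sum>k\<in>{0, 1/4, 1/2, 3/4}. ennreal (norm (fourier h (circ t)) powr q) * indicator {k..k+1/4} t) \<partial>lborel)"
      proof (rule nn_integral_mono)
        fix t :: real
        show "ennreal (norm (fourier f (circ t)) powr q) * indicator {0..<1} t
          \<le> ennreal (I powr (q / p)) * (\<Sum>k\<in>{0, 1/4, 1/2, 3/4}. ennreal (norm (fourier h (circ t)) powr q) * indicator {k..k+1/4} t)"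
        proof (cases "t \<in> {0..<1}")
          case True
          then obtain k where k: "k \<in> {0, 1/4, 1/2, 3/4}" "t \<in> {k..k+1/4}"
          proof -
            consider "t \<le> 1/4" | "1/4 \<le> t" "t \<le> 1/2" | "1/2 \<le> t" "t \<le> 3/4" | "3/4 \<le> t" by linarith
            then show ?thesis using True that[of 0] that[of "1/4"] that[of "1/2"] that[of "3/4"] by cases auto
          qed
          have "ennreal (norm (fourier h (circ t)) powr q) = ennreal (norm (fourier h (circ t)) powr q) * indicator {k..k+1/4} t"
            using k by simp
          also have "\<dots> \<le> (\<Sum>k\<in>{0, 1/4, 1/2, 3/4}. ennreal (norm (fourier h (circ t)) powr q) * indicator {k..k+1/4} t)"
            using k(1) by (intro member_le_sum) auto
          finally show ?thesis
            using True by (simp add: fh ennreal_mult mult_left_mono del: sum.insert)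
        qed simp
      qed
      also have "\<dots> = ennreal (I powr (q / p)) * (\<Sum>k\<in>{0, 1/4, 1/2, 3/4}. \<integral>\<^sup>+t. ennreal (norm (fourier h (circ t)) powr q) * indicator {k..k+1/4} t \<partial>lborel)"
        using h by (subst nn_integral_cmult, measurable, subst nn_integral_sum) (auto dest: borel_measurable_integrable simp del: sum.insert)
      also have "\<dots> \<le> ennreal (I powr (q / p)) * (\<Sum>k\<in>{0, 1/4, 1/2, 3/4::real}. ennreal C)"
        by (intro mult_left_mono sum_mono C(2) h hp) auto
      also have "(\<Sum>k\<in>{0, 1/4, 1/2, 3/4::real}. ennreal C) = ennreal (4 * C)"
        using C by (simp add: ennreal_mult)
      also have "ennreal (I powr (q / p)) * ennreal (4 * C) = ennreal (4 * C * I powr (q / p))"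
        using C by (subst ennreal_mult[symmetric]) (auto simp: mult_ac)
      finally show ?thesis .
    qed
    moreover have "q / p = 1 / (3 * (p - 1))" using p by (simp add: q_def)
    ultimately show "(\<integral>\<^sup>+t. ennreal (norm (fourier f (circ t)) powr (p / (3 * (p - 1)))) * indicator {0..<1} t \<partial>lborel)
        \<le> ennreal (4 * C * (LINT x|lborel. norm (f x) powr p) powr (1 / (3 * (p - 1))))"
      by (simp add: q_def I_def)
  qed
qed

subsection \<open>Restriction to the torus\<close>

text \<open>A weighted form of Minkowski's integral inequality: by Hoelder's inequality with respect to the
  density \<open>b\<close>, it suffices to dominate each slice in \<open>L\<^sup>s\<close> by \<open>b\<close>.\<close>

lemma minkowski_slices:
  fixes H :: "'a \<Rightarrow> 'b \<Rightarrow> real" and b :: "'a \<Rightarrow> real"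
  assumes M: "sigma_finite_measure M" and N: "sigma_finite_measure N"
    and H[measurable]: "(\<lambda>(x, t). H x t) \<in> borel_measurable (M \<Otimes>\<^sub>M N)" and H0: "\<And>x t. H x t \<ge> 0"
    and b: "integrable M b" and b0: "\<And>x. b x \<ge> 0"
    and s: "s > 1" and C: "C \<ge> 0"
    and slice: "\<And>x. x \<in> space M \<Longrightarrow> (\<integral>\<^sup>+t. ennreal (H x t powr s) \<partial>N) \<le> ennreal (C * b x powr s)"
    and zero: "\<And>x t. b x = 0 \<Longrightarrow> H x t = 0"
    and int: "\<And>t. t \<in> space N \<Longrightarrow> integrable M (\<lambda>x. H x t)"
  shows "(\<integral>\<^sup>+t. ennreal ((LINT x|M. H x t) powr s) \<partial>N) \<le> ennreal (C * (LINT x|M. b x) powr s)"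
proof -
  interpret M: sigma_finite_measure M by (rule M)
  interpret N: sigma_finite_measure N by (rule N)
  interpret MN: pair_sigma_finite M N ..
  have [measurable]: "b \<in> borel_measurable M" using b by auto
  define B where "B = (LINT x|M. b x)"
  have B0: "B \<ge> 0" unfolding B_def by (simp add: b0)
  have bB: "(\<integral>\<^sup>+x. ennreal (b x) \<partial>M) = ennreal B"
    unfolding B_def by (rule nn_integral_eq_integral[OF b]) (simp add: b0)
  have conj: "1 / s + 1 / (s / (s - 1)) = 1" "s / (s - 1) > 1"
    using s by (auto simp: field_simps)
  have ptw: "ennreal ((LINT x|M. H x t) powr s) \<le> ennreal (B powr (s - 1)) * (\<integral>\<^sup>+x. ennreal (H x t powr s * b x powr (1 - s)) \<partial>M)"
    if t: "t \<in> space N" for t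
  proof (cases "(\<integral>\<^sup>+x. ennreal (H x t powr s * b x powr (1 - s)) \<partial>M) = \<infinity>")
    case True
    \<comment> \<open>When the integral on the right is infinite, the bound could fail only through
      a vanishing factor \<open>B powr (s - 1)\<close>; in that case the left side vanishes
      too.\<close>
    have "(LINT x|M. H x t) = 0" if "B = 0"
    proof -
      have "AE x in M. ennreal (b x) = 0"
        using bB that by (subst nn_integral_0_iff_AE[symmetric]) auto
      then have "AE x in M. H x t = 0"
        by eventually_elim (use b0 zero in \<open>auto simp: ennreal_eq_0_iff order_antisym\<close>)
      then show ?thesis by (intro integral_eq_zero_AE)
    qed
    then show ?thesis
      using True B0 s by (cases "B = 0") (auto simp: ennreal_mult_top)
  next
    case False
    define U where "U = enn2real (\<integral>\<^sup>+x. ennreal (H x t powr s * b x powr (1 - s)) \<partial>M)"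
    have U: "(\<integral>\<^sup>+x. ennreal (H x t powr s * b x powr (1 - s)) \<partial>M) = ennreal U" "U \<ge> 0"
      using False by (auto simp: U_def ennreal_enn2real_if)
    have [measurable]: "(\<lambda>x. H x t) \<in> borel_measurable M"
      using int[OF t] by auto
    \<comment> \<open>Hoelder with exponents \<open>s\<close> and \<open>s / (s - 1)\<close>:
      \<open>v\<close> is the power of \<open>b\<close> whose \<open>s / (s - 1)\<close>-th power is
      \<open>b\<close>, and \<open>u\<close> carries the inverse power. Where \<open>b\<close>
      vanishes, \<open>zero\<close> keeps \<open>u x * v x = H x t\<close> true.\<close>
    define u where "u x = H x t * b x powr (- ((s - 1) / s))" for x
    define v where "v x = b x powr ((s - 1) / s)" for x
    have [measurable]: "u \<in> borel_measurable M" "v \<in> borel_measurable M"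
      unfolding u_def v_def by measurable
    have uv: "u x * v x = H x t" for x
      using zero[of x t] b0[of x] by (cases "b x = 0") (auto simp: u_def v_def powr_minus)
    have up: "u x powr s = H x t powr s * b x powr (1 - s)" for x
      using s H0 b0 by (simp add: u_def powr_mult powr_powr)
    have vp: "v x powr (s / (s - 1)) = b x" for x
      using s b0 by (simp add: v_def powr_powr)
    have "ennreal (LINT x|M. H x t) = (\<integral>\<^sup>+x. ennreal (u x * v x) \<partial>M)"
      unfolding uv using int[OF t] H0 by (intro nn_integral_eq_integral[symmetric]) auto
    also have "\<dots> \<le> ennreal (U powr (1 / s) * B powr (1 / (s / (s - 1))))"
      by (rule nn_integral_holder[where p=s and q="s / (s - 1)"])
         (use s conj U B0 H0 b0 in \<open>auto simp: u_def[symmetric] v_def[symmetric] up vp bB\<close>, auto simp: u_def v_def H0)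
    finally have "(LINT x|M. H x t) \<le> U powr (1 / s) * B powr ((s - 1) / s)"
      by (subst (asm) ennreal_le_iff) auto
    then have "(LINT x|M. H x t) powr s \<le> (U powr (1 / s) * B powr ((s - 1) / s)) powr s"
      using s by (intro powr_mono2) (auto simp: H0)
    also have "\<dots> = B powr (s - 1) * U"
      using s U by (simp add: powr_mult powr_powr)
    finally show ?thesis
      unfolding U(1) using U(2) by (simp add: ennreal_mult'[symmetric] ennreal_leI)
  qed
  have "(\<integral>\<^sup>+t. ennreal ((LINT x|M. H x t) powr s) \<partial>N)
     \<le> (\<integral>\<^sup>+t. ennreal (B powr (s - 1)) * (\<integral>\<^sup>+x. ennreal (H x t powr s * b x powr (1 - s)) \<partial>M) \<partial>N)"
    by (intro nn_integral_mono ptw)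
  also have "\<dots> = ennreal (B powr (s - 1)) * (\<integral>\<^sup>+t. \<integral>\<^sup>+x. ennreal (H x t powr s * b x powr (1 - s)) \<partial>M \<partial>N)"
  proof (rule nn_integral_cmult)
    have "(\<lambda>(t, x). ennreal (H x t powr s * b x powr (1 - s))) \<in> borel_measurable (N \<Otimes>\<^sub>M M)"
      by measurable
    then show "(\<lambda>t. \<integral>\<^sup>+x. ennreal (H x t powr s * b x powr (1 - s)) \<partial>M) \<in> borel_measurable N"
      by (rule M.borel_measurable_nn_integral)
  qed
  also have "(\<integral>\<^sup>+t. \<integral>\<^sup>+x. ennreal (H x t powr s * b x powr (1 - s)) \<partial>M \<partial>N)
      = (\<integral>\<^sup>+x. \<integral>\<^sup>+t. ennreal (H x t powr s * b x powr (1 - s)) \<partial>N \<partial>M)"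
    by (rule MN.Fubini') measurable
  also have "\<dots> \<le> (\<integral>\<^sup>+x. ennreal C * ennreal (b x) \<partial>M)"
  proof (rule nn_integral_mono)
    fix x assume x: "x \<in> space M"
    have [measurable]: "(\<lambda>t. H x t) \<in> borel_measurable N"
      using measurable_Pair2[OF H x] by simp
    have "(\<integral>\<^sup>+t. ennreal (H x t powr s * b x powr (1 - s)) \<partial>N)
        = (\<integral>\<^sup>+t. ennreal (b x powr (1 - s)) * ennreal (H x t powr s) \<partial>N)"
      by (intro nn_integral_cong) (simp add: ennreal_mult'[symmetric] mult.commute)
    also have "\<dots> = ennreal (b x powr (1 - s)) * (\<integral>\<^sup>+t. ennreal (H x t powr s) \<partial>N)"
      by (rule nn_integral_cmult) measurable
    also have "\<dots> \<le> ennreal (b x powr (1 - s)) * ennreal (C * b x powr s)"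
      by (intro mult_left_mono slice x) auto
    also have "\<dots> = ennreal (b x powr (1 - s) * (C * b x powr s))"
      by (simp add: ennreal_mult')
    also have "b x powr (1 - s) * (C * b x powr s) = C * b x"
      using powr_add[of "b x" "1 - s" s] b0[of x] by (simp add: mult_ac)
    finally show "(\<integral>\<^sup>+t. ennreal (H x t powr s * b x powr (1 - s)) \<partial>N) \<le> ennreal C * ennreal (b x)"
      using C b0[of x] by (simp add: ennreal_mult)
  qed
  also have "\<dots> = ennreal C * ennreal B"
    by (simp add: nn_integral_cmult bB)
  finally have "(\<integral>\<^sup>+t. ennreal ((LINT x|M. H x t) powr s) \<partial>N) \<le> ennreal (B powr (s - 1)) * (ennreal C * ennreal B)"
    by (simp add: mult_left_mono)
  also have "\<dots> = ennreal (C * (B powr (s - 1) * B))"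
    using C B0 by (simp add: ennreal_mult mult_ac)
  also have "B powr (s - 1) * B = B powr s"
    using powr_add[of B "s - 1" 1] B0 by simp
  finally show ?thesis by (simp add: B_def)
qed

text \<open>One product majorant yields integrability of \<open>g\<close>, of its slices and of its
  partial transforms, uniformly in the free variable. Test functions satisfy it, in pair
  coordinates, for suitable \<open>B\<close> and \<open>R\<close>.\<close>

definition disc_supported :: "real \<Rightarrow> real \<Rightarrow> ((real \<times> real) \<times> (real \<times> real) \<Rightarrow> complex) \<Rightarrow> bool" where
  "disc_supported B R g \<longleftrightarrow> g \<in> borel_measurable borel \<and> B \<ge> 0 \<and>
     (\<forall>x y. norm (g (x, y)) \<le> B * indicator (cball 0 R) x * indicator (cball 0 R) y)"

lemma disc_indicator_integrable: "integrable lborel (indicator (cball (0 :: 'a::euclidean_space) R) :: 'a \<Rightarrow> real)"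
  using emeasure_bounded_finite[OF bounded_cball[of "0::'a" R]] by (simp add: integrable_indicator_iff)

text \<open>For fixed \<open>t\<close> the torus transform is the circle transform in
  \<open>x\<close> of the partial transform \<open>Pt x t\<close>, so the circle estimate bounds the
  integral over the first angle by the \<open>L^p\<close> norm of \<open>Pt\<close> in
  \<open>x\<close>. \<open>minkowski_slices\<close> exchanges this norm with the integral over
  \<open>t\<close>, and the circle estimate is used once more, in \<open>y\<close>, on each slice of
  \<open>g\<close>.\<close>

theorem torus_restriction:
  fixes p :: real
  assumes p: "1 < p" "p < 4 / 3"
  obtains C :: real where "C > 0"
    "\<And>g B R. disc_supported B R g \<Longrightarrow>
      (\<integral>\<^sup>+t. \<integral>\<^sup>+s. ennreal (norm (fourier g (circ s, circ t)) powr (p / (3 * (p - 1)))) * indicator {0..<1} s \<partial>lborel * indicator {0..<1} t \<partial>lborel)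
        \<le> ennreal (C * (LINT z|lborel. norm (g z) powr p) powr (1 / (3 * (p - 1))))"
proof -
  define q where "q = p / (3 * (p - 1))"
  \<comment> \<open>The ratio \<open>q / p\<close>, greater than 1 because \<open>p < 4 / 3\<close>;
    it is the exponent for Minkowski.\<close>
  define s where "s = 1 / (3 * (p - 1))"
  have s: "s > 1" using p by (simp add: s_def field_simps)
  have qs: "q = p * s" by (simp add: q_def s_def)
  obtain C where C: "C > 0"
    "\<And>f :: real \<times> real \<Rightarrow> complex. integrable lborel f \<Longrightarrow> integrable lborel (\<lambda>x. norm (f x) powr p) \<Longrightarrow>
      (\<integral>\<^sup>+t. ennreal (norm (fourier f (circ t)) powr q) * indicator {0..<1} t \<partial>lborel)
        \<le> ennreal (C * (LINT x|lborel. norm (f x) powr p) powr s)"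
    by (rule circle_restriction[OF p, folded q_def s_def]) (rule that)
  show ?thesis
  proof
    show "C * C > 0" using C by simp
    fix g :: "(real \<times> real) \<times> (real \<times> real) \<Rightarrow> complex" and B R :: real
    assume g: "disc_supported B R g"
    then have gm[measurable]: "g \<in> borel_measurable borel" and B: "B \<ge> 0"
      and gb: "\<And>x y. norm (g (x, y)) \<le> B * indicator (cball 0 R) x * indicator (cball 0 R) y"
      by (auto simp: disc_supported_def)
    define K where "K = cball (0 :: real \<times> real) R"
    have [measurable]: "K \<in> sets borel" by (simp add: K_def)
    have Kint: "integrable lborel (indicator K :: real \<times> real \<Rightarrow> real)"
      unfolding K_def by (rule disc_indicator_integrable)
    have gm2[measurable]: "(\<lambda>(x, y). g (x, y)) \<in> borel_measurable (borel \<Otimes>\<^sub>M borel)"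
      using gm by (simp add: borel_prod)
    have gp: "norm (g (x, y)) powr p \<le> B powr p * indicator K x * indicator K y" for x y
    proof -
      have "norm (g (x, y)) powr p \<le> (B * indicator K x * indicator K y) powr p"
        using gb[of x y] p unfolding K_def by (intro powr_mono2) auto
      then show ?thesis by (cases "x \<in> K"; cases "y \<in> K") simp_all
    qed
    have g0: "g (x, y) = 0" if "x \<notin> K \<or> y \<notin> K" for x y
      using gb[of x y] that unfolding K_def[symmetric] by auto
    have gB: "norm (g (x, y)) \<le> B" for x y
      using gb[of x y] B unfolding K_def[symmetric] by (cases "x \<in> K"; cases "y \<in> K") simp_all
    define \<kappa> where "\<kappa> = (LINT y|lborel. B * indicator K y)"
    define Pt where "Pt x t = fourier (\<lambda>y. g (x, y)) (circ t)" for x t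
    have Pm[measurable]: "(\<lambda>(x, t). Pt x t) \<in> borel_measurable (borel \<Otimes>\<^sub>M borel)"
      unfolding Pt_def fourier_wave by measurable
    have slice_int: "integrable lborel (\<lambda>y. g (x, y))" for x
    proof (rule Bochner_Integration.integrable_bound)
      show "integrable lborel (\<lambda>y. B * indicator K y)" using Kint by simp
      show "AE y in lborel. norm (g (x, y)) \<le> norm (B * indicator K y)"
      proof (intro AE_I2)
        fix y show "norm (g (x, y)) \<le> norm (B * indicator K y)"
          using gB[of x y] g0[of x y] B by (cases "y \<in> K") simp_all
      qed
    qed measurable
    have slice_p: "integrable lborel (\<lambda>y. norm (g (x, y)) powr p)" for x
    proof (rule Bochner_Integration.integrable_bound)
      show "integrable lborel (\<lambda>y. B powr p * indicator K y)" using Kint by simp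
      show "AE y in lborel. norm (norm (g (x, y)) powr p) \<le> norm (B powr p * indicator K y)"
      proof (intro AE_I2)
        fix y show "norm (norm (g (x, y)) powr p) \<le> norm (B powr p * indicator K y)"
          using gB[of x y] g0[of x y] p by (cases "y \<in> K") (simp_all add: powr_mono2)
      qed
    qed measurable
    have Pb: "norm (Pt x t) \<le> \<kappa> * indicator K x" for x t
    proof (cases "x \<in> K")
      case True
      have "norm (Pt x t) \<le> (LINT y|lborel. norm (g (x, y)))"
        unfolding Pt_def by (rule norm_fourier_le)
      also have "\<dots> \<le> \<kappa>"
        unfolding \<kappa>_def
      proof (rule integral_mono)
        show "integrable lborel (\<lambda>y. norm (g (x, y)))" using slice_int by simp
        show "integrable lborel (\<lambda>y. B * indicator K y)" using Kint by simp
        fix y show "norm (g (x, y)) \<le> B * indicator K y"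
          using gB[of x y] g0[of x y] by (cases "y \<in> K") simp_all
      qed
      finally show ?thesis using True by simp
    next
      case False
      then have "g (x, y) = 0" for y using g0 by simp
      then show ?thesis using False by (simp add: Pt_def fourier_wave)
    qed
    have P_int: "integrable lborel (\<lambda>x. Pt x t)" for t
    proof (rule Bochner_Integration.integrable_bound)
      show "integrable lborel (\<lambda>x. \<kappa> * indicator K x)" using Kint by simp
      show "AE x in lborel. norm (Pt x t) \<le> norm (\<kappa> * indicator K x)"
      proof (intro AE_I2)
        fix x show "norm (Pt x t) \<le> norm (\<kappa> * indicator K x)"
          using Pb[of x t] by (metis abs_ge_self order_trans real_norm_def)
      qed
    qed measurable
    have P_p: "integrable lborel (\<lambda>x. norm (Pt x t) powr p)" for t
    proof (rule Bochner_Integration.integrable_bound[of _ "\<lambda>x. \<kappa> powr p * indicator K x"])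
      show "AE x in lborel. norm (norm (Pt x t) powr p) \<le> norm (\<kappa> powr p * indicator K x)"
      proof (intro AE_I2)
        fix x
        have "norm (Pt x t) powr p \<le> (\<kappa> * indicator K x) powr p"
          using Pb[of x t] p by (intro powr_mono2) auto
        then show "norm (norm (Pt x t) powr p) \<le> norm (\<kappa> powr p * indicator K x)"
          by (cases "x \<in> K") simp_all
      qed
    qed (use Kint in auto)
    have ft: "fourier g (\<xi>, circ t) = fourier (\<lambda>x. Pt x t) \<xi>" for \<xi> t
    proof -
      have int: "integrable (lborel \<Otimes>\<^sub>M lborel) (\<lambda>(x, y). wave x \<xi> * (wave y (circ t) * g (x, y)))"
      proof (rule Bochner_Integration.integrable_bound)
        show "integrable (lborel \<Otimes>\<^sub>M lborel) (\<lambda>z. (B * indicator K (fst z)) * indicator K (snd z))"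
          unfolding lborel_prod using Kint by (intro lborel_prod_integrable_mult) auto
        show "AE z in lborel \<Otimes>\<^sub>M lborel. norm (case z of (x, y) \<Rightarrow> wave x \<xi> * (wave y (circ t) * g (x, y)))
           \<le> norm ((B * indicator K (fst z)) * indicator K (snd z))"
        proof (intro AE_I2)
          fix z :: "(real \<times> real) \<times> (real \<times> real)"
          obtain x y where z: "z = (x, y)" by (cases z)
          show "norm (case z of (x, y) \<Rightarrow> wave x \<xi> * (wave y (circ t) * g (x, y)))
             \<le> norm ((B * indicator K (fst z)) * indicator K (snd z))"
            unfolding z using gB[of x y] g0[of x y] B by (cases "x \<in> K"; cases "y \<in> K") (simp_all add: norm_mult)
        qed
      qed measurable
      have "fourier g (\<xi>, circ t) = (LINT z|(lborel \<Otimes>\<^sub>M lborel). (case z of (x, y) \<Rightarrow> wave x \<xi> * (wave y (circ t) * g (x, y))))"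
        unfolding fourier_wave lborel_prod
        unfolding wave_prod[of _ "(\<xi>, circ t)"] by (simp only: case_prod_beta fst_conv snd_conv mult.assoc prod.collapse)
      also have "\<dots> = (LINT x|lborel. LINT y|lborel. wave x \<xi> * (wave y (circ t) * g (x, y)))"
        using lborel_pair.integral_fst'[OF int] by simp
      also have "\<dots> = fourier (\<lambda>x. Pt x t) \<xi>"
        unfolding fourier_wave Pt_def by simp
      finally show ?thesis .
    qed
    \<comment> \<open>The \<open>p\<close>-th power of the \<open>L^p\<close> norm of a slice. In
      these terms the circle estimate in \<open>y\<close> is exactly the hypothesis
      \<open>slice\<close> of \<open>minkowski_slices\<close>.\<close>
    define b where "b x = (LINT y|lborel. norm (g (x, y)) powr p)" for x
    have gp_int: "integrable (lborel \<Otimes>\<^sub>M lborel) (\<lambda>(x, y). norm (g (x, y)) powr p)"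
    proof (rule Bochner_Integration.integrable_bound)
      show "integrable (lborel \<Otimes>\<^sub>M lborel) (\<lambda>z. (B powr p * indicator K (fst z)) * indicator K (snd z))"
        unfolding lborel_prod using Kint by (intro lborel_prod_integrable_mult) auto
      show "AE z in lborel \<Otimes>\<^sub>M lborel. norm (case z of (x, y) \<Rightarrow> norm (g (x, y)) powr p) \<le> norm ((B powr p * indicator K (fst z)) * indicator K (snd z))"
      proof (intro AE_I2)
        fix z :: "(real \<times> real) \<times> (real \<times> real)"
        obtain x y where z: "z = (x, y)" by (cases z)
        show "norm (case z of (x, y) \<Rightarrow> norm (g (x, y)) powr p) \<le> norm ((B powr p * indicator K (fst z)) * indicator K (snd z))"
          unfolding z using gp[of x y] by simp
      qed
    qed measurable
    have b: "integrable lborel b" "(LINT x|lborel. b x) = (LINT z|lborel. norm (g z) powr p)"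
      unfolding b_def using lborel_pair.integrable_fst'[OF gp_int] lborel_pair.integral_fst'[OF gp_int]
      by (simp_all add: lborel_prod case_prod_beta')
    define N where "N = restrict_space (lborel :: real measure) {0..<1}"
    have N: "sigma_finite_measure N"
      unfolding N_def by (rule sigma_finite_measure_restrict_space) (auto intro: sigma_finite_lborel)
    have nnN: "(\<integral>\<^sup>+t. h t \<partial>N) = (\<integral>\<^sup>+t. h t * indicator {0..<1} t \<partial>lborel)" for h
      unfolding N_def by (rule nn_integral_restrict_space) auto
    have mink: "(\<integral>\<^sup>+t. ennreal ((LINT x|lborel. norm (Pt x t) powr p) powr s) \<partial>N) \<le> ennreal (C * (LINT x|lborel. b x) powr s)"
    proof (rule minkowski_slices[OF sigma_finite_lborel N])
      show "(\<lambda>(x, t). norm (Pt x t) powr p) \<in> borel_measurable (lborel \<Otimes>\<^sub>M N)"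
      proof -
        have idN: "(\<lambda>t. t) \<in> borel_measurable N"
          unfolding N_def by (intro measurable_restrict_space1) simp
        have "(\<lambda>z. (fst z, snd z)) \<in> measurable (lborel \<Otimes>\<^sub>M N) (borel \<Otimes>\<^sub>M borel)"
          by (intro measurable_Pair measurable_compose[OF measurable_snd idN] measurable_compose[OF measurable_fst, of "\<lambda>x. x"]) simp
        from measurable_compose[OF this Pm] have [measurable]: "(\<lambda>z. Pt (fst z) (snd z)) \<in> borel_measurable (lborel \<Otimes>\<^sub>M N)"
          by simp
        show ?thesis unfolding case_prod_beta' by measurable
      qed
      show "integrable lborel b" by fact
      show "b x \<ge> 0" for x by (simp add: b_def)
      show "(\<integral>\<^sup>+t. ennreal ((norm (Pt x t) powr p) powr s) \<partial>N) \<le> ennreal (C * b x powr s)" for x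
        unfolding nnN powr_powr qs[symmetric] b_def Pt_def by (rule C(2)[OF slice_int slice_p])
      show "norm (Pt x t) powr p = 0" if "b x = 0" for x t
      proof -
        have "AE y in lborel. norm (g (x, y)) powr p = 0"
          using that integral_nonneg_eq_0_iff_AE[OF slice_p[of x]] by (simp add: b_def)
        then have "Pt x t = 0"
          unfolding Pt_def fourier_wave by (intro integral_eq_zero_AE) (auto elim!: eventually_mono)
        then show ?thesis by simp
      qed
    qed (use s C P_p in auto)
    have "(\<integral>\<^sup>+t. \<integral>\<^sup>+s. ennreal (norm (fourier g (circ s, circ t)) powr q) * indicator {0..<1} s \<partial>lborel * indicator {0..<1} t \<partial>lborel)
       = (\<integral>\<^sup>+t. \<integral>\<^sup>+s. ennreal (norm (fourier g (circ s, circ t)) powr q) * indicator {0..<1} s \<partial>lborel \<partial>N)"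
      unfolding nnN ..
    also have "\<dots> \<le> (\<integral>\<^sup>+t. ennreal C * ennreal ((LINT x|lborel. norm (Pt x t) powr p) powr s) \<partial>N)"
      unfolding ft using C P_int P_p by (intro nn_integral_mono) (simp add: ennreal_mult[symmetric])
    also have "\<dots> = ennreal C * (\<integral>\<^sup>+t. ennreal ((LINT x|lborel. norm (Pt x t) powr p) powr s) \<partial>N)"
      by (rule nn_integral_cmult) (auto simp: N_def intro!: measurable_restrict_space1)
    also have "\<dots> \<le> ennreal C * ennreal (C * (LINT x|lborel. b x) powr s)"
      by (intro mult_left_mono mink) auto
    also have "\<dots> = ennreal (C * C * (LINT z|lborel. norm (g z) powr p) powr s)"
      using C by (simp add: ennreal_mult b(2) mult_ac)
    finally show "(\<integral>\<^sup>+t. \<integral>\<^sup>+s. ennreal (norm (fourier g (circ s, circ t)) powr (p / (3 * (p - 1)))) * indicator {0..<1} s \<partial>lborel * indicator {0..<1} t \<partial>lborel)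
        \<le> ennreal (C * C * (LINT z|lborel. norm (g z) powr p) powr (1 / (3 * (p - 1))))"
      by (simp add: q_def s_def)
  qed
qed

section \<open>Transfer between \<open>real^4\<close> and pairs of plane vectors\<close>

definition pair_to_vec4 :: "(real \<times> real) \<times> (real \<times> real) \<Rightarrow> real^4" where
  "pair_to_vec4 z = vector [fst (fst z), snd (fst z), fst (snd z), snd (snd z)]"

definition vec4_to_pair :: "real^4 \<Rightarrow> (real \<times> real) \<times> (real \<times> real)" where
  "vec4_to_pair x = ((x $ 1, x $ 2), (x $ 3, x $ 4))"

lemma pair_to_vec4_inverse [simp]: "vec4_to_pair (pair_to_vec4 z) = z"
  by (simp add: vec4_to_pair_def pair_to_vec4_def)

lemma vec4_to_pair_inverse [simp]: "pair_to_vec4 (vec4_to_pair x) = x"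
  by (simp add: vec4_to_pair_def pair_to_vec4_def vec_eq_iff forall_4)

lemma bounded_linear_pair_to_vec4: "bounded_linear pair_to_vec4"
  unfolding linear_conv_bounded_linear[symmetric] 
  by (rule linearI) (simp_all add: pair_to_vec4_def vec_eq_iff forall_4)

lemma bounded_linear_vec4_to_pair: "bounded_linear vec4_to_pair"
  unfolding vec4_to_pair_def by (intro bounded_linear_Pair bounded_linear_vec_nth)

lemma pair_to_vec4_measurable [measurable]: "pair_to_vec4 \<in> borel_measurable borel"
  by (intro borel_measurable_continuous_onI linear_continuous_on bounded_linear_pair_to_vec4)

lemma inner_pair_to_vec4: "pair_to_vec4 x \<bullet> pair_to_vec4 y = x \<bullet> y"
  by (simp add: inner_vec_def sum_4 pair_to_vec4_def inner_prod_def)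

text \<open>Lebesgue measure is determined by the volumes of boxes, and the preimage of a box is a
  product of four intervals.\<close>

lemma lborel_distr_pair_to_vec4: "distr lborel borel pair_to_vec4 = lborel"
proof (rule lborel_eqI[symmetric])
  fix l u :: "real^4"
  assume lu: "\<And>b. b \<in> Basis \<Longrightarrow> l \<bullet> b \<le> u \<bullet> b"
  have le: "l $ i \<le> u $ i" for i
  proof -
    have "axis i 1 \<in> (Basis :: (real^4) set)" by (auto simp: Basis_vec_def)
    from lu[OF this] show ?thesis by (simp add: inner_axis)
  qed
  have "(\<Prod>b\<in>Basis. (u - l) \<bullet> b) = (\<Prod>i\<in>UNIV. (u - l) $ i)"
  proof -
    have B: "(Basis :: (real^4) set) = range (\<lambda>i. axis i 1)" by (auto simp: Basis_vec_def)
    have inj: "inj (\<lambda>i::4. axis i (1::real))" by (auto simp: inj_def axis_eq_axis)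
    show ?thesis unfolding B prod.reindex[OF inj] by (simp add: inner_axis)
  qed
  also have "\<dots> = (u$1 - l$1) * (u$2 - l$2) * ((u$3 - l$3) * (u$4 - l$4))"
    unfolding UNIV_4 by simp
  finally have prod: "(\<Prod>b\<in>Basis. (u - l) \<bullet> b) = (u$1 - l$1) * (u$2 - l$2) * ((u$3 - l$3) * (u$4 - l$4))" .
  have "pair_to_vec4 -` box l u = ({l$1<..<u$1} \<times> {l$2<..<u$2}) \<times> ({l$3<..<u$3} \<times> {l$4<..<u$4})"
    by (auto simp: pair_to_vec4_def mem_box_cart forall_4)
  then have "emeasure (distr lborel borel pair_to_vec4) (box l u)
      = emeasure (lborel \<Otimes>\<^sub>M lborel) (({l$1<..<u$1} \<times> {l$2<..<u$2}) \<times> ({l$3<..<u$3} \<times> {l$4<..<u$4}))"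
    by (subst emeasure_distr) (auto simp: lborel_prod)
  also have "\<dots> = emeasure (lborel \<Otimes>\<^sub>M lborel) ({l$1<..<u$1} \<times> {l$2<..<u$2}) * emeasure (lborel \<Otimes>\<^sub>M lborel) ({l$3<..<u$3} \<times> {l$4<..<u$4})"
    unfolding lborel_prod by (subst lborel.emeasure_pair_measure_Times[symmetric]) (auto simp: lborel_prod open_Times)
  also have "\<dots> = ennreal (\<Prod>b\<in>Basis. (u - l) \<bullet> b)"
    unfolding prod using le by (simp add: lborel.emeasure_pair_measure_Times ennreal_mult mult_ac)
  finally show "emeasure (distr lborel borel pair_to_vec4) (box l u) = ennreal (\<Prod>b\<in>Basis. (u - l) \<bullet> b)" .
qed simp

lemma fourier_pair_to_vec4:
  assumes [measurable]: "f \<in> borel_measurable borel"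
  shows "fourier f (pair_to_vec4 \<zeta>) = fourier (\<lambda>z. f (pair_to_vec4 z)) \<zeta>"
proof -
  have "fourier f (pair_to_vec4 \<zeta>) = (LINT x|distr lborel borel pair_to_vec4. wave x (pair_to_vec4 \<zeta>) * f x)"
    unfolding fourier_wave lborel_distr_pair_to_vec4 ..
  also have "\<dots> = fourier (\<lambda>z. f (pair_to_vec4 z)) \<zeta>"
    unfolding fourier_wave by (subst integral_distr) (auto simp: inner_pair_to_vec4)
  finally show ?thesis .
qed

lemma Lp_norm_pair_to_vec4:
  assumes [measurable]: "f \<in> borel_measurable borel"
  shows "Lp_norm p lborel f = Lp_norm p lborel (\<lambda>z. f (pair_to_vec4 z))"
proof -
  have "(LINT x|lborel. norm (f x) powr p) = (LINT x|distr lborel borel pair_to_vec4. norm (f x) powr p)"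
    unfolding lborel_distr_pair_to_vec4 ..
  also have "\<dots> = (LINT z|lborel. norm (f (pair_to_vec4 z)) powr p)"
    by (rule integral_distr) auto
  finally show ?thesis by (simp add: Lp_norm_def)
qed

section \<open>The torus measure as a push-forward of the unit square\<close>

abbreviation unit_interval :: "real measure" where
  "unit_interval \<equiv> restrict_space lborel {0..<1}"

lemma prob_space_unit_interval: "prob_space unit_interval"
  by (rule prob_spaceI) (simp add: emeasure_restrict_space space_restrict_space)

lemma measurable_unit_interval:
  "f \<in> borel_measurable borel \<Longrightarrow> f \<in> borel_measurable unit_interval"
  by (intro measurable_restrict_space1) simp

lemma prob_space_unit_square: "prob_space (unit_interval \<Otimes>\<^sub>M unit_interval)"
proof -
  interpret prob_space unit_interval by (rule prob_space_unit_interval)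
  interpret pair_prob_space unit_interval unit_interval ..
  show ?thesis by unfold_locales
qed

definition torus_param :: "real \<times> real \<Rightarrow> (real \<times> real) \<times> (real \<times> real)" where
  "torus_param z = (circ (fst z), circ (snd z))"

lemma torus_param_measurable [measurable]: "torus_param \<in> borel_measurable (unit_interval \<Otimes>\<^sub>M unit_interval)"
proof -
  have "(\<lambda>z. (circ (fst z), circ (snd z))) \<in> measurable (unit_interval \<Otimes>\<^sub>M unit_interval) (borel \<Otimes>\<^sub>M borel)"
    by (intro measurable_Pair measurable_compose[OF measurable_fst] measurable_compose[OF measurable_snd]
        measurable_unit_interval circ_measurable)
  then show ?thesis unfolding torus_param_def borel_prod by simp
qed

text \<open>\<open>torus_measure\<close> stacks push-forwards, two circle parametrisations and then
  \<open>join22\<close>. A product of push-forwards is the push-forward of the product, so they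
  collapse to a single map on the unit square.\<close>

lemma integral_torus_measure:
  fixes u :: "real^4 \<Rightarrow> real"
  assumes u: "u \<in> borel_measurable borel"
  shows "(LINT x|torus_measure. u x) = (LINT z|(unit_interval \<Otimes>\<^sub>M unit_interval). u (pair_to_vec4 (torus_param z)))"
proof -
  interpret C: prob_space circle_measure by (rule prob_space_circle_measure)
  define RS where "RS = restrict_space borel (sphere (0::real^2) 1)"
  have cp: "circle_param \<in> unit_interval \<rightarrow>\<^sub>M RS" unfolding RS_def by (rule circle_param_measurable)
  have "circle_measure \<Otimes>\<^sub>M circle_measure
     = distr (unit_interval \<Otimes>\<^sub>M unit_interval) (RS \<Otimes>\<^sub>M RS) (\<lambda>(x, y). (circle_param x, circle_param y))"
    unfolding circle_measure_def RS_def[symmetric]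
    by (rule pair_measure_distr[OF cp cp]) (use C.sigma_finite_measure_axioms in \<open>simp add: circle_measure_def RS_def\<close>)
  moreover have "(\<lambda>(x, y). (circle_param x, circle_param y)) \<in> measurable (unit_interval \<Otimes>\<^sub>M unit_interval) (RS \<Otimes>\<^sub>M RS)"
    using cp by measurable
  moreover have "join22 \<in> measurable (RS \<Otimes>\<^sub>M RS) (restrict_space borel torus2)"
  proof -
    have "sets (circle_measure \<Otimes>\<^sub>M circle_measure) = sets (RS \<Otimes>\<^sub>M RS)"
      by (intro sets_pair_measure_cong) (simp_all add: circle_measure_def RS_def)
    from measurable_cong_sets[OF this refl] show ?thesis using join22_measurable by blast
  qed
  ultimately have tm: "torus_measure = distr (unit_interval \<Otimes>\<^sub>M unit_interval) (restrict_space borel torus2) (join22 \<circ> (\<lambda>(x, y). (circle_param x, circle_param y)))"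
    and mm: "join22 \<circ> (\<lambda>(x, y). (circle_param x, circle_param y)) \<in> measurable (unit_interval \<Otimes>\<^sub>M unit_interval) (restrict_space borel torus2)"
    unfolding torus_measure_def by (simp_all add: distr_distr measurable_comp)
  have "u \<in> borel_measurable (restrict_space borel torus2)"
    by (rule measurable_restrict_space1[OF u])
  then have "(LINT x|torus_measure. u x) = (LINT z|(unit_interval \<Otimes>\<^sub>M unit_interval). u ((join22 \<circ> (\<lambda>(x, y). (circle_param x, circle_param y))) z))"
    unfolding tm by (rule integral_distr[OF mm])
  moreover have "(join22 \<circ> (\<lambda>(x, y). (circle_param x, circle_param y))) z = pair_to_vec4 (torus_param z)" for z
    by (simp add: case_prod_beta join22_def circle_param_def pair_to_vec4_def torus_param_def circ_def)
  ultimately show ?thesis by (simp only:)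
qed

lemma Lp_norm_torus_measure:
  assumes [measurable]: "f \<in> borel_measurable borel"
  shows "Lp_norm q torus_measure (fourier f)
     = (LINT z|(unit_interval \<Otimes>\<^sub>M unit_interval). norm (fourier (\<lambda>z. f (pair_to_vec4 z)) (torus_param z)) powr q) powr (1 / q)"
  unfolding Lp_norm_def
  by (subst integral_torus_measure) (simp_all add: fourier_pair_to_vec4)

lemma test_function_measurable: "f \<in> test_functions \<Longrightarrow> f \<in> borel_measurable borel"
  using C_k_imp_continuous[of 0 f] by (auto simp: test_functions_def smooth_def intro: borel_measurable_continuous_onI)

lemma test_function_disc_supported:
  fixes f :: "real^4 \<Rightarrow> complex"
  assumes f: "f \<in> test_functions"
  obtains B R where "disc_supported B R (\<lambda>z. f (pair_to_vec4 z))"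
proof -
  have cont: "continuous_on UNIV f" and cpt: "compact (closure {x. f x \<noteq> 0})"
    using f C_k_imp_continuous[of 0 f] by (auto simp: test_functions_def smooth_def)
  have "bounded (f ` closure {x. f x \<noteq> 0})"
    by (intro compact_imp_bounded compact_continuous_image cpt continuous_on_subset[OF cont]) auto
  then obtain B where B: "\<And>x. x \<in> closure {x. f x \<noteq> 0} \<Longrightarrow> norm (f x) \<le> B"
    by (auto simp: bounded_iff)
  have "bounded (vec4_to_pair ` closure {x. f x \<noteq> 0})"
    by (intro bounded_linear_image compact_imp_bounded cpt bounded_linear_vec4_to_pair)
  then obtain R where R: "\<And>x. x \<in> closure {x. f x \<noteq> 0} \<Longrightarrow> norm (vec4_to_pair x) \<le> R"
    by (auto simp: bounded_iff)
  have "norm (f (pair_to_vec4 (x, y))) \<le> \<bar>B\<bar> * indicator (cball 0 R) x * indicator (cball 0 R) y" for x y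
  proof (cases "f (pair_to_vec4 (x, y)) = 0")
    case False
    then have *: "pair_to_vec4 (x, y) \<in> closure {x. f x \<noteq> 0}" by (auto intro: closure_subset[THEN subsetD])
    have "norm x \<le> R" "norm y \<le> R"
      using R[OF *] norm_fst_le[of x y] norm_snd_le[of y x] by auto
    then show ?thesis using B[OF *] by simp
  qed (auto simp: indicator_def)
  then have "disc_supported \<bar>B\<bar> R (\<lambda>z. f (pair_to_vec4 z))"
    using test_function_measurable[OF f] by (auto simp: disc_supported_def)
  then show ?thesis by (rule that)
qed

text \<open>The exponent \<open>q0 = p' / 3\<close> comes from the torus estimate; smaller
  \<open>q\<close> follow by Hoelder against the constant 1 on a probability space. For
  \<open>p = 1\<close> there is no finite endpoint, and the sup bound by the \<open>L^1\<close> norm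
  serves every \<open>q\<close> with constant 1.\<close>

theorem restriction_sufficient:
  fixes p q :: real
  assumes p: "1 \<le> p" "p < 4 / 3" and q: "1 \<le> q" "ereal q \<le> conj_exponent p / 3"
  shows "\<exists>C>0. \<forall>f \<in> (test_functions :: (real^4 \<Rightarrow> complex) set).
            Lp_norm q torus_measure (fourier f) \<le> C * Lp_norm p lborel f"
proof -
  define Q where "Q = unit_interval \<Otimes>\<^sub>M unit_interval"
  interpret Q: prob_space Q unfolding Q_def by (rule prob_space_unit_square)
  have [measurable]: "torus_param \<in> borel_measurable Q" unfolding Q_def by (rule torus_param_measurable)
  show ?thesis
  proof (cases "p = 1")
    case True
    show ?thesis
    proof (intro exI[of _ 1] conjI ballI)
      fix f :: "real^4 \<Rightarrow> complex" assume "f \<in> test_functions"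
      then have fm[measurable]: "f \<in> borel_measurable borel" by (rule test_function_measurable)
      define g where "g z = f (pair_to_vec4 z)" for z
      have [measurable]: "g \<in> borel_measurable borel" unfolding g_def by measurable
      define D where "D = (LINT z|lborel. norm (g z))"
      have D: "D \<ge> 0" unfolding D_def by simp
      have v: "norm (fourier g (torus_param z)) powr q \<le> D powr q" for z
        unfolding D_def using q by (intro powr_mono2 norm_fourier_le) auto
      have "(LINT z|Q. norm (fourier g (torus_param z)) powr q) \<le> (LINT z|Q. D powr q)"
        by (intro integral_mono Q.integrable_const_bound[of _ "D powr q"]) (auto simp: v)
      then have "(LINT z|Q. norm (fourier g (torus_param z)) powr q) powr (1 / q) \<le> (D powr q) powr (1 / q)"
        using q by (intro powr_mono2) (auto simp: Q.prob_space intro!: integral_nonneg_AE)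
      also have "\<dots> = D" using D q by (simp add: powr_powr)
      finally show "Lp_norm q torus_measure (fourier f) \<le> 1 * Lp_norm p lborel f"
        unfolding Lp_norm_torus_measure[OF fm] Lp_norm_pair_to_vec4[OF fm] g_def[symmetric] Q_def[symmetric]
        unfolding Lp_norm_def using D by (simp add: True D_def)
    qed simp
  next
    case False
    then have p1: "p > 1" using p by simp
    define q0 where "q0 = p / (3 * (p - 1))"
    define s where "s = 1 / (3 * (p - 1))"
    have "ereal q \<le> ereal (p / (p - 1)) / 3" using q False by (simp add: conj_exponent_def)
    also have "\<dots> = ereal q0" by (simp add: q0_def divide_ereal_def ac_simps divide_simps)
    finally have qq0: "q \<le> q0" by simp
    have q0: "q0 > 0" using p1 by (simp add: q0_def)
    obtain C where C: "C > 0"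
      "\<And>g B R. disc_supported B R g \<Longrightarrow>
      (\<integral>\<^sup>+t. \<integral>\<^sup>+s. ennreal (norm (fourier g (circ s, circ t)) powr q0) * indicator {0..<1} s \<partial>lborel * indicator {0..<1} t \<partial>lborel)
        \<le> ennreal (C * (LINT z|lborel. norm (g z) powr p) powr s)"
      by (rule torus_restriction[OF p1 p(2), folded q0_def s_def]) (rule that)
    show ?thesis
    proof (intro exI[of _ "C powr (1 / q0)"] conjI ballI)
      show "C powr (1 / q0) > 0" using C by simp
      fix f :: "real^4 \<Rightarrow> complex" assume f: "f \<in> test_functions"
      then have fm[measurable]: "f \<in> borel_measurable borel" by (rule test_function_measurable)
      define g where "g z = f (pair_to_vec4 z)" for z
      have [measurable]: "g \<in> borel_measurable borel" unfolding g_def by measurable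
      obtain B R where BR: "disc_supported B R g"
        by (rule test_function_disc_supported[OF f, folded g_def]) (rule that)
      define D where "D = (LINT z|lborel. norm (g z) powr p)"
      have D: "D \<ge> 0" unfolding D_def by simp
      define v where "v z = norm (fourier g (torus_param z))" for z
      have [measurable]: "v \<in> borel_measurable Q" unfolding v_def by measurable
      have vb: "v z \<le> (LINT z|lborel. norm (g z))" and v0: "v z \<ge> 0" for z
        unfolding v_def by (auto intro: norm_fourier_le)
      have "(\<integral>\<^sup>+z. ennreal (v z powr q0) \<partial>Q) = (\<integral>\<^sup>+t. \<integral>\<^sup>+s. ennreal (v (s, t) powr q0) \<partial>unit_interval \<partial>unit_interval)"
      proof -
        interpret U: prob_space unit_interval by (rule prob_space_unit_interval)
        interpret UU: pair_sigma_finite unit_interval unit_interval ..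
        show ?thesis unfolding Q_def by (rule UU.nn_integral_snd[symmetric]) (simp flip: Q_def)
      qed
      also have "\<dots> = (\<integral>\<^sup>+t. \<integral>\<^sup>+s. ennreal (norm (fourier g (circ s, circ t)) powr q0) * indicator {0..<1} s \<partial>lborel * indicator {0..<1} t \<partial>lborel)"
        unfolding v_def torus_param_def by (simp add: nn_integral_restrict_space)
      also have "\<dots> \<le> ennreal (C * D powr s)"
        unfolding D_def by (rule C(2)[OF BR])
      finally have vq0: "(\<integral>\<^sup>+z. ennreal (v z powr q0) \<partial>Q) \<le> ennreal (C * D powr s)" .
      have CD: "C * D powr s \<ge> 0" using C by simp
      have vq: "(\<integral>\<^sup>+z. ennreal (v z powr q) \<partial>Q) \<le> ennreal ((C * D powr s) powr (q / q0))"
      proof (cases "q = q0")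
        case True
        then show ?thesis using vq0 CD q0 by simp
      next
        case False
        then have lt: "q < q0" using qq0 by simp
        have "(\<integral>\<^sup>+z. ennreal (v z powr q * 1) \<partial>Q) \<le> ennreal ((C * D powr s) powr (1 / (q0 / q)) * 1 powr (1 / (q0 / (q0 - q))))"
        proof (rule nn_integral_holder[where p="q0 / q" and q="q0 / (q0 - q)"])
          show "(\<integral>\<^sup>+z. ennreal ((v z powr q) powr (q0 / q)) \<partial>Q) \<le> ennreal (C * D powr s)"
            using vq0 q by (simp add: powr_powr)
          show "(\<integral>\<^sup>+z. ennreal (1 powr (q0 / (q0 - q))) \<partial>Q) \<le> ennreal 1"
            by (simp add: Q.emeasure_space_1)
          show "1 / (q0 / q) + 1 / (q0 / (q0 - q)) = 1" using q0 by (simp add: field_simps)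
        qed (use CD lt q in \<open>auto simp: field_simps\<close>)
        then show ?thesis by simp
      qed
      have "integrable Q (\<lambda>z. v z powr q)"
        using vb v0 q by (intro Q.integrable_const_bound[of _ "(LINT z|lborel. norm (g z)) powr q"] AE_I2) (auto intro: powr_mono2)
      then have "ennreal (LINT z|Q. v z powr q) \<le> ennreal ((C * D powr s) powr (q / q0))"
        using vq by (subst nn_integral_eq_integral[symmetric]) auto
      then have "(LINT z|Q. v z powr q) \<le> (C * D powr s) powr (q / q0)"
        by (subst (asm) ennreal_le_iff) auto
      then have "(LINT z|Q. v z powr q) powr (1 / q) \<le> ((C * D powr s) powr (q / q0)) powr (1 / q)"
        using q by (intro powr_mono2) (auto intro!: integral_nonneg_AE)
      also have "\<dots> = C powr (1 / q0) * D powr (1 / p)"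
      proof -
        have "s * (1 / q0) = 1 / p" using p1 by (simp add: s_def q0_def)
        then show ?thesis using C q by (simp add: powr_powr powr_mult)
      qed
      finally show "Lp_norm q torus_measure (fourier f) \<le> C powr (1 / q0) * Lp_norm p lborel f"
        unfolding Lp_norm_torus_measure[OF fm] Lp_norm_pair_to_vec4[OF fm] g_def[symmetric] Q_def[symmetric]
        unfolding Lp_norm_def v_def D_def .
    qed
  qed
qed

subsection \<open>Necessity: reduction to the circle and the Knapp example\<close>

lemma gauss_fourier': "\<epsilon> > 0 \<Longrightarrow> fourier (\<lambda>x. of_real (gauss \<epsilon> x)) \<xi> = of_real (kern \<epsilon> \<xi>)"
  using gauss_fourier[of \<epsilon> \<xi>] by (simp only: fourier_wave mult.commute)

lemma norm_circ: "norm (circ t) = 1"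
  by (simp add: circ_def norm_Pair)

lemma gauss_powr: "gauss \<epsilon> x powr p = gauss (p * \<epsilon>) x"
  by (simp add: gauss_def exp_powr_real mult_ac)

lemma smooth_C_kI: "(\<And>k. C_k k f) \<Longrightarrow> smooth f"
  by (simp add: smooth_def)

lemma smooth_imp_C_k: "smooth f \<Longrightarrow> C_k k f"
  by (simp add: smooth_def)

lemma C_k_fst_snd:
  "C_k k (\<lambda>x :: real \<times> real. complex_of_real (fst x))" "C_k k (\<lambda>x :: real \<times> real. complex_of_real (snd x))"
  by (intro C_k_linear bounded_linear_compose[OF bounded_linear_of_real] bounded_linear_fst bounded_linear_snd)+

lemma C_k_anisotropic_gauss:
  "C_k k (\<lambda>x :: real \<times> real. complex_of_real (exp (- (pi * a * (fst x)\<^sup>2)) * exp (- (pi * b * (snd x)\<^sup>2))))"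
proof -
  have "complex_of_real (exp (- (pi * a * (fst x)\<^sup>2)) * exp (- (pi * b * (snd x)\<^sup>2)))
     = exp (of_real (- (pi * a)) * (of_real (fst x) * of_real (fst x)) + of_real (- (pi * b)) * (of_real (snd x) * of_real (snd x)))" for x :: "real \<times> real"
    by (simp add: exp_add[symmetric] exp_of_real[symmetric] power2_eq_square)
  then show ?thesis
    by (simp only:) (intro C_k_exp C_k_add C_k_mult C_k_const C_k_fst_snd)
qed

lemma C_k_gauss: "C_k k (\<lambda>x. complex_of_real (gauss \<epsilon> x))"
  using C_k_anisotropic_gauss[of k \<epsilon> \<epsilon>] by (simp only: gauss_prod[symmetric] prod.collapse)

lemma gauss_bounded_integrable:
  fixes F :: "real \<times> real \<Rightarrow> complex"
  assumes [measurable]: "F \<in> borel_measurable borel" and \<epsilon>: "\<epsilon> > 0" and F: "\<And>x. norm (F x) \<le> A * gauss \<epsilon> x" and p: "p > 0"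
  shows "integrable lborel F" "integrable lborel (\<lambda>x. norm (F x) powr p)"
proof -
  have A: "A \<ge> 0" using F[of 0] order_trans[OF norm_ge_zero F[of 0]] gauss_pos[of \<epsilon> 0]
    by (simp add: zero_le_mult_iff)
  show "integrable lborel F"
  proof (rule Bochner_Integration.integrable_bound)
    show "integrable lborel (\<lambda>x. A * gauss \<epsilon> x)" using gauss_integrable[OF \<epsilon>] by simp
    show "AE x in lborel. norm (F x) \<le> norm (A * gauss \<epsilon> x)"
      by (intro AE_I2 order_trans[OF F]) simp
  qed measurable
  show "integrable lborel (\<lambda>x. norm (F x) powr p)"
  proof (rule Bochner_Integration.integrable_bound)
    show "integrable lborel (\<lambda>x. A powr p * gauss (p * \<epsilon>) x)" using gauss_integrable[of "p * \<epsilon>"] \<epsilon> p by simp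
    show "AE x in lborel. norm (norm (F x) powr p) \<le> norm (A powr p * gauss (p * \<epsilon>) x)"
    proof (intro AE_I2)
      fix x
      have "norm (F x) powr p \<le> (A * gauss \<epsilon> x) powr p"
        using F p by (intro powr_mono2) auto
      then show "norm (norm (F x) powr p) \<le> norm (A powr p * gauss (p * \<epsilon>) x)"
        using A gauss_pos[of "p * \<epsilon>" x] gauss_pos[of \<epsilon> x] by (simp add: powr_mult gauss_powr less_imp_le)
    qed
  qed measurable
qed

text \<open>The class of smooth functions with a Gaussian majorant contains both families of
  counterexamples: modulated anisotropic Gaussians, and Gaussian-weighted products of the circle
  transform. The constant \<open>C\<close> is independent of \<open>\<epsilon>\<close> and
  \<open>A\<close>, which only secure integrability.\<close>

definition circle_inequality :: "real \<Rightarrow> real \<Rightarrow> real \<Rightarrow> bool" where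
  "circle_inequality p q C \<longleftrightarrow>
     (\<forall>F \<epsilon> A. smooth F \<longrightarrow> \<epsilon> > 0 \<longrightarrow> (\<forall>x. norm (F x) \<le> A * gauss \<epsilon> x) \<longrightarrow>
       (LINT t|unit_interval. norm (fourier F (circ t)) powr q) powr (1 / q)
         \<le> C * (LINT x|lborel. norm (F x) powr p) powr (1 / p))"

text \<open>Testing the torus inequality on truncated tensor products with a fixed Gaussian yields the
  circle inequality.\<close>

lemma tensor_reduction:
  fixes p q C :: real
  assumes p: "1 \<le> p" and q: "1 \<le> q"
    and ineq: "\<forall>f \<in> (test_functions :: (real^4 \<Rightarrow> complex) set).
            Lp_norm q torus_measure (fourier f) \<le> C * Lp_norm p lborel f" and C: "C > 0"
  obtains C' where "C' > 0" "circle_inequality p q C'"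
proof -
  obtain \<chi>' :: "(real \<times> real) \<times> (real \<times> real) \<Rightarrow> complex"
    where cut: "smooth \<chi>'" "\<And>x. norm (\<chi>' x) \<le> 1" "\<chi>' 0 \<noteq> 0" "bounded {x. \<chi>' x \<noteq> 0}"
    by (rule smooth_cutoff_exists) (rule that)
  have cut_cont: "continuous_on UNIV \<chi>'"
    by (rule C_k_imp_continuous[OF smooth_imp_C_k[OF cut(1), of 0]])
  define Q where "Q = unit_interval \<Otimes>\<^sub>M unit_interval"
  interpret U: prob_space unit_interval by (rule prob_space_unit_interval)
  interpret UU: pair_sigma_finite unit_interval unit_interval ..
  interpret Q: prob_space Q unfolding Q_def by (rule prob_space_unit_square)
  have [measurable]: "torus_param \<in> borel_measurable Q" unfolding Q_def by (rule torus_param_measurable)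
  define g2 where "g2 y = complex_of_real (gauss 1 y)" for y
  have g2_m[measurable]: "g2 \<in> borel_measurable borel" unfolding g2_def by measurable
  define I2 where "I2 = (LINT y|lborel. norm (g2 y) powr p)"
  \<comment> \<open>The integral is the Fourier transform of a Gaussian at the origin, hence
    explicit and positive.\<close>
  have I2: "I2 > 0"
  proof -
    have "norm (g2 y) powr p = gauss p y" for y
      using gauss_powr[of 1 y p] gauss_pos[of 1 y] by (simp add: g2_def)
    then have "complex_of_real I2 = (LINT y|lborel. complex_of_real (gauss p y))"
      unfolding I2_def by (simp only: integral_complex_of_real)
    also have "\<dots> = of_real (kern p 0)"
      using gauss_fourier[of p 0] p by simp
    finally have "I2 = kern p 0" by (simp only: of_real_eq_iff)
    then show ?thesis using p by (simp add: kern_def)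
  qed
  \<comment> \<open>On the circle \<open>kern 1\<close> is constantly \<open>exp (- pi)\<close>, so
    the transform of the Gaussian factor is constant there. Together with the limiting value
    \<open>\<chi>' 0\<close> of the cutoffs this is the factor gained on the left side.\<close>
  define c where "c = norm (\<chi>' 0) * exp (- pi)"
  have c: "c > 0" using cut(3) by (simp add: c_def)
  show ?thesis
  proof
    show "C * I2 powr (1 / p) / c > 0" using C I2 c by simp
    show "circle_inequality p q (C * I2 powr (1 / p) / c)"
      unfolding circle_inequality_def
    proof (intro allI impI)
      fix F :: "real \<times> real \<Rightarrow> complex" and \<epsilon> A :: real
      assume F: "smooth F" and \<epsilon>: "\<epsilon> > 0" and FA': "\<forall>x. norm (F x) \<le> A * gauss \<epsilon> x"
      have FA: "norm (F x) \<le> A * gauss \<epsilon> x" for x using FA' by blast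
      have [measurable]: "F \<in> borel_measurable borel"
        by (intro borel_measurable_continuous_onI C_k_imp_continuous[OF smooth_imp_C_k[OF F, of 0]])
      have F_int: "integrable lborel F" and F_p: "integrable lborel (\<lambda>x. norm (F x) powr p)"
        using gauss_bounded_integrable[OF _ \<epsilon> FA, of p] p by auto
      have g2_int: "integrable lborel g2" and g2_p: "integrable lborel (\<lambda>x. norm (g2 x) powr p)"
        using gauss_bounded_integrable[OF g2_m, of 1 1 p] p by (auto simp: g2_def gauss_pos less_imp_le)
      define FF where "FF z = F (fst z) * g2 (snd z)" for z
      have FFC: "C_k k FF" for k
        unfolding FF_def g2_def
        by (intro C_k_mult C_k_comp_linear[OF bounded_linear_fst] C_k_comp_linear[OF bounded_linear_snd] C_k_gauss smooth_imp_C_k[OF F])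
      have [measurable]: "FF \<in> borel_measurable borel"
        by (intro borel_measurable_continuous_onI C_k_imp_continuous[OF FFC[of 0]])
      have FF_int: "integrable lborel FF"
        unfolding FF_def by (rule lborel_prod_integrable_mult(1)[OF F_int g2_int])
      have FF_p: "integrable lborel (\<lambda>z. norm (FF z) powr p)"
        and FF_p_eq: "(LINT z|lborel. norm (FF z) powr p) = (LINT x|lborel. norm (F x) powr p) * I2"
        using lborel_prod_integrable_mult[OF F_p g2_p] by (simp_all add: FF_def norm_mult powr_mult I2_def)
      have FF_fourier: "fourier FF (\<xi>, \<eta>) = fourier F \<xi> * of_real (kern 1 \<eta>)" for \<xi> \<eta>
        unfolding FF_def fourier_tensor[OF F_int g2_int] by (simp add: g2_def[abs_def] gauss_fourier')
      \<comment> \<open>The dilated cutoffs are bounded by 1, so they never increase an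
        \<open>L^p\<close> norm, and they tend pointwise to \<open>\<chi>' 0\<close>.\<close>
      define ff where "ff n z = FF z * \<chi>' ((1 / real (Suc n)) *\<^sub>R z)" for n z
      have ff_le: "norm (ff n z) \<le> norm (FF z)" for n z
        using mult_left_mono[OF cut(2)[of "(1 / real (Suc n)) *\<^sub>R z"], of "norm (FF z)"] by (simp add: ff_def norm_mult)
      have ffC: "C_k k (ff n)" for k n
        unfolding ff_def
        by (intro C_k_mult FFC C_k_comp_linear[OF bounded_linear_scaleR_right] smooth_imp_C_k[OF cut(1)])
      have ff_m[measurable]: "ff n \<in> borel_measurable borel" for n
        by (intro borel_measurable_continuous_onI C_k_imp_continuous[OF ffC[of 0]])
      define h where "h n x = ff n (vec4_to_pair x)" for n x
      have h_test: "h n \<in> test_functions" for n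
      proof -
        have "smooth (h n)"
          unfolding h_def by (intro smooth_C_kI C_k_comp_linear[OF bounded_linear_vec4_to_pair] ffC)
        moreover have "{x. h n x \<noteq> 0} \<subseteq> (\<lambda>w. pair_to_vec4 (real (Suc n) *\<^sub>R w)) ` {w. \<chi>' w \<noteq> 0}"
        proof (rule subsetI)
          fix x assume "x \<in> {x. h n x \<noteq> 0}"
          then have "\<chi>' ((1 / real (Suc n)) *\<^sub>R vec4_to_pair x) \<noteq> 0" by (simp add: h_def ff_def)
          moreover have "x = pair_to_vec4 (real (Suc n) *\<^sub>R ((1 / real (Suc n)) *\<^sub>R vec4_to_pair x))" by simp
          ultimately show "x \<in> (\<lambda>w. pair_to_vec4 (real (Suc n) *\<^sub>R w)) ` {w. \<chi>' w \<noteq> 0}" by blast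
        qed
        moreover have "bounded ((\<lambda>w. pair_to_vec4 (real (Suc n) *\<^sub>R w)) ` {w. \<chi>' w \<noteq> 0})"
          by (intro bounded_linear_image cut(4) bounded_linear_compose[OF bounded_linear_pair_to_vec4] bounded_linear_scaleR_right)
        ultimately show ?thesis
          by (auto simp: test_functions_def compact_closure intro: bounded_subset)
      qed
      have hm: "h n \<in> borel_measurable borel" for n by (rule test_function_measurable[OF h_test])
      have hff: "(\<lambda>z. h n (pair_to_vec4 z)) = ff n" for n by (simp add: h_def)
      define Y where "Y = C * (LINT z|lborel. norm (FF z) powr p) powr (1 / p)"
      have ff_bd: "(LINT z|Q. norm (fourier (ff n) (torus_param z)) powr q) powr (1 / q) \<le> Y" for n
      proof -
        have "(LINT z|Q. norm (fourier (ff n) (torus_param z)) powr q) powr (1 / q) = Lp_norm q torus_measure (fourier (h n))"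
          unfolding Lp_norm_torus_measure[OF hm] hff Q_def ..
        also have "\<dots> \<le> C * Lp_norm p lborel (h n)" using ineq h_test by blast
        also have "Lp_norm p lborel (h n) = (LINT z|lborel. norm (ff n z) powr p) powr (1 / p)"
          unfolding Lp_norm_pair_to_vec4[OF hm] hff unfolding Lp_norm_def ..
        also have "C * \<dots> \<le> Y"
        proof -
          have "(LINT z|lborel. norm (ff n z) powr p) \<le> (LINT z|lborel. norm (FF z) powr p)"
          proof (rule integral_mono)
            show "integrable lborel (\<lambda>z. norm (ff n z) powr p)"
              by (rule Bochner_Integration.integrable_bound[OF FF_p])
                 (use p ff_le in \<open>auto intro!: AE_I2 powr_mono2\<close>)
          qed (use FF_p p ff_le in \<open>auto intro!: powr_mono2\<close>)
          then show ?thesis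
            unfolding Y_def using C p by (intro mult_left_mono powr_mono2) (auto intro!: integral_nonneg_AE)
        qed
        finally show ?thesis .
      qed
      have lim: "(\<lambda>n. fourier (ff n) \<zeta>) \<longlonglongrightarrow> \<chi>' 0 * fourier FF \<zeta>" for \<zeta>
      proof -
        have "(\<lambda>n. LINT z|lborel. wave z \<zeta> * ff n z) \<longlonglongrightarrow> (LINT z|lborel. \<chi>' 0 * (wave z \<zeta> * FF z))"
        proof (rule integral_dominated_convergence[where w="\<lambda>z. norm (FF z)"])
          show "AE z in lborel. (\<lambda>n. wave z \<zeta> * ff n z) \<longlonglongrightarrow> \<chi>' 0 * (wave z \<zeta> * FF z)"
          proof (intro AE_I2)
            fix z :: "(real \<times> real) \<times> (real \<times> real)"
            have "(\<lambda>n. (1 / real (Suc n)) *\<^sub>R z) \<longlonglongrightarrow> 0 *\<^sub>R z"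
              by (intro tendsto_scaleR tendsto_const LIMSEQ_Suc[OF lim_1_over_n])
            then have "(\<lambda>n. (1 / real (Suc n)) *\<^sub>R z) \<longlonglongrightarrow> 0" by simp
            moreover have "isCont \<chi>' 0" using cut_cont continuous_on_eq_continuous_at[OF open_UNIV, of \<chi>'] by blast
            ultimately have "(\<lambda>n. \<chi>' ((1 / real (Suc n)) *\<^sub>R z)) \<longlonglongrightarrow> \<chi>' 0"
              by (rule isCont_tendsto_compose[rotated])
            then have "(\<lambda>n. wave z \<zeta> * (FF z * \<chi>' ((1 / real (Suc n)) *\<^sub>R z))) \<longlonglongrightarrow> wave z \<zeta> * (FF z * \<chi>' 0)"
              by (intro tendsto_intros)
            then show "(\<lambda>n. wave z \<zeta> * ff n z) \<longlonglongrightarrow> \<chi>' 0 * (wave z \<zeta> * FF z)"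
              by (simp only: ff_def mult_ac)
          qed
          show "AE z in lborel. norm (wave z \<zeta> * ff n z) \<le> norm (FF z)" for n
            using ff_le by (intro AE_I2) (simp only: norm_mult norm_cis mult_1)
        qed (use FF_int in \<open>auto intro!: integrable_norm\<close>)
        then show ?thesis unfolding fourier_wave by simp
      qed
      define D where "D = (LINT z|lborel. norm (FF z))"
      have ff_D: "norm (fourier (ff n) \<zeta>) \<le> D" for n \<zeta>
      proof -
        have "norm (fourier (ff n) \<zeta>) \<le> (LINT z|lborel. norm (ff n z))" by (rule norm_fourier_le)
        also have "\<dots> \<le> D"
          unfolding D_def
        proof (rule integral_mono)
          show "integrable lborel (\<lambda>z. norm (ff n z))"
            by (rule Bochner_Integration.integrable_bound[OF FF_int]) (use ff_le in \<open>auto intro!: AE_I2\<close>)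
        qed (use FF_int ff_le in auto)
        finally show ?thesis .
      qed
      have "(\<lambda>n. LINT z|Q. norm (fourier (ff n) (torus_param z)) powr q) \<longlonglongrightarrow> (LINT z|Q. norm (\<chi>' 0 * fourier FF (torus_param z)) powr q)"
      proof (rule integral_dominated_convergence[where w="\<lambda>_. D powr q"])
        show "AE z in Q. (\<lambda>n. norm (fourier (ff n) (torus_param z)) powr q) \<longlonglongrightarrow> norm (\<chi>' 0 * fourier FF (torus_param z)) powr q"
          using q by (intro AE_I2 tendsto_powr' tendsto_norm lim tendsto_const) auto
        show "AE z in Q. norm (norm (fourier (ff n) (torus_param z)) powr q) \<le> D powr q" for n
          using q by (intro AE_I2) (simp add: powr_mono2 ff_D)
      qed measurable
      then have "(\<lambda>n. (LINT z|Q. norm (fourier (ff n) (torus_param z)) powr q) powr (1 / q))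
         \<longlonglongrightarrow> (LINT z|Q. norm (\<chi>' 0 * fourier FF (torus_param z)) powr q) powr (1 / q)"
        using q by (intro tendsto_powr' tendsto_const) (auto intro!: integral_nonneg_AE always_eventually)
      then have XY: "(LINT z|Q. norm (\<chi>' 0 * fourier FF (torus_param z)) powr q) powr (1 / q) \<le> Y"
        by (rule LIMSEQ_le_const2) (use ff_bd in auto)
      define u where "u t = norm (fourier F (circ t)) powr q" for t
      have [measurable]: "u \<in> borel_measurable unit_interval"
        unfolding u_def by (rule measurable_unit_interval) measurable
      have "kern 1 (circ t) = exp (- pi)" for t by (simp add: kern_def norm_circ)
      then have eq: "norm (\<chi>' 0 * fourier FF (torus_param z)) powr q = c powr q * u (fst z)" for z
        unfolding torus_param_def FF_fourier by (simp add: norm_mult powr_mult u_def c_def mult_ac)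
      have "integrable Q (\<lambda>z. c powr q * u (fst z))"
      proof (rule Q.integrable_const_bound[of _ "c powr q * (LINT x|lborel. norm (F x)) powr q"])
        show "AE z in Q. norm (c powr q * u (fst z)) \<le> c powr q * (LINT x|lborel. norm (F x)) powr q"
          using q by (intro AE_I2) (auto simp: u_def intro!: mult_left_mono powr_mono2 norm_fourier_le)
        show "(\<lambda>z. c powr q * u (fst z)) \<in> borel_measurable Q" unfolding Q_def by measurable
      qed
      then have "(LINT z|Q. c powr q * u (fst z)) = c powr q * (LINT t|unit_interval. u t)"
        unfolding Q_def using UU.integral_fst'[of "\<lambda>z. c powr q * u (fst z)"] U.prob_space by auto
      then have "(LINT z|Q. norm (\<chi>' 0 * fourier FF (torus_param z)) powr q) powr (1 / q) = c * (LINT t|unit_interval. u t) powr (1 / q)"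
        unfolding eq using c q by (simp add: powr_mult powr_powr)
      then have "c * (LINT t|unit_interval. u t) powr (1 / q) \<le> C * ((LINT x|lborel. norm (F x) powr p) powr (1 / p) * I2 powr (1 / p))"
        using XY unfolding Y_def FF_p_eq by (simp add: powr_mult)
      then show "(LINT t|unit_interval. norm (fourier F (circ t)) powr q) powr (1 / q) \<le> C * I2 powr (1 / p) / c * (LINT x|lborel. norm (F x) powr p) powr (1 / p)"
        using c by (simp add: u_def field_simps)
    qed
  qed
qed

lemma gauss_integral_1:
  assumes "\<epsilon> > 0"
  shows "(LINT x|lborel. exp (- (pi * \<epsilon> * x\<^sup>2))) = 1 / sqrt \<epsilon>"
proof -
  have "(LINT x|lborel. complex_of_real (exp (- (pi * \<epsilon> * x\<^sup>2)))) = of_real (1 / sqrt \<epsilon>)"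
    using gauss_fourier_1[OF assms, of 0] by simp
  then have "complex_of_real (LINT x|lborel. exp (- (pi * \<epsilon> * x\<^sup>2))) = of_real (1 / sqrt \<epsilon>)"
    by (simp only: integral_complex_of_real)
  then show ?thesis by (simp only: of_real_eq_iff)
qed

text \<open>The transform of the test function has size \<open>\<delta>^(-3)\<close> on a box of
  sides \<open>\<delta>^2\<close> and \<open>\<delta>\<close> around \<open>(1, 0)\<close>. The box
  contains an arc of length comparable to \<open>\<delta>\<close>, because the circle leaves its
  tangent only quadratically. So the left side is at least of order
  \<open>\<delta>^(1/q - 3)\<close> while the right side has order \<open>\<delta>^(-3/p)\<close>,
  and small \<open>\<delta>\<close> compares the exponents.\<close>

lemma knapp_necessary:
  fixes p q C :: real
  assumes p: "1 < p" and q: "1 \<le> q"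
    and ineq: "circle_inequality p q C"
    and C: "C > 0"
  shows "q \<le> p / (3 * (p - 1))"
proof (rule ccontr)
  assume not: "\<not> q \<le> p / (3 * (p - 1))"
  \<comment> \<open>The difference of the two exponents of \<open>\<delta>\<close>; it is negative
    exactly when \<open>q > p' / 3\<close>.\<close>
  define \<kappa> where "\<kappa> = 1 / q - 3 + 3 / p"
  have \<kappa>: "\<kappa> < 0"
  proof -
    have "0 < 3 * (p - 1)" using p by simp
    from pos_divide_less_eq[OF this, of p q] have "p < q * (3 * (p - 1))" using not by (simp only: not_le)
    then show ?thesis using p q by (simp add: \<kappa>_def field_simps)
  qed
  interpret U: prob_space unit_interval by (rule prob_space_unit_interval)
  have main: "(1 / (2 * pi)) powr (1 / q) * exp (- (2 * pi)) * \<delta> powr \<kappa> \<le> C * (1 / p) powr (1 / p)"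
    if \<delta>: "0 < \<delta>" "\<delta> \<le> 1" for \<delta>
  proof -
    \<comment> \<open>The modulation moves the centre of the transform to
      \<open>(1, 0) = circ 0\<close>. The tangent there is vertical, hence the finer scale
      \<open>\<delta>^2\<close> of the transform in the first variable, that is, the Gaussian
      parameter \<open>\<delta> ^ 4\<close>.\<close>
    define F1 where "F1 x = complex_of_real (exp (- (pi * \<delta> ^ 4 * x\<^sup>2))) * cis (2 * pi * x)" for x
    define F2 where "F2 x = complex_of_real (exp (- (pi * \<delta>\<^sup>2 * x\<^sup>2)))" for x
    define F where "F x = F1 (fst x) * F2 (snd x)" for x
    have F_exp: "F x = complex_of_real (exp (- (pi * \<delta> ^ 4 * (fst x)\<^sup>2)) * exp (- (pi * \<delta>\<^sup>2 * (snd x)\<^sup>2))) * exp (of_real (fst x) * (\<i> * of_real (2 * pi)))" for x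
      by (simp add: F_def F1_def F2_def cis_conv_exp mult_ac)
    have smooth: "smooth F"
      unfolding F_exp by (intro smooth_C_kI C_k_mult C_k_anisotropic_gauss C_k_exp C_k_fst_snd C_k_const)
    have Fn: "norm (F x) = exp (- (pi * \<delta> ^ 4 * (fst x)\<^sup>2)) * exp (- (pi * \<delta>\<^sup>2 * (snd x)\<^sup>2))" for x
      by (simp add: F_def F1_def F2_def norm_mult)
    have bound: "norm (F x) \<le> 1 * gauss (\<delta> ^ 4) x" for x
    proof -
      have "\<delta> ^ 4 \<le> \<delta>\<^sup>2" using \<delta> by (intro power_decreasing) auto
      then have "pi * \<delta> ^ 4 * (snd x)\<^sup>2 \<le> pi * \<delta>\<^sup>2 * (snd x)\<^sup>2" by (intro mult_right_mono mult_left_mono) auto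
      then show ?thesis
        unfolding Fn using gauss_prod[of "\<delta> ^ 4" "fst x" "snd x"] by simp
    qed
    have int1: "integrable lborel F1" "integrable lborel F2"
    proof -
      have "F1 \<in> borel_measurable borel" "F2 \<in> borel_measurable borel"
        unfolding F1_def F2_def by measurable
      then show "integrable lborel F1" "integrable lborel F2"
        using \<delta> by (auto intro!: Bochner_Integration.integrable_bound[OF gauss_integrable_1[of "\<delta> ^ 4"], of F1]
          Bochner_Integration.integrable_bound[OF gauss_integrable_1[of "\<delta>\<^sup>2"], of F2] simp: F1_def F2_def norm_mult)
    qed
    have fF: "fourier F \<xi> = of_real (exp (- (pi * (fst \<xi> - 1)\<^sup>2 / \<delta> ^ 4)) / \<delta>\<^sup>2 * (exp (- (pi * (snd \<xi>)\<^sup>2 / \<delta>\<^sup>2)) / \<delta>))" for \<xi>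
    proof -
      have "fourier F \<xi> = fourier F1 (fst \<xi>) * fourier F2 (snd \<xi>)"
        unfolding F_def by (rule fourier_tensor[OF int1])
      moreover have "fourier F1 u = of_real (exp (- (pi * (u - 1)\<^sup>2 / \<delta> ^ 4)) / \<delta>\<^sup>2)" for u
      proof -
        have "wave x u * F1 x = of_real (exp (- (pi * \<delta> ^ 4 * x\<^sup>2))) * cis (- 2 * pi * (x * (u - 1)))" for x
        proof -
          have "- 2 * pi * (x * (u - 1)) = - 2 * pi * (x \<bullet> u) + 2 * pi * x" by (simp add: right_diff_distrib)
          then have "cis (- 2 * pi * (x * (u - 1))) = wave x u * cis (2 * pi * x)" by (simp only: cis_mult)
          then show ?thesis by (simp only: F1_def mult_ac)
        qed
        moreover have "sqrt (\<delta> ^ 4) = \<delta>\<^sup>2" using \<delta> by (intro real_sqrt_unique) auto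
        ultimately show ?thesis
          unfolding fourier_wave using gauss_fourier_1[of "\<delta> ^ 4" "u - 1"] \<delta> by (simp only: zero_less_power)
      qed
      moreover have "fourier F2 u = of_real (exp (- (pi * u\<^sup>2 / \<delta>\<^sup>2)) / \<delta>)" for u
        unfolding fourier_wave F2_def using gauss_fourier_1[of "\<delta>\<^sup>2" u] \<delta> by (simp add: mult.commute)
      ultimately show ?thesis by (simp only: of_real_mult)
    qed
    define u where "u t = norm (fourier F (circ t)) powr q" for t
    \<comment> \<open>For these \<open>t\<close> the angle \<open>x = 2 * pi * t\<close> is at most
      \<open>\<delta>\<close>, so \<open>\<bar>sin x\<bar> \<le> \<delta>\<close> and
      \<open>1 - cos x \<le> \<delta>^2\<close>. Each Gaussian factor is then at least
      \<open>exp (- pi)\<close>.\<close>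
    have low: "(exp (- (2 * pi)) / \<delta> ^ 3) powr q * indicator {0..\<delta> / (2 * pi)} t \<le> u t" for t
    proof (cases "t \<in> {0..\<delta> / (2 * pi)}")
      case True
      define x where "x = 2 * pi * t"
      have x: "0 \<le> x" "x \<le> \<delta>" using True by (auto simp: x_def field_simps)
      have s: "(sin x)\<^sup>2 \<le> \<delta>\<^sup>2"
        using x abs_sin_x_le_abs_x[of x] by (intro power2_le_iff_abs_le[THEN iffD2]) auto
      have "1 - cos x = 2 * (sin (x / 2))\<^sup>2"
        using cos_double_sin[of "x / 2"] by simp
      also have "\<dots> \<le> 2 * (\<delta> / 2)\<^sup>2"
        using x abs_sin_x_le_abs_x[of "x / 2"] by (intro mult_left_mono power2_le_iff_abs_le[THEN iffD2]) auto
      also have "2 * (\<delta> / 2)\<^sup>2 \<le> \<delta>\<^sup>2" by (simp add: power_divide)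
      finally have "\<bar>cos x - 1\<bar> \<le> \<delta>\<^sup>2" using cos_le_one[of x] by (subst abs_of_nonpos) auto
      then have "(cos x - 1)\<^sup>2 \<le> (\<delta>\<^sup>2)\<^sup>2"
        by (intro power2_le_iff_abs_le[THEN iffD2]) auto
      then have "(cos x - 1)\<^sup>2 / \<delta> ^ 4 \<le> 1" "(sin x)\<^sup>2 / \<delta>\<^sup>2 \<le> 1"
        using \<delta> s by (auto simp flip: power_mult)
      then have "pi * ((cos x - 1)\<^sup>2 / \<delta> ^ 4) \<le> pi * 1" "pi * ((sin x)\<^sup>2 / \<delta>\<^sup>2) \<le> pi * 1"
        by (intro mult_left_mono; simp)+
      then have "exp (- pi) * exp (- pi) \<le> exp (- (pi * (cos x - 1)\<^sup>2 / \<delta> ^ 4)) * exp (- (pi * (sin x)\<^sup>2 / \<delta>\<^sup>2))"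
        by (intro mult_mono) auto
      moreover have "exp (- pi) * exp (- pi) = exp (- (2 * pi))" by (simp flip: exp_add)
      moreover have "norm (fourier F (circ t)) = exp (- (pi * (cos x - 1)\<^sup>2 / \<delta> ^ 4)) * exp (- (pi * (sin x)\<^sup>2 / \<delta>\<^sup>2)) / \<delta> ^ 3"
        using \<delta> unfolding fF norm_of_real x_def circ_def fst_conv snd_conv by (simp add: abs_mult power2_eq_square power3_eq_cube)
      ultimately have "exp (- (2 * pi)) / \<delta> ^ 3 \<le> norm (fourier F (circ t))"
        using \<delta> by (simp add: divide_right_mono)
      then show ?thesis using True \<delta> q by (auto simp: u_def intro!: powr_mono2)
    qed (simp add: u_def)
    have [measurable]: "F \<in> borel_measurable borel"
      by (intro borel_measurable_continuous_onI C_k_imp_continuous[OF smooth_imp_C_k[OF smooth, of 0]])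
    have [measurable]: "u \<in> borel_measurable borel" unfolding u_def by measurable
    have u_int: "integrable unit_interval u"
      using q by (intro U.integrable_const_bound[of _ "(LINT x|lborel. norm (F x)) powr q"] AE_I2)
        (auto simp: u_def[symmetric] intro!: measurable_unit_interval, auto simp: u_def intro!: powr_mono2 norm_fourier_le)
    have d1: "\<delta> / (2 * pi) < 1"
      using \<delta> pi_gt3 by (simp add: field_simps)
    have "(exp (- (2 * pi)) / \<delta> ^ 3) powr q * (\<delta> / (2 * pi)) = (LINT t|unit_interval. (exp (- (2 * pi)) / \<delta> ^ 3) powr q * indicator {0..\<delta> / (2 * pi)} t)"
    proof -
      have sub: "{0..\<delta> / (2 * pi)} \<subseteq> {0..<1}" using d1 by (auto intro: le_less_trans simp del: divide_less_eq_1 divide_less_eq_1_pos)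
      have "measure unit_interval {0..\<delta> / (2 * pi)} = \<delta> / (2 * pi)"
        using sub \<delta> by (subst measure_restrict_space) auto
      moreover have "{0..\<delta> / (2 * pi)} \<in> sets unit_interval"
        using sub by (subst sets_restrict_space_iff) auto
      ultimately show ?thesis
        using sets.sets_into_space[of "{0..\<delta> / (2 * pi)}" unit_interval] by (simp add: Int_absorb2)
    qed
    also have "\<dots> \<le> (LINT t|unit_interval. u t)"
    proof (rule integral_mono[OF _ u_int low])
      show "integrable unit_interval (\<lambda>t. (exp (- (2 * pi)) / \<delta> ^ 3) powr q * indicator {0..\<delta> / (2 * pi)} t)"
        by (intro U.integrable_const_bound[of _ "(exp (- (2 * pi)) / \<delta> ^ 3) powr q"] AE_I2 measurable_unit_interval)
           (auto simp: indicator_def)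
    qed
    finally have "((exp (- (2 * pi)) / \<delta> ^ 3) powr q * (\<delta> / (2 * pi))) powr (1 / q) \<le> (LINT t|unit_interval. u t) powr (1 / q)"
      using q \<delta> by (intro powr_mono2) auto
    also have "\<dots> \<le> C * (LINT x|lborel. norm (F x) powr p) powr (1 / p)"
      proof -
      have "\<delta> ^ 4 > 0" using \<delta> by simp
      with ineq smooth bound show ?thesis unfolding circle_inequality_def u_def by blast
    qed
    also have "(LINT x|lborel. norm (F x) powr p) = 1 / p * \<delta> powr (- 3)"
    proof -
      have "norm (F x) powr p = exp (- (pi * (p * \<delta> ^ 4) * (fst x)\<^sup>2)) * exp (- (pi * (p * \<delta>\<^sup>2) * (snd x)\<^sup>2))" for x
        unfolding Fn by (simp add: powr_mult exp_powr_real mult_ac)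
      moreover have "p * \<delta> ^ 4 > 0" "p * \<delta>\<^sup>2 > 0" using p \<delta> by auto
      ultimately have "(LINT x|lborel. norm (F x) powr p) = 1 / sqrt (p * \<delta> ^ 4) * (1 / sqrt (p * \<delta>\<^sup>2))"
        by (simp only: lborel_prod_integrable_mult(2)[OF gauss_integrable_1 gauss_integrable_1] gauss_integral_1)
      also have "\<dots> = 1 / p * \<delta> powr (- 3)"
      proof -
        have "sqrt (\<delta> ^ 4) = \<delta>\<^sup>2" using \<delta> by (intro real_sqrt_unique) auto
        moreover have "\<delta> powr (- 3) = 1 / \<delta> ^ 3" using \<delta> by (simp add: powr_minus_divide)
        ultimately show ?thesis using p \<delta> by (simp add: real_sqrt_mult field_simps power2_eq_square power3_eq_cube)
      qed
      finally show ?thesis .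
    qed
    finally have "((exp (- (2 * pi)) / \<delta> ^ 3) powr q * (\<delta> / (2 * pi))) powr (1 / q) \<le> C * (1 / p * \<delta> powr (- 3)) powr (1 / p)" .
    moreover have "((exp (- (2 * pi)) / \<delta> ^ 3) powr q * (\<delta> / (2 * pi))) powr (1 / q) = (1 / (2 * pi)) powr (1 / q) * exp (- (2 * pi)) * \<delta> powr (1 / q - 3)"
    proof -
      have "((exp (- (2 * pi)) / \<delta> ^ 3) powr q * (\<delta> / (2 * pi))) powr (1 / q) = (exp (- (2 * pi)) / \<delta> ^ 3) * (\<delta> powr (1 / q) * (1 / (2 * pi)) powr (1 / q))"
      proof -
        have "((exp (- (2 * pi)) / \<delta> ^ 3) powr q) powr (1 / q) = exp (- (2 * pi)) / \<delta> ^ 3"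
          using \<delta> q by (simp add: powr_powr)
        moreover have "(\<delta> / (2 * pi)) powr (1 / q) = \<delta> powr (1 / q) * (1 / (2 * pi)) powr (1 / q)"
          using \<delta> powr_mult[of \<delta> "1 / (2 * pi)" "1 / q"] by simp
        ultimately show ?thesis using \<delta> by (subst powr_mult) auto
      qed
      moreover have "\<delta> powr (1 / q - 3) = \<delta> powr (1 / q) / \<delta> ^ 3" using \<delta> by (simp add: powr_diff)
      ultimately show ?thesis by (simp add: mult_ac)
    qed
    moreover have "(1 / p * \<delta> powr (- 3)) powr (1 / p) = (1 / p) powr (1 / p) * \<delta> powr (- (3 / p))"
      using \<delta> p by (subst powr_mult) (auto simp: powr_powr)
    ultimately have "(1 / (2 * pi)) powr (1 / q) * exp (- (2 * pi)) * \<delta> powr (1 / q - 3) \<le> C * (1 / p) powr (1 / p) * \<delta> powr (- (3 / p))"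
      by (simp add: mult.assoc)
    then have "(1 / (2 * pi)) powr (1 / q) * exp (- (2 * pi)) * \<delta> powr (1 / q - 3) * \<delta> powr (3 / p) \<le> C * (1 / p) powr (1 / p) * \<delta> powr (- (3 / p)) * \<delta> powr (3 / p)"
      by (rule mult_right_mono) simp
    moreover have "\<delta> powr (- (3 / p)) * \<delta> powr (3 / p) = 1" "\<delta> powr (1 / q - 3) * \<delta> powr (3 / p) = \<delta> powr \<kappa>"
      using \<delta> by (simp_all add: \<kappa>_def flip: powr_add)
    ultimately show ?thesis by (simp only: mult.assoc mult_1_right)
  qed
  define b where "b = (1 / (2 * pi)) powr (1 / q) * exp (- (2 * pi))"
  have b: "b > 0" by (simp add: b_def)
  define K where "K = C * (1 / p) powr (1 / p) / b"
  have K: "K \<ge> 0" using C b by (simp add: K_def)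
  \<comment> \<open>Since \<open>\<kappa> < 0\<close>, this gives \<open>\<delta> \<le> 1\<close>
    and \<open>\<delta> powr \<kappa> = K + 1\<close>, one more than \<open>main\<close>
    allows.\<close>
  define \<delta> where "\<delta> = (K + 1) powr (1 / \<kappa>)"
  have "\<delta> \<le> (K + 1) powr 0" unfolding \<delta>_def using K \<kappa> by (intro powr_mono) (auto simp: divide_nonpos_neg)
  then have "0 < \<delta>" "\<delta> \<le> 1" using K by (auto simp: \<delta>_def)
  from main[OF this] have "b * \<delta> powr \<kappa> \<le> b * K" using b by (simp add: b_def K_def)
  moreover have "\<delta> powr \<kappa> = K + 1" using K \<kappa> by (simp add: \<delta>_def powr_powr)
  ultimately show False using b by simp
qed

subsection \<open>Necessity: the fourth moment of the circle transform\<close>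

definition circle_transform :: "real \<times> real \<Rightarrow> complex" where
  "circle_transform x = (LINT t|unit_interval. wave x (circ t))"

lemma lborel_integral_unit_interval:
  fixes f :: "real \<Rightarrow> 'b::{banach, second_countable_topology}"
  shows "(LINT t|unit_interval. f t) = (LINT t|lborel. indicator {0..<1} t *\<^sub>R f t)"
  by (rule integral_restrict_space) simp

lemma indicator_scaleR_eq_mult: "indicator A t *\<^sub>R (z :: complex) = indicator A t * z"
  by (simp add: indicator_def)

lemma circle_transform_eq_extension: "circle_transform = extension (indicator {0..<1})"
  unfolding circle_transform_def extension_def lborel_integral_unit_interval indicator_scaleR_eq_mult ..

lemma norm_circle_transform_le: "norm (circle_transform x) \<le> 1"
proof -
  interpret U: prob_space unit_interval by (rule prob_space_unit_interval)
  have "norm (circle_transform x) \<le> (LINT t|unit_interval. norm (wave x (circ t)))"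
    unfolding circle_transform_def by (rule integral_norm_bound)
  then show ?thesis using U.prob_space by simp
qed

lemma continuous_circ: "continuous_on UNIV circ"
  unfolding circ_def by (intro continuous_intros)

text \<open>Differentiating under the integral multiplies \<open>h\<close> by
  \<open>- 2 * pi * \<i> * (v \<bullet> circ t)\<close>, which is again a continuous density; the
  induction is therefore over all \<open>h\<close>. The derivative is handled as a bounded linear
  map because that is the form in which the Leibniz rule integrates it.\<close>

lemma C_k_parameter_integral:
  fixes h :: "real \<Rightarrow> complex"
  assumes "continuous_on {0..1} h"
  shows "C_k k (\<lambda>x. integral {0..1} (\<lambda>t. h t * wave x (circ t)))"
  using assms
proof (induction k arbitrary: h)
  case (0 h)
  have "continuous_on UNIV (\<lambda>x. integral (cbox 0 1) (\<lambda>t. h t * wave x (circ t)))"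
  proof (rule integral_continuous_on_param)
    show "continuous_on (UNIV \<times> cbox 0 1) (\<lambda>(x, t). h t * wave x (circ t))"
      unfolding case_prod_beta
      by (intro continuous_intros continuous_on_compose2[OF continuous_circ] continuous_on_compose2[OF 0[folded cbox_interval]]) auto
  qed
  then show ?case by simp
next
  case (Suc k h)
  define D where "D x t = (\<lambda>v. h t * (of_real (- 2 * pi * (v \<bullet> circ t)) * (\<i> * wave x (circ t))))" for x t
  have bl: "bounded_linear (D x t)" for x t
    unfolding D_def
    by (intro bounded_linear_const_mult bounded_linear_mult_const bounded_linear_compose[OF bounded_linear_of_real]
        bounded_linear_inner_left)
  define Df where "Df x t = Blinfun (D x t)" for x t
  have Df: "blinfun_apply (Df x t) = D x t" for x t
    unfolding Df_def by (rule bounded_linear_Blinfun_apply[OF bl])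
  have cont: "continuous_on (UNIV \<times> cbox 0 1) (\<lambda>(x, t). Df x t)"
  proof (rule continuous_on_blinfun_componentwise)
    fix v :: "real \<times> real"
    show "continuous_on (UNIV \<times> cbox 0 1) (\<lambda>y. blinfun_apply (case y of (x, t) \<Rightarrow> Df x t) v)"
      unfolding case_prod_beta Df D_def
      by (intro continuous_intros continuous_on_compose2[OF continuous_circ] continuous_on_compose2[OF Suc.prems[folded cbox_interval]]) auto
  qed
  have intD: "Df x integrable_on cbox 0 1" for x
    by (rule integrable_continuous) (rule continuous_on_compose2[OF cont, of _ "\<lambda>t. (x, t)", simplified], auto intro!: continuous_intros)
  have deriv: "((\<lambda>x. integral (cbox 0 1) (\<lambda>t. h t * wave x (circ t))) has_derivative blinfun_apply (integral (cbox 0 1) (Df x))) (at x)" for x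
  proof -
    have "((\<lambda>x. integral (cbox 0 1) (\<lambda>t. h t * wave x (circ t))) has_derivative integral (cbox 0 1) (Df x)) (at x within UNIV)"
    proof (rule leibniz_rule)
      fix x :: "real \<times> real" and t :: real
      have "((\<lambda>x. h t * wave x (circ t)) has_derivative D x t) (at x)"
      proof -
        define L where "L v = \<i> * complex_of_real (- 2 * pi * (v \<bullet> circ t))" for v
        have "bounded_linear L"
          unfolding L_def by (intro bounded_linear_const_mult bounded_linear_compose[OF bounded_linear_of_real] bounded_linear_inner_left)
        then have "(L has_derivative L) (at x)"
          by (rule bounded_linear_imp_has_derivative)
        from has_derivative_mult_right[OF has_derivative_compose[OF this DERIV_exp[unfolded has_field_derivative_def]], of "h t"]
        have "((\<lambda>x. h t * exp (L x)) has_derivative (\<lambda>v. h t * (exp (L x) * L v))) (at x)"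
          by simp
        moreover have "exp (L y) = wave y (circ t)" for y
          by (simp only: L_def cis_conv_exp)
        ultimately show ?thesis
          unfolding D_def by (simp add: L_def mult_ac)
      qed
      then show "((\<lambda>x. h t * wave x (circ t)) has_derivative blinfun_apply (Df x t)) (at x within UNIV)"
        by (simp add: Df)
    next
      fix x :: "real \<times> real"
      show "(\<lambda>t. h t * wave x (circ t)) integrable_on cbox 0 1"
        by (intro integrable_continuous continuous_intros continuous_on_compose2[OF continuous_circ] Suc.prems[folded cbox_interval]) auto
    qed (use cont in auto)
    then show ?thesis by simp
  qed
  show ?case
    unfolding cbox_interval[symmetric]
  proof (rule C_k_SucI[OF deriv])
    fix v :: "real \<times> real"
    define h' where "h' t = h t * (of_real (- 2 * pi * (v \<bullet> circ t)) * \<i>)" for t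
    have "blinfun_apply (integral (cbox 0 1) (Df x)) v = integral (cbox 0 1) (\<lambda>t. h' t * wave x (circ t))" for x
      unfolding blinfun_apply_integral[OF intD] Df D_def h'_def by (simp only: mult_ac)
    moreover have "C_k k (\<lambda>x. integral {0..1} (\<lambda>t. h' t * wave x (circ t)))"
      unfolding h'_def
      by (intro Suc.IH continuous_intros continuous_on_subset[OF continuous_circ] Suc.prems) auto
    ultimately show "C_k k (\<lambda>x. blinfun_apply (integral (cbox 0 1) (Df x)) v)"
      by simp
  qed
qed

lemma C_k_circle_transform: "C_k k circle_transform"
proof -
  have "circle_transform x = integral {0..1} (\<lambda>t. 1 * wave x (circ t))" for x
  proof -
    have c: "continuous_on {0..1} (\<lambda>t. wave x (circ t))"
      by (intro continuous_intros continuous_on_subset[OF continuous_circ]) auto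
    have "integral {0..1} (\<lambda>t. wave x (circ t)) = (LINT t:{0..1}|lborel. wave x (circ t))"
      by (intro set_borel_integral_eq_integral(2)[symmetric] borel_integrable_atLeastAtMost' c)
    also have "\<dots> = (LINT t|lborel. indicator {0..<1} t *\<^sub>R wave x (circ t))"
      unfolding set_lebesgue_integral_def
    proof (rule integral_cong_AE)
      show "AE t in lborel. indicator {0..1} t *\<^sub>R wave x (circ t) = indicator {0..<1} t *\<^sub>R wave x (circ t)"
        using AE_lborel_singleton[of "1::real"] by eventually_elim (auto simp: indicator_def)
    qed measurable
    finally show ?thesis by (simp add: circle_transform_def lborel_integral_unit_interval)
  qed
  then have "circle_transform = (\<lambda>x. integral {0..1} (\<lambda>t. 1 * wave x (circ t)))" by blast
  then show ?thesis
    using C_k_parameter_integral[of "\<lambda>_. 1" k] by (simp add: continuous_on_const)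
qed

lemma circle_transform_measurable [measurable]: "circle_transform \<in> borel_measurable borel"
  by (intro borel_measurable_continuous_onI C_k_imp_continuous[OF C_k_circle_transform[of 0]])

lemma (in prob_space) expectation_le_powr_mean:
  fixes u :: "'a \<Rightarrow> real"
  assumes [measurable]: "u \<in> borel_measurable M" and u: "\<And>x. 0 \<le> u x" "\<And>x. u x \<le> B" and q: "1 \<le> q"
  shows "(LINT x|M. u x) \<le> (LINT x|M. u x powr q) powr (1 / q)"
proof (cases "q = 1")
  case True
  then show ?thesis using u by (simp add: integral_nonneg_AE)
next
  case False
  then have q1: "q > 1" using q by simp
  have int: "integrable M u" "integrable M (\<lambda>x. u x powr q)"
    using u q by (intro integrable_const_bound[of _ B] integrable_const_bound[of _ "B powr q"]; auto intro!: powr_mono2)+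
  define V where "V = (LINT x|M. u x powr q)"
  have V: "V \<ge> 0" by (simp add: V_def integral_nonneg_AE)
  have "ennreal (LINT x|M. u x) = (\<integral>\<^sup>+x. ennreal (u x * 1) \<partial>M)"
    using int u by (simp add: nn_integral_eq_integral)
  also have "\<dots> \<le> ennreal (V powr (1 / q) * 1 powr (1 / (q / (q - 1))))"
  proof (rule nn_integral_holder[where p=q and q="q / (q - 1)"])
    show "(\<integral>\<^sup>+x. ennreal (u x powr q) \<partial>M) \<le> ennreal V"
      using int by (simp add: V_def nn_integral_eq_integral)
  qed (use u q1 V in \<open>auto simp: field_simps emeasure_space_1\<close>)
  finally show ?thesis by (simp add: V_def)
qed

definition fourth_moment :: "real \<Rightarrow> real" where
  "fourth_moment \<epsilon> = (LINT x|lborel. gauss \<epsilon> x * norm (circle_transform x) ^ 4)"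

lemma fourth_moment_integrable:
  assumes "\<epsilon> > 0"
  shows "integrable lborel (\<lambda>x. gauss \<epsilon> x * norm (circle_transform x) ^ 4)"
proof (rule Bochner_Integration.integrable_bound[OF gauss_integrable[OF assms]])
  have "norm (circle_transform x) ^ 4 \<le> 1" for x
    using norm_circle_transform_le[of x] by (intro power_le_one) auto
  then show "AE x in lborel. norm (gauss \<epsilon> x * norm (circle_transform x) ^ 4) \<le> norm (gauss \<epsilon> x)"
    using gauss_pos[of \<epsilon>] by (intro AE_I2) (simp add: abs_mult mult_left_le)
qed measurable

text \<open>Testing the circle inequality on a truncation of \<open>\<bar>\<sigma>\<bar>\<^sup>2 cnj \<sigma>\<close>, \<open>\<sigma>\<close> being the
  Fourier transform of the circle measure, bounds \<open>\<parallel>\<sigma>\<parallel>\<^sub>4\<close>.\<close>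

lemma fourth_moment_bounded:
  fixes p q C :: real
  assumes p: "4 / 3 \<le> p" and q: "1 \<le> q"
    and ineq: "circle_inequality p q C"
    and C: "C > 0" and \<epsilon>: "\<epsilon> > 0"
  shows "fourth_moment \<epsilon> \<le> C powr (p / (p - 1))"
proof -
  interpret U: prob_space unit_interval by (rule prob_space_unit_interval)
  define \<sigma> where "\<sigma> = circle_transform"
  have \<sigma>1: "norm (\<sigma> x) \<le> 1" for x unfolding \<sigma>_def by (rule norm_circle_transform_le)
  have \<sigma>C: "C_k k \<sigma>" for k unfolding \<sigma>_def by (rule C_k_circle_transform)
  have [measurable]: "\<sigma> \<in> borel_measurable borel" unfolding \<sigma>_def by measurable
  \<comment> \<open>Apart from the weight this is the extremal function in the duality between
    \<open>L^4\<close> and \<open>L^(4/3)\<close>: paired with \<open>\<sigma>\<close> it gives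
    \<open>norm (\<sigma> x) ^ 4\<close>.\<close>
  define F where "F x = complex_of_real (gauss \<epsilon> x) * (cnj (\<sigma> x) * cnj (\<sigma> x) * \<sigma> x)" for x
  have [measurable]: "F \<in> borel_measurable borel" unfolding F_def by measurable
  have smooth: "smooth F"
    unfolding F_def smooth_def by (intro allI C_k_mult C_k_gauss C_k_linear_comp[OF bounded_linear_cnj] \<sigma>C)
  have Fn: "norm (F x) = gauss \<epsilon> x * norm (\<sigma> x) ^ 3" for x
    using gauss_pos[of \<epsilon> x] by (simp add: F_def norm_mult power3_eq_cube)
  have bound: "norm (F x) \<le> 1 * gauss \<epsilon> x" for x
    unfolding Fn using \<sigma>1[of x] gauss_pos[of \<epsilon> x] by (simp add: mult_left_le power_le_one)
  have F_int: "integrable lborel F"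
    by (rule Bochner_Integration.integrable_bound[OF gauss_integrable[OF \<epsilon>]])
       (use bound in \<open>auto intro!: AE_I2 order_trans[OF _ abs_ge_self]\<close>)
  define I where "I = fourth_moment \<epsilon>"
  have I0: "I \<ge> 0" unfolding I_def fourth_moment_def
    by (intro integral_nonneg_AE AE_I2) (simp add: gauss_pos less_imp_le)
  \<comment> \<open>The average of \<open>fourier F\<close> over the circle is the pairing of
    \<open>F\<close> with the circle transform, by duality with the constant density 1.\<close>
  have dual: "(LINT t|unit_interval. fourier F (circ t)) = of_real I"
  proof -
    have "(LINT t|unit_interval. fourier F (circ t)) = (LINT t|lborel. indicator {0..<1} t * fourier F (circ t))"
      unfolding lborel_integral_unit_interval indicator_scaleR_eq_mult ..
    also have "\<dots> = (LINT x|lborel. F x * extension (indicator {0..<1}) x)"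
    proof (rule extension_duality[OF F_int])
      show "integrable lborel (indicator {0..<1} :: real \<Rightarrow> complex)"
        by (rule Bochner_Integration.integrable_bound[of _ "indicator {0..<1} :: real \<Rightarrow> real"])
           (auto simp: integrable_indicator_iff indicator_def)
    qed
    also have "\<dots> = (LINT x|lborel. complex_of_real (gauss \<epsilon> x * norm (\<sigma> x) ^ 4))"
    proof (rule Bochner_Integration.integral_cong)
      fix x
      have "complex_of_real (norm (\<sigma> x) ^ 4) = (\<sigma> x * cnj (\<sigma> x)) * (\<sigma> x * cnj (\<sigma> x))"
        by (simp only: complex_norm_square[symmetric] of_real_mult[symmetric]) (simp add: power2_eq_square power4_eq_xxxx)
      then show "F x * extension (indicator {0..<1}) x = complex_of_real (gauss \<epsilon> x * norm (\<sigma> x) ^ 4)"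
        unfolding circle_transform_eq_extension[symmetric] \<sigma>_def[symmetric] F_def by (simp only: of_real_mult mult_ac)
    qed simp
    also have "\<dots> = of_real I"
      unfolding I_def fourth_moment_def \<sigma>_def by (rule integral_complex_of_real)
    finally show ?thesis .
  qed
  have um: "(\<lambda>t. norm (fourier F (circ t))) \<in> borel_measurable unit_interval"
    by (rule measurable_unit_interval) measurable
  have "I \<le> (LINT t|unit_interval. norm (fourier F (circ t)))"
    using integral_norm_bound[of unit_interval "\<lambda>t. fourier F (circ t)"] I0 unfolding dual by simp
  also have "\<dots> \<le> (LINT t|unit_interval. norm (fourier F (circ t)) powr q) powr (1 / q)"
    by (rule U.expectation_le_powr_mean[OF um _ _ q, of "LINT x|lborel. norm (F x)"]) (auto intro: norm_fourier_le)
  also have "\<dots> \<le> C * (LINT x|lborel. norm (F x) powr p) powr (1 / p)"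
    using ineq smooth \<epsilon> bound unfolding circle_inequality_def by blast
  also have "\<dots> \<le> C * I powr (1 / p)"
  proof -
    \<comment> \<open>Here \<open>p \<ge> 4 / 3\<close> enters: the exponent \<open>3 * p\<close> of
      \<open>norm (\<sigma> x) \<le> 1\<close> is at least 4, and \<open>p \<ge> 1\<close> handles
      the weight. The norm of \<open>F\<close> is thereby bounded by the same moment
      \<open>I\<close>.\<close>
    have "norm (F x) powr p \<le> gauss \<epsilon> x * norm (\<sigma> x) ^ 4" for x
    proof (cases "\<sigma> x = 0")
      case False
      define s where "s = norm (\<sigma> x)"
      have s: "0 < s" "s \<le> 1" using False \<sigma>1[of x] by (auto simp: s_def)
      have g: "0 < gauss \<epsilon> x" "gauss \<epsilon> x \<le> 1"
        using gauss_pos[of \<epsilon> x] \<epsilon> by (auto simp: gauss_def)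
      have "norm (F x) powr p = gauss \<epsilon> x powr p * s powr (3 * p)"
        using s g by (simp add: Fn s_def[symmetric] powr_mult powr_powr flip: powr_numeral)
      also have "\<dots> \<le> gauss \<epsilon> x powr 1 * s powr 4"
        using p s g by (intro mult_mono powr_mono') auto
      also have "\<dots> = gauss \<epsilon> x * s ^ 4"
        using s g by simp
      finally show ?thesis by (simp add: s_def)
    qed (simp add: Fn)
    then have "(LINT x|lborel. norm (F x) powr p) \<le> I"
      unfolding I_def fourth_moment_def \<sigma>_def[symmetric] using fourth_moment_integrable[OF \<epsilon>]
      by (intro integral_mono') (auto simp: \<sigma>_def gauss_pos less_imp_le)
    then show ?thesis
      using C p by (intro mult_left_mono powr_mono2) (auto intro!: integral_nonneg_AE)
  qed
  \<comment> \<open>As \<open>p > 1\<close>, the power \<open>I powr (1 / p)\<close> is absorbed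
    into the left side, which leaves a bound free of \<open>\<epsilon>\<close>.\<close>
  finally have main: "I \<le> C * I powr (1 / p)" .
  show ?thesis
  proof (cases "I = 0")
    case False
    then have I: "I > 0" using I0 by simp
    have "I powr (1 - 1 / p) = I / I powr (1 / p)" using I by (simp add: powr_diff)
    also have "\<dots> \<le> C" using main I by (simp add: pos_divide_le_eq)
    finally have "(I powr (1 - 1 / p)) powr (p / (p - 1)) \<le> C powr (p / (p - 1))"
      using p by (intro powr_mono2) auto
    moreover have "(1 - 1 / p) * (p / (p - 1)) = 1" using p by (simp add: field_simps)
    ultimately have "I powr 1 \<le> C powr (p / (p - 1))" by (simp only: powr_powr)
    then show ?thesis using I by (simp add: I_def)
  qed (simp add: I_def)
qed

section \<open>Logarithmic divergence of the fourth moment\<close>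

lemma unit_square_shear:
  fixes k :: "real \<times> real \<Rightarrow> ennreal"
  assumes [measurable]: "k \<in> borel_measurable (borel \<Otimes>\<^sub>M borel)"
  shows "(\<integral>\<^sup>+z. k z \<partial>(unit_interval \<Otimes>\<^sub>M unit_interval))
     = (\<integral>\<^sup>+d. \<integral>\<^sup>+w. k (w + d, w) * indicator {0..<1} (w + d) * indicator {0..<1} w \<partial>lborel \<partial>lborel)"
proof -
  interpret U: prob_space unit_interval by (rule prob_space_unit_interval)
  interpret UU: pair_sigma_finite unit_interval unit_interval ..
  have "(\<lambda>z. (fst z, snd z)) \<in> measurable (unit_interval \<Otimes>\<^sub>M unit_interval) (borel \<Otimes>\<^sub>M borel)"
    by (intro measurable_Pair measurable_compose[OF measurable_fst, of "\<lambda>x. x"] measurable_compose[OF measurable_snd, of "\<lambda>x. x"]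
        measurable_unit_interval) auto
  from measurable_compose[OF this assms] have "k \<in> borel_measurable (unit_interval \<Otimes>\<^sub>M unit_interval)" by simp
  then have "(\<integral>\<^sup>+z. k z \<partial>(unit_interval \<Otimes>\<^sub>M unit_interval)) = (\<integral>\<^sup>+t. \<integral>\<^sup>+s. k (s, t) \<partial>unit_interval \<partial>unit_interval)"
    by (rule UU.nn_integral_snd[symmetric])
  also have "\<dots> = (\<integral>\<^sup>+w. (\<integral>\<^sup>+s. k (s, w) * indicator {0..<1} s \<partial>lborel) * indicator {0..<1} w \<partial>lborel)"
    by (simp add: nn_integral_restrict_space)
  also have "\<dots> = (\<integral>\<^sup>+w. \<integral>\<^sup>+d. k (w + d, w) * indicator {0..<1} (w + d) * indicator {0..<1} w \<partial>lborel \<partial>lborel)"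
  proof (rule nn_integral_cong)
    fix w :: real
    have "(\<integral>\<^sup>+s. k (s, w) * indicator {0..<1} s \<partial>lborel) = (\<integral>\<^sup>+d. k (w + 1 * d, w) * indicator {0..<1} (w + 1 * d) \<partial>lborel)"
      using nn_integral_real_affine[of "\<lambda>s. k (s, w) * indicator {0..<1} s" 1 w] by simp
    then show "(\<integral>\<^sup>+s. k (s, w) * indicator {0..<1} s \<partial>lborel) * indicator {0..<1} w
        = (\<integral>\<^sup>+d. k (w + d, w) * indicator {0..<1} (w + d) * indicator {0..<1} w \<partial>lborel)"
      by (simp add: nn_integral_multc)
  qed
  also have "\<dots> = (\<integral>\<^sup>+d. \<integral>\<^sup>+w. k (w + d, w) * indicator {0..<1} (w + d) * indicator {0..<1} w \<partial>lborel \<partial>lborel)"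
    by (rule lborel_pair.Fubini') measurable
  finally show ?thesis .
qed

text \<open>The factor \<open>y\<close>, an improvement on the Lipschitz bound for small
  \<open>y\<close>, reflects the vanishing derivative of the cosine at 0. It makes the length of a
  sum insensitive to the difference of two nearby angles.\<close>

lemma abs_cos_diff_le: "\<bar>cos x - cos y\<bar> \<le> \<bar>x - y\<bar> * y" if "0 \<le> x" "x \<le> y" for x y :: real
proof (cases "x = y")
  case False
  then have "x < y" using that by simp
  have "\<exists>z>x. z < y \<and> cos y - cos x = (y - x) * - sin z"
    by (rule MVT2[OF \<open>x < y\<close>]) (auto intro!: derivative_eq_intros)
  then obtain z where z: "x < z" "z < y" "cos y - cos x = (y - x) * - sin z" by blast
  have "\<bar>sin z\<bar> \<le> y" using abs_sin_x_le_abs_x[of z] z that by linarith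
  then have "(y - x) * \<bar>sin z\<bar> \<le> (y - x) * y" using \<open>x < y\<close> by (intro mult_left_mono) auto
  moreover have "\<bar>cos x - cos y\<bar> = (y - x) * \<bar>sin z\<bar>"
    using z(3) \<open>x < y\<close> abs_minus_commute[of "cos x" "cos y"] by (simp add: abs_mult)
  ultimately show ?thesis using \<open>x < y\<close> by simp
qed (use that in auto)

text \<open>Changing the difference of a pair from \<open>d\<close> to \<open>\<tau>\<close> moves
  the length of its sum by about \<open>d * (\<tau> - d)\<close>, so \<open>\<tau>\<close> has the
  freedom \<open>sqrt \<epsilon> / d\<close>; the midpoint has the freedom
  \<open>sqrt \<epsilon>\<close>. The sum then moves by a multiple of \<open>sqrt \<epsilon>\<close>
  and the kernel keeps its full size. The condition \<open>sqrt \<epsilon> \<le> d^2\<close> gives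
  \<open>\<tau> \<le> 2 * d\<close>. The number 10000 generously covers \<open>4096 + 256\<close>,
  which come from \<open>pi < 4\<close>.\<close>

lemma kern_lower_bound:
  assumes e: "\<epsilon> > 0" and d: "0 < d" "sqrt \<epsilon> \<le> d\<^sup>2" and \<tau>: "d \<le> \<tau>" "\<tau> \<le> d + sqrt \<epsilon> / d"
    and w: "t + d / 2 - \<tau> / 2 \<le> w" "w \<le> t + d / 2 - \<tau> / 2 + sqrt \<epsilon>"
  shows "exp (- (pi * 10000)) / \<epsilon> \<le> kern \<epsilon> (circ (t + d) + circ t - (circ (w + \<tau>) + circ w))"
proof -
  define r where "r = 2 * cos (pi * d)"
  define m where "m = t + d / 2"
  define v where "v = (r * cos (2 * pi * m), r * sin (2 * pi * m))"
  \<comment> \<open>The distance formula evaluated at this pair gives 0 and so identifies the polar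
    form of its sum.\<close>
  have v: "v = circ (t + d) + circ t"
  proof -
    have "(norm (v - circ (t + d) - circ t))\<^sup>2 = 0"
      unfolding circ_sum_dist[OF v_def] by (simp add: r_def m_def field_simps)
    then show ?thesis by (simp add: algebra_simps)
  qed
  define \<rho> where "\<rho> = 2 * cos (pi * \<tau>)"
  define u where "u = (w + \<tau> + w) / 2 - m"
  have u: "0 \<le> u" "u \<le> sqrt \<epsilon>" using w by (auto simp: u_def m_def field_simps)
  have N: "(norm (v - circ (w + \<tau>) - circ w))\<^sup>2 = (r - \<rho>)\<^sup>2 + 2 * r * \<rho> * (1 - cos (2 * pi * u))"
    unfolding circ_sum_dist[OF v_def] by (simp add: \<rho>_def u_def)
  have "sqrt \<epsilon> / d \<le> d" using d by (simp add: pos_divide_le_eq power2_eq_square)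
  then have \<tau>2: "\<tau> \<le> 2 * d" using \<tau> by simp
  have "\<bar>r - \<rho>\<bar> \<le> 2 * (\<bar>pi * d - pi * \<tau>\<bar> * (pi * \<tau>))"
    using abs_cos_diff_le[of "pi * d" "pi * \<tau>"] d \<tau> by (simp add: r_def \<rho>_def)
  also have "\<dots> = 2 * (pi * pi) * ((\<tau> - d) * \<tau>)"
  proof -
    have "\<bar>pi * d - pi * \<tau>\<bar> = pi * (\<tau> - d)" using \<tau> by (simp add: abs_mult flip: right_diff_distrib)
    then show ?thesis by simp
  qed
  also have "\<dots> \<le> 2 * (pi * pi) * ((sqrt \<epsilon> / d) * (2 * d))"
    using \<tau> \<tau>2 d by (intro mult_left_mono mult_mono) auto
  also have "\<dots> = 4 * (pi * pi) * sqrt \<epsilon>" using d by simp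
  also have "\<dots> \<le> 4 * 16 * sqrt \<epsilon>"
  proof -
    have "pi * pi \<le> 4 * 4" using pi_less_4 by (intro mult_mono) auto
    then show ?thesis using e by (intro mult_right_mono) auto
  qed
  finally have "(r - \<rho>)\<^sup>2 \<le> (64 * sqrt \<epsilon>)\<^sup>2"
    by (intro power2_le_iff_abs_le[THEN iffD2]) (use e in auto)
  then have 1: "(r - \<rho>)\<^sup>2 \<le> 4096 * \<epsilon>" using e by (simp add: power_mult_distrib)
  have "1 - cos (2 * pi * u) = 2 * (sin (pi * u))\<^sup>2"
    using cos_double_sin[of "pi * u"] by (simp add: mult.assoc)
  also have "\<dots> \<le> 2 * (4 * sqrt \<epsilon>)\<^sup>2"
  proof -
    have "\<bar>sin (pi * u)\<bar> \<le> pi * u" using abs_sin_x_le_abs_x[of "pi * u"] u by simp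
    also have "\<dots> \<le> 4 * sqrt \<epsilon>" using u pi_less_4 e by (intro mult_mono) auto
    finally show ?thesis by (intro mult_left_mono power2_le_iff_abs_le[THEN iffD2]) (use e in auto)
  qed
  also have "\<dots> = 32 * \<epsilon>" using e by (simp add: power_mult_distrib)
  finally have c: "1 - cos (2 * pi * u) \<le> 32 * \<epsilon>" .
  have "r * \<rho> \<le> \<bar>r\<bar> * \<bar>\<rho>\<bar>" using abs_ge_self[of "r * \<rho>"] by (simp add: abs_mult)
  also have "\<dots> \<le> 2 * 2"
    unfolding r_def \<rho>_def by (intro mult_mono) (auto simp: abs_mult)
  finally have "r * \<rho> * (1 - cos (2 * pi * u)) \<le> 4 * (1 - cos (2 * pi * u))"
    by (intro mult_right_mono) auto
  also have "\<dots> \<le> 4 * (32 * \<epsilon>)" using c by (intro mult_left_mono) auto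
  finally have "2 * (r * \<rho> * (1 - cos (2 * pi * u))) \<le> 2 * (4 * (32 * \<epsilon>))"
    by (intro mult_left_mono) auto
  moreover have "2 * r * \<rho> * (1 - cos (2 * pi * u)) = 2 * (r * \<rho> * (1 - cos (2 * pi * u)))"
    by (simp only: mult.assoc)
  ultimately have 2: "2 * r * \<rho> * (1 - cos (2 * pi * u)) \<le> 256 * \<epsilon>" by linarith
  have "(norm (v - circ (w + \<tau>) - circ w))\<^sup>2 \<le> 4096 * \<epsilon> + 256 * \<epsilon>"
    unfolding N using 1 2 by (rule add_mono)
  also have "\<dots> \<le> 10000 * \<epsilon>" using e by simp
  finally have "(norm (v - circ (w + \<tau>) - circ w))\<^sup>2 / \<epsilon> \<le> 10000"
    using e by (simp add: pos_divide_le_eq)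
  then have "pi * ((norm (v - circ (w + \<tau>) - circ w))\<^sup>2 / \<epsilon>) \<le> pi * 10000"
    by (intro mult_left_mono) auto
  then have "exp (- (pi * 10000)) / \<epsilon> \<le> kern \<epsilon> (v - circ (w + \<tau>) - circ w)"
    unfolding kern_def using e by (intro divide_right_mono) auto
  then show ?thesis unfolding v by (simp add: diff_diff_eq)
qed

lemma inner_lower_bound:
  assumes e: "0 < \<epsilon>" and d: "0 < d" "d \<le> 1 / 8" "sqrt \<epsilon> \<le> d\<^sup>2" and t: "1 / 4 \<le> t" "t \<le> 1 / 2"
  shows "ennreal (exp (- (pi * 10000)) / d)
     \<le> (\<integral>\<^sup>+z. ennreal (kern \<epsilon> (circ (t + d) + circ t - (circ (fst z) + circ (snd z)))) \<partial>(unit_interval \<Otimes>\<^sub>M unit_interval))"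
proof -
  define k where "k z = ennreal (kern \<epsilon> (circ (t + d) + circ t - (circ (fst z) + circ (snd z))))" for z
  have k[measurable]: "k \<in> borel_measurable (borel \<Otimes>\<^sub>M borel)" unfolding k_def by measurable
  define c where "c = exp (- (pi * 10000)) / \<epsilon>"
  have c: "c > 0" using e by (simp add: c_def)
  have dd: "d * d \<le> 1 / 8 * (1 / 8)" using d by (intro mult_mono) auto
  then have se: "sqrt \<epsilon> \<le> 1 / 64" "sqrt \<epsilon> / d \<le> d"
    using d by (auto simp: power2_eq_square pos_divide_le_eq)
  have "ennreal (exp (- (pi * 10000)) / d) = ennreal c * (ennreal (sqrt \<epsilon>) * ennreal (sqrt \<epsilon> / d))"
    using e d c by (simp add: c_def ennreal_mult[symmetric] real_sqrt_mult_self)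
  also have "\<dots> = (\<integral>\<^sup>+\<tau>. ennreal c * ennreal (sqrt \<epsilon>) * indicator {d..d + sqrt \<epsilon> / d} \<tau> \<partial>lborel)"
    using d e by (subst nn_integral_cmult_indicator) (auto simp: mult.assoc)
  also have "\<dots> \<le> (\<integral>\<^sup>+\<tau>. \<integral>\<^sup>+w. k (w + \<tau>, w) * indicator {0..<1} (w + \<tau>) * indicator {0..<1} w \<partial>lborel \<partial>lborel)"
  proof (rule nn_integral_mono)
    fix \<tau> :: real
    show "ennreal c * ennreal (sqrt \<epsilon>) * indicator {d..d + sqrt \<epsilon> / d} \<tau>
      \<le> (\<integral>\<^sup>+w. k (w + \<tau>, w) * indicator {0..<1} (w + \<tau>) * indicator {0..<1} w \<partial>lborel)"
    proof (cases "\<tau> \<in> {d..d + sqrt \<epsilon> / d}")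
      case True
      define W where "W = {t + d / 2 - \<tau> / 2..t + d / 2 - \<tau> / 2 + sqrt \<epsilon>}"
      have "ennreal c * ennreal (sqrt \<epsilon>) = (\<integral>\<^sup>+w. ennreal c * indicator W w \<partial>lborel)"
        using e by (subst nn_integral_cmult_indicator) (auto simp: W_def)
      also have "\<dots> \<le> (\<integral>\<^sup>+w. k (w + \<tau>, w) * indicator {0..<1} (w + \<tau>) * indicator {0..<1} w \<partial>lborel)"
      proof (rule nn_integral_mono)
        fix w :: real
        show "ennreal c * indicator W w \<le> k (w + \<tau>, w) * indicator {0..<1} (w + \<tau>) * indicator {0..<1} w"
        proof (cases "w \<in> W")
          case w: True
          have \<tau>d: "d \<le> \<tau>" "\<tau> \<le> d + sqrt \<epsilon> / d" using True by auto
          have wb: "t + d / 2 - \<tau> / 2 \<le> w" "w \<le> t + d / 2 - \<tau> / 2 + sqrt \<epsilon>" using w by (auto simp: W_def)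
          have "\<tau> \<le> 1 / 4" using \<tau>d se d by simp
          then have "w \<in> {0..<1}" "w + \<tau> \<in> {0..<1}"
            using wb \<tau>d d t se by auto
          moreover have "ennreal c \<le> k (w + \<tau>, w)"
            unfolding k_def c_def fst_conv snd_conv
            by (intro ennreal_leI kern_lower_bound e d \<tau>d wb)
          ultimately show ?thesis by (simp add: w)
        qed simp
      qed
      finally show ?thesis using True by simp
    qed simp
  qed
  also have "\<dots> = (\<integral>\<^sup>+z. k z \<partial>(unit_interval \<Otimes>\<^sub>M unit_interval))"
    by (rule unit_square_shear[OF k, symmetric])
  finally show ?thesis by (simp add: k_def)
qed

text \<open>The square of the circle transform is the transform of the unit square under the sum
  map, so the fourth moment is a weighted second moment, which \<open>H_gauss_integral_real\<close>
  evaluates.\<close>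

lemma fourth_moment_eq:
  assumes e: "\<epsilon> > 0"
  shows "ennreal (fourth_moment \<epsilon>) = (\<integral>\<^sup>+a. \<integral>\<^sup>+b. ennreal (kern \<epsilon> ((circ (fst a) + circ (snd a)) - (circ (fst b) + circ (snd b))))
      \<partial>(unit_interval \<Otimes>\<^sub>M unit_interval) \<partial>(unit_interval \<Otimes>\<^sub>M unit_interval))"
proof -
  define Q where "Q = unit_interval \<Otimes>\<^sub>M unit_interval"
  interpret U: prob_space unit_interval by (rule prob_space_unit_interval)
  interpret UU: pair_sigma_finite unit_interval unit_interval ..
  interpret Q: prob_space Q unfolding Q_def by (rule prob_space_unit_square)
  define \<Phi> where "\<Phi> z = circ (fst z) + circ (snd z)" for z
  have [measurable]: "\<Phi> \<in> borel_measurable Q"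
  proof -
    have "circ \<in> borel_measurable unit_interval" by (rule measurable_unit_interval) measurable
    then show ?thesis unfolding \<Phi>_def Q_def by measurable
  qed
  have "finite_extension_axioms Q \<Phi> (\<lambda>_. 1) 1" by standard simp_all
  then interpret finite_extension Q \<Phi> "\<lambda>_. 1" 1
    by (rule finite_extension.intro[OF Q.finite_measure_axioms])
  interpret QQ: pair_prob_space Q Q ..
  have H: "H x = circle_transform x * circle_transform x" for x
  proof -
    define c where "c t = wave x (circ t)" for t
    have cm: "c \<in> borel_measurable unit_interval" unfolding c_def by (rule measurable_unit_interval) measurable
    have "integrable (unit_interval \<Otimes>\<^sub>M unit_interval) (\<lambda>(s, t). c s * c t)"
    proof -
      have "(\<lambda>(s, t). c s * c t) \<in> borel_measurable Q" unfolding Q_def using cm by measurable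
      then have "integrable Q (\<lambda>(s, t). c s * c t)"
        by (rule Q.integrable_const_bound[of _ 1, rotated]) (auto simp: c_def norm_mult)
      then show ?thesis by (simp add: Q_def)
    qed
    from UU.integral_fst'[OF this] have "(LINT z|Q. c (fst z) * c (snd z)) = circle_transform x * circle_transform x"
      by (simp add: Q_def case_prod_beta' circle_transform_def c_def)
    moreover have "wave x (\<Phi> z) = c (fst z) * c (snd z)" for z
      by (simp only: c_def \<Phi>_def wave_add)
    ultimately show ?thesis unfolding H_def by (simp only: mult_1)
  qed
  define k where "k z = kern \<epsilon> (\<Phi> (fst z) - \<Phi> (snd z))" for z
  have [measurable]: "k \<in> borel_measurable (Q \<Otimes>\<^sub>M Q)" unfolding k_def by measurable
  have k0: "k z \<ge> 0" for z unfolding k_def by (rule kern_nonneg[OF e])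
  have k_int: "integrable (Q \<Otimes>\<^sub>M Q) k"
    using e by (intro QQ.P.integrable_const_bound[of _ "1 / \<epsilon>"] AE_I2) (auto simp: k_def kern_def divide_right_mono)
  have "fourth_moment \<epsilon> = (LINT x|lborel. gauss \<epsilon> x * (norm (H x))\<^sup>2)"
    unfolding fourth_moment_def H by (intro Bochner_Integration.integral_cong) (simp_all add: norm_mult power2_eq_square power4_eq_xxxx mult.assoc)
  also have "\<dots> = Re (LINT z|(Q \<Otimes>\<^sub>M Q). of_real (k z))"
    unfolding H_gauss_integral_real[OF e] k_def by simp
  also have "\<dots> = (LINT z|(Q \<Otimes>\<^sub>M Q). k z)"
    by (simp only: integral_complex_of_real Re_complex_of_real)
  finally have "ennreal (fourth_moment \<epsilon>) = (\<integral>\<^sup>+z. ennreal (k z) \<partial>(Q \<Otimes>\<^sub>M Q))"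
    using k0 by (simp add: nn_integral_eq_integral[OF k_int])
  also have "\<dots> = (\<integral>\<^sup>+a. \<integral>\<^sup>+b. ennreal (k (a, b)) \<partial>Q \<partial>Q)"
    by (rule Q.nn_integral_fst[symmetric]) measurable
  finally show ?thesis by (simp add: Q_def k_def \<Phi>_def)
qed

text \<open>Integrating the bound \<open>c / d\<close> over \<open>a \<le> d \<le> 1 / 8\<close>
  produces the logarithm. With \<open>\<epsilon> = a ^ 4\<close> the condition
  \<open>sqrt \<epsilon> \<le> d^2\<close> holds on the whole range; the factor \<open>1 / 4\<close>
  is the length of the interval of \<open>t\<close>.\<close>

lemma fourth_moment_lower_bound:
  assumes a: "0 < a" "a < 1 / 8"
  shows "exp (- (pi * 10000)) / 4 * ln (1 / (8 * a)) \<le> fourth_moment (a ^ 4)"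
proof -
  define \<epsilon> where "\<epsilon> = a ^ 4"
  have e: "\<epsilon> > 0" using a by (simp add: \<epsilon>_def)
  have se: "sqrt \<epsilon> = a\<^sup>2" unfolding \<epsilon>_def by (intro real_sqrt_unique) auto
  define W where "W z = (\<integral>\<^sup>+b. ennreal (kern \<epsilon> ((circ (fst z) + circ (snd z)) - (circ (fst b) + circ (snd b)))) \<partial>(unit_interval \<Otimes>\<^sub>M unit_interval))" for z
  have W[measurable]: "W \<in> borel_measurable (borel \<Otimes>\<^sub>M borel)"
  proof -
    interpret Q: prob_space "unit_interval \<Otimes>\<^sub>M unit_interval" by (rule prob_space_unit_square)
    have [measurable]: "circ \<in> borel_measurable unit_interval" by (rule measurable_unit_interval) measurable
    show ?thesis unfolding W_def by measurable
  qed
  define c where "c = exp (- (pi * 10000))"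
  have c: "c > 0" by (simp add: c_def)
  have "ennreal (c / 4 * ln (1 / (8 * a))) = ennreal (1 / 4) * ennreal (c * ln (1 / 8) - c * ln a)"
  proof -
    have "ln (1 / (8 * a)) = ln (1 / 8) - ln a" using a by (simp add: ln_div ln_mult)
    then have "c / 4 * ln (1 / (8 * a)) = 1 / 4 * (c * ln (1 / 8) - c * ln a)" by (simp add: right_diff_distrib)
    then show ?thesis by (subst ennreal_mult'[symmetric]) simp_all
  qed
  also have "ennreal (c * ln (1 / 8) - c * ln a) = (\<integral>\<^sup>+d. ennreal (c / d) * indicator {a..1/8} d \<partial>lborel)"
    using a c by (intro nn_integral_FTC_Icc[symmetric]) (auto intro!: derivative_eq_intros)
  also have "ennreal (1 / 4) * \<dots> = (\<integral>\<^sup>+d. ennreal (c / d) * indicator {a..1/8} d * ennreal (1 / 4) \<partial>lborel)"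
    by (subst nn_integral_multc) (auto simp: mult.commute)
  also have "\<dots> \<le> (\<integral>\<^sup>+d. \<integral>\<^sup>+t. W (t + d, t) * indicator {0..<1} (t + d) * indicator {0..<1} t \<partial>lborel \<partial>lborel)"
  proof (rule nn_integral_mono)
    fix d :: real
    show "ennreal (c / d) * indicator {a..1/8} d * ennreal (1 / 4) \<le> (\<integral>\<^sup>+t. W (t + d, t) * indicator {0..<1} (t + d) * indicator {0..<1} t \<partial>lborel)"
    proof (cases "d \<in> {a..1/8}")
      case True
      have d: "0 < d" "d \<le> 1 / 8" using True a by auto
      have sd: "sqrt \<epsilon> \<le> d\<^sup>2" unfolding se using True a by (intro power_mono) auto
      have "ennreal (c / d) * ennreal (1 / 4) = (\<integral>\<^sup>+t. ennreal (c / d) * indicator {1/4..1/2::real} t \<partial>lborel)"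
        by (subst nn_integral_cmult_indicator) auto
      also have "\<dots> \<le> (\<integral>\<^sup>+t. W (t + d, t) * indicator {0..<1} (t + d) * indicator {0..<1} t \<partial>lborel)"
      proof (rule nn_integral_mono)
        fix t :: real
        show "ennreal (c / d) * indicator {1/4..1/2} t \<le> W (t + d, t) * indicator {0..<1} (t + d) * indicator {0..<1} t"
        proof (cases "t \<in> {1/4..1/2}")
          case t: True
          then have "t \<in> {0..<1}" "t + d \<in> {0..<1}" using d by auto
          moreover have "ennreal (c / d) \<le> W (t + d, t)"
            unfolding W_def c_def fst_conv snd_conv using t by (intro inner_lower_bound e d sd) auto
          ultimately show ?thesis using t by simp
        qed simp
      qed
      finally show ?thesis using True by simp
    qed simp
  qed
  also have "\<dots> = (\<integral>\<^sup>+z. W z \<partial>(unit_interval \<Otimes>\<^sub>M unit_interval))"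
    by (rule unit_square_shear[OF W, symmetric])
  also have "\<dots> = ennreal (fourth_moment \<epsilon>)"
    unfolding W_def by (rule fourth_moment_eq[OF e, symmetric])
  finally have "ennreal (c / 4 * ln (1 / (8 * a))) \<le> ennreal (fourth_moment \<epsilon>)" .
  moreover have "fourth_moment \<epsilon> \<ge> 0"
    unfolding fourth_moment_def by (intro integral_nonneg_AE AE_I2) (simp add: gauss_pos less_imp_le)
  ultimately show ?thesis by (simp add: ennreal_le_iff c_def \<epsilon>_def)
qed

lemma fourth_moment_unbounded: "\<exists>\<epsilon>>0. K < fourth_moment \<epsilon>"
proof -
  define c where "c = exp (- (pi * 10000)) / 4"
  have c: "c > 0" by (simp add: c_def)
  \<comment> \<open>Solves \<open>c * ln (1 / (8 * a)) = \<bar>K\<bar> + 1\<close>; the absolute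
    value keeps \<open>a < 1 / 8\<close> for negative \<open>K\<close> as well.\<close>
  define a where "a = exp (- ((\<bar>K\<bar> + 1) / c)) / 8"
  have "- ((\<bar>K\<bar> + 1) / c) < 0" using c by simp
  then have a: "0 < a" "a < 1 / 8" unfolding a_def by (simp, simp only: exp_less_one_iff divide_strict_right_mono zero_less_numeral)
  have "ln (1 / (8 * a)) = (\<bar>K\<bar> + 1) / c"
    by (simp add: a_def ln_div)
  then have "c * ln (1 / (8 * a)) = \<bar>K\<bar> + 1" using c by simp
  then have "\<bar>K\<bar> + 1 \<le> fourth_moment (a ^ 4)"
    using fourth_moment_lower_bound[OF a] by (simp add: c_def)
  then show ?thesis using a by (intro exI[of _ "a ^ 4"]) auto
qed

theorem theorem1p2:
  fixes p q :: real
  assumes "1 \<le> p" and "1 \<le> q"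
  shows "(\<exists>C>0. \<forall>f \<in> (test_functions :: (real^4 \<Rightarrow> complex) set).
            Lp_norm q torus_measure (fourier f) \<le> C * Lp_norm p lborel f)
         \<longleftrightarrow> (1 \<le> p \<and> p < 4/3 \<and> ereal q \<le> conj_exponent p / 3)"
proof
  assume "\<exists>C>0. \<forall>f \<in> (test_functions :: (real^4 \<Rightarrow> complex) set).
            Lp_norm q torus_measure (fourier f) \<le> C * Lp_norm p lborel f"
  then obtain C where C: "C > 0" "\<forall>f \<in> (test_functions :: (real^4 \<Rightarrow> complex) set).
            Lp_norm q torus_measure (fourier f) \<le> C * Lp_norm p lborel f" by blast
  show "1 \<le> p \<and> p < 4/3 \<and> ereal q \<le> conj_exponent p / 3"
  proof (rule tensor_reduction[OF assms C(2,1)])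
    fix C' :: real
    assume C': "C' > 0" "circle_inequality p q C'"
    have p: "p < 4 / 3"
    proof (rule ccontr)
      assume "\<not> p < 4 / 3"
      then have "fourth_moment \<epsilon> \<le> C' powr (p / (p - 1))" if "\<epsilon> > 0" for \<epsilon>
        using fourth_moment_bounded[OF _ assms(2) C'(2,1) that] by simp
      then show False
        using fourth_moment_unbounded[of "C' powr (p / (p - 1))"] by (meson not_less)
    qed
    moreover have "ereal q \<le> conj_exponent p / 3"
    \<comment> \<open>For \<open>p = 1\<close> the conjugate exponent is infinite and the condition
      on \<open>q\<close> holds automatically; the Knapp example treats
      \<open>p > 1\<close>.\<close>
    proof (cases "p = 1")
      case False
      then have "1 < p" using assms by simp
      from knapp_necessary[OF this assms(2) C'(2,1)] have "q \<le> p / (3 * (p - 1))" .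
      then show ?thesis
        using False by (simp add: conj_exponent_def divide_ereal_def ac_simps divide_simps)
    qed (simp add: conj_exponent_def)
    ultimately show "1 \<le> p \<and> p < 4/3 \<and> ereal q \<le> conj_exponent p / 3"
      using assms by simp
  qed
next
  assume "1 \<le> p \<and> p < 4/3 \<and> ereal q \<le> conj_exponent p / 3"
  then show "\<exists>C>0. \<forall>f \<in> (test_functions :: (real^4 \<Rightarrow> complex) set).
            Lp_norm q torus_measure (fourier f) \<le> C * Lp_norm p lborel f"
    using restriction_sufficient assms by blast
qed


end
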